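(* Fix $\varepsilon\in(0,1]$ and run the algorithm described in the context. Then: (i) the design $\widehat r$ it returns is surrogate-feasible, i.e. $\overline{P}_e(y;\widehat r)\le\alpha_y$ for all $y\in\mathcal{Y}$; (ii) there exists $a_0(\varepsilon)>0$ (depending on $\varepsilon$ and the instance data but not on $\alpha$) such that whenever $\alpha_{\min}:=\min_y\alpha_y\le a_0(\varepsilon)$, \[ C(\widehat r)\le(1+\varepsilon)\,\overline{\mathrm{OPT}}(\alpha); \] (iii) the running time of the algorithm is polynomial in $K$, $\log(1/\alpha_{\min})$ and $1/\varepsilon$ for fixed $L$.
   Context: Setting: $L,K$ positive integers, $\mathcal{Y}=\{1,\dots,L\}$, prior $\pi$ with $\pi(y)>0$; for each model $m\in\{1,\dots,K\}$ a finite alphabet $\mathcal{X}_m$, probability mass functions $p_m(\cdot\mid y)$ on $\mathcal{X}_m$ with $p_m(x\mid y)>0$, and a cost $c_m>0$; pairwise identifiability: for all $y\neq y'$ some $m$ has $p_m(\cdot\mid y)\neq p_m(\cdot\mid y')$. Tolerances $\alpha\in(0,1)^L$. $C(r)=\sum_mc_mr_m$ for $r\in\mathbb{Z}_{\ge0}^K$. Let $M_m^{(y,y')}(s):=\sum_{x}p_m(x\mid y)^{1-s}p_m(x\mid y')^{s}$, $\overline{P}_e(y;r):=\sum_{y'\neq y}\min_{s\in[0,1]}(\pi(y')/\pi(y))^{s}\prod_{m}(M_m^{(y,y')}(s))^{r_m}$, and $\overline{\mathrm{OPT}}(\alpha):=\min\{C(r):r\in\mathbb{Z}_{\ge0}^K,\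 \overline{P}_e(y;r)\le\alpha_y\ \forall y\}$. (Probabilistic model, used only through these definitions: $Y\sim\pi$, and given $Y=y$ the outputs $X_{m,t}$, $t\le r_m$, are independent with law $p_m(\cdot\mid y)$.) Constants: $\mathcal{P}=\{(y,y'):y\neq y'\}$; $\pi_{\min},\pi_{\max}$ the min/max of $\pi$; $c_{\min}=\min_mc_m$, $c_\Sigma=\sum_mc_m$; $B<\infty$ a constant with $|\log(p_m(x\mid y')/p_m(x\mid y))|\le B$ for all $m,y\neq y',x$; $\kappa_{\min}$ the minimum, over $y\neq y'$ and $m$ with $p_m(\cdot\mid y)\neq p_m(\cdot\mid y')$, of $\min\{D_{\mathrm{KL}}(p_m(\cdot\mid y)\|p_m(\cdot\mid y')),D_{\mathrm{KL}}(p_m(\cdot\mid y')\|p_m(\cdot\mid y))\}$; $\delta=\min\{\kappa_{\min}/(4B^2),1/4\}$; $\vartheta=\max_{y\neq y',\,s\in[\delta,1-\delta]}\prod_mM_m^{(y,y')}(s)$; $\rho=\max_{y\neq y'}\min_{s\in[0,1]}\prod_mM_m^{(y,y')}(s)$; $n_{\mathrm{unif}}=\lceil\log(\frac{(L-1)\pi_{\max}}{\pi_{\min}\alpha_{\min}})/(-\log\rho)\rceil$; $k_{\max}=\lceil 2\log2/(-\log\vartheta)\rceil$; $N_{\max}=n_{\mathrm{unif}}c_\Sigma/c_{\min}+k_{\max}K$; $\Lambda=\log(\pi_{\max}/\pi_{\min})+BN_{\max}$. Algorithm: set $h=\log(1+\varepsilon)/\Lambda$, grid $\mathcal{G}_\varepsilon=\{0,h,2h,\dots,\lfloor1/h\rfloor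 h,1\}^{|\mathcal{P}|}$, $\Delta=\log(1+\varepsilon)/N_{\max}$, $T_{\max}=\lceil BN_{\max}/\Delta\rceil$. For each $s=(s_p)_{p\in\mathcal{P}}\in\mathcal{G}_\varepsilon$: set $\widetilde w_{m,p}(s)=\lfloor-\log M_m^{(y,y')}(s_p)/\Delta\rfloor$ for $p=(y,y')$; for $t\in\{0,\dots,T_{\max}\}^{|\mathcal{P}|}$ let $\mathrm{DP}[t]$ be the minimum of $C(r)$ over $r\in\mathbb{Z}_{\ge0}^K$ with $\sum_mr_m\widetilde w_{m,p}(s)\ge t_p$ for all $p$, computed via $\mathrm{DP}[\mathbf 0]=0$ and $\mathrm{DP}[t]=\min_m\{c_m+\mathrm{DP}[(t-\widetilde w_m(s))_+]\}$ (componentwise positive part); pick $t^\dagger(s)$ minimizing $\mathrm{DP}[t]$ among states with $\sum_{y'\neq y}(\pi(y')/\pi(y))^{s_{(y,y')}}e^{-\Delta t_{(y,y')}}\le\alpha_y$ for all $y$, and recover by backtracking a design $r^\dagger(s)$ with $C(r^\dagger(s))=\mathrm{DP}[t^\dagger(s)]$ attaining the state. Return $\widehat r$, the $r^\dagger(s)$ of minimum cost over $s\in\mathcal{G}_\varepsilon$. *)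

theory Defs
  imports Complex_Main "HOL-Library.Extended_Real"
begin

text \<open>
  Labels are \<open>{1..nlabels}\<close>, models are \<open>{1..nmodels}\<close>; \<open>lik I m y x\<close> is the probability
  \<open>p\<^sub>m(x | y)\<close>, and \<open>llr_bound\<close> is the constant \<open>B\<close> bounding the log-likelihood ratios.
\<close>

record 'x ensemble =
  nlabels :: nat
  nmodels :: nat
  prior :: "nat \<Rightarrow> real"
  alphabet :: "nat \<Rightarrow> 'x set"
  lik :: "nat \<Rightarrow> nat \<Rightarrow> 'x \<Rightarrow> real"
  price :: "nat \<Rightarrow> real"
  llr_bound :: real

abbreviation labels :: "('x, 'z) ensemble_scheme \<Rightarrow> nat set" where
  "labels I \<equiv> {1..nlabels I}"

abbreviation models :: "('x, 'z) ensemble_scheme \<Rightarrow> nat set" where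
  "models I \<equiv> {1..nmodels I}"

definition distinguishes :: "'x ensemble \<Rightarrow> nat \<Rightarrow> nat \<Rightarrow> nat \<Rightarrow> bool" where
  "distinguishes I m y y' \<longleftrightarrow> (\<exists>x\<in>alphabet I m. lik I m y x \<noteq> lik I m y' x)"

definition valid_ensemble :: "'x ensemble \<Rightarrow> bool" where
  "valid_ensemble I \<longleftrightarrow>
     1 \<le> nlabels I \<and> 1 \<le> nmodels I \<and>
     (\<forall>y\<in>labels I. 0 < prior I y) \<and> (\<Sum>y\<in>labels I. prior I y) = 1 \<and>
     (\<forall>m\<in>models I. finite (alphabet I m)) \<and>
     (\<forall>m\<in>models I. \<forall>y\<in>labels I.
        (\<forall>x\<in>alphabet I m. 0 < lik I m y x) \<and> (\<Sum>x\<in>alphabet I m. lik I m y x) = 1) \<and>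
     (\<forall>m\<in>models I. 0 < price I m) \<and>
     (\<forall>y\<in>labels I. \<forall>y'\<in>labels I. y \<noteq> y' \<longrightarrow> (\<exists>m\<in>models I. distinguishes I m y y')) \<and>
     (\<forall>m\<in>models I. \<forall>y\<in>labels I. \<forall>y'\<in>labels I. y \<noteq> y' \<longrightarrow>
        (\<forall>x\<in>alphabet I m. \<bar>ln (lik I m y' x / lik I m y x)\<bar> \<le> llr_bound I))"

definition valid_tolerance :: "'x ensemble \<Rightarrow> (nat \<Rightarrow> real) \<Rightarrow> bool" where
  "valid_tolerance I \<alpha> \<longleftrightarrow> (\<forall>y\<in>labels I. 0 < \<alpha> y \<and> \<alpha> y < 1)"

definition tol_min :: "'x ensemble \<Rightarrow> (nat \<Rightarrow> real) \<Rightarrow> real" where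
  "tol_min I \<alpha> = Min (\<alpha> ` labels I)"


section \<open>Surrogate error and surrogate optimum\<close>

text \<open>
  A design is a function \<open>r :: nat \<Rightarrow> nat\<close>, only its values on \<open>models I\<close> matter.  The minima over
  \<open>s \<in> [0,1]\<close> (continuous functions on a compact interval) and over feasible designs (finitely many
  designs below any cost) are attained, so they are written as infima; likewise for the maximum
  over \<open>[\<delta>, 1 - \<delta>]\<close> below.
\<close>

definition cost :: "'x ensemble \<Rightarrow> (nat \<Rightarrow> nat) \<Rightarrow> real" where
  "cost I r = (\<Sum>m\<in>models I. price I m * real (r m))"

definition chern :: "'x ensemble \<Rightarrow> nat \<Rightarrow> nat \<Rightarrow> nat \<Rightarrow> real \<Rightarrow> real" where
  "chern I m y y' s = (\<Sum>x\<in>alphabet I m. lik I m y x powr (1 - s) * lik I m y' x powr s)"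

definition surrogate_error :: "'x ensemble \<Rightarrow> nat \<Rightarrow> (nat \<Rightarrow> nat) \<Rightarrow> real" where
  "surrogate_error I y r =
     (\<Sum>y'\<in>labels I - {y}. INF s\<in>{0..1}.
        (prior I y' / prior I y) powr s * (\<Prod>m\<in>models I. chern I m y y' s ^ r m))"

definition surrogate_feasible :: "'x ensemble \<Rightarrow> (nat \<Rightarrow> real) \<Rightarrow> (nat \<Rightarrow> nat) \<Rightarrow> bool" where
  "surrogate_feasible I \<alpha> r \<longleftrightarrow> (\<forall>y\<in>labels I. surrogate_error I y r \<le> \<alpha> y)"

definition surrogate_opt :: "'x ensemble \<Rightarrow> (nat \<Rightarrow> real) \<Rightarrow> real" where
  "surrogate_opt I \<alpha> = Inf {cost I r | r. surrogate_feasible I \<alpha> r}"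


section \<open>Constants\<close>

definition pair_set :: "'x ensemble \<Rightarrow> (nat \<times> nat) set" where
  "pair_set I = {(y, y'). y \<in> labels I \<and> y' \<in> labels I \<and> y \<noteq> y'}"

definition prior_min :: "'x ensemble \<Rightarrow> real" where
  "prior_min I = Min (prior I ` labels I)"

definition prior_max :: "'x ensemble \<Rightarrow> real" where
  "prior_max I = Max (prior I ` labels I)"

definition price_min :: "'x ensemble \<Rightarrow> real" where
  "price_min I = Min (price I ` models I)"

definition price_max :: "'x ensemble \<Rightarrow> real" where
  "price_max I = Max (price I ` models I)"

definition price_sum :: "'x ensemble \<Rightarrow> real" where
  "price_sum I = (\<Sum>m\<in>models I. price I m)"

definition kl :: "'x ensemble \<Rightarrow> nat \<Rightarrow> nat \<Rightarrow> nat \<Rightarrow> real" where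
  "kl I m y y' = (\<Sum>x\<in>alphabet I m. lik I m y x * ln (lik I m y x / lik I m y' x))"

definition kappa_min :: "'x ensemble \<Rightarrow> real" where
  "kappa_min I = Min {min (kl I m y y') (kl I m y' y) | m y y'.
     m \<in> models I \<and> (y, y') \<in> pair_set I \<and> distinguishes I m y y'}"

definition delta :: "'x ensemble \<Rightarrow> real" where
  "delta I = min (kappa_min I / (4 * (llr_bound I)\<^sup>2)) (1/4)"

definition vartheta :: "'x ensemble \<Rightarrow> real" where
  "vartheta I = Max ((\<lambda>(y, y'). SUP s\<in>{delta I..1 - delta I}. \<Prod>m\<in>models I. chern I m y y' s)
     ` pair_set I)"

definition rho :: "'x ensemble \<Rightarrow> real" where
  "rho I = Max ((\<lambda>(y, y'). INF s\<in>{0..1}. \<Prod>m\<in>models I. chern I m y y' s) ` pair_set I)"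

definition n_unif :: "'x ensemble \<Rightarrow> (nat \<Rightarrow> real) \<Rightarrow> int" where
  "n_unif I \<alpha> =
     \<lceil>ln ((real (nlabels I) - 1) * prior_max I / (prior_min I * tol_min I \<alpha>)) / (- ln (rho I))\<rceil>"

definition k_max :: "'x ensemble \<Rightarrow> int" where
  "k_max I = \<lceil>2 * ln 2 / (- ln (vartheta I))\<rceil>"

definition N_max :: "'x ensemble \<Rightarrow> (nat \<Rightarrow> real) \<Rightarrow> real" where
  "N_max I \<alpha> = of_int (n_unif I \<alpha>) * price_sum I / price_min I + of_int (k_max I) * real (nmodels I)"

definition Lambda :: "'x ensemble \<Rightarrow> (nat \<Rightarrow> real) \<Rightarrow> real" where
  "Lambda I \<alpha> = ln (prior_max I / prior_min I) + llr_bound I * N_max I \<alpha>"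

definition step_h :: "'x ensemble \<Rightarrow> (nat \<Rightarrow> real) \<Rightarrow> real \<Rightarrow> real" where
  "step_h I \<alpha> \<epsilon> = ln (1 + \<epsilon>) / Lambda I \<alpha>"

definition step_Delta :: "'x ensemble \<Rightarrow> (nat \<Rightarrow> real) \<Rightarrow> real \<Rightarrow> real" where
  "step_Delta I \<alpha> \<epsilon> = ln (1 + \<epsilon>) / N_max I \<alpha>"

definition T_max :: "'x ensemble \<Rightarrow> (nat \<Rightarrow> real) \<Rightarrow> real \<Rightarrow> nat" where
  "T_max I \<alpha> \<epsilon> = nat \<lceil>llr_bound I * N_max I \<alpha> / step_Delta I \<alpha> \<epsilon>\<rceil>"


section \<open>Nondeterministic computations with operation counts\<close>

text \<open>
  A computation is the set of its possible outcomes, each a result together with the number of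
  elementary steps spent.  The nondeterminism is that of breaking ties in a minimisation.  The
  machine model is the real RAM: arithmetic, comparison, rounding, \<open>exp\<close>, \<open>ln\<close> and \<open>powr\<close> on reals
  and access to an array cell cost a bounded number of steps, and handling a vector (also as an
  index into a multidimensional array) costs its length.
\<close>

type_synonym 'a comp = "('a \<times> nat) set"

definition charge :: "nat \<Rightarrow> 'a \<Rightarrow> 'a comp" where
  "charge n x = {(x, n)}"

definition andthen :: "'a comp \<Rightarrow> ('a \<Rightarrow> 'b comp) \<Rightarrow> 'b comp"  (infixr \<open>\<Zsemi>\<close> 54) where
  "(F \<Zsemi> G) = {(z, a + b) | z a b. \<exists>x. (x, a) \<in> F \<and> (z, b) \<in> G x}"

text \<open>\<open>k\<close> is the cost of evaluating the objective once.\<close>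

definition argmin :: "nat \<Rightarrow> ('a \<Rightarrow> 'b::linorder) \<Rightarrow> 'a list \<Rightarrow> 'a comp" where
  "argmin k f xs = {(x, k * length xs) | x. x \<in> set xs \<and> (\<forall>z\<in>set xs. f x \<le> f z)}"

primrec loop :: "('a \<Rightarrow> 'b \<Rightarrow> 'b comp) \<Rightarrow> 'a list \<Rightarrow> 'b \<Rightarrow> 'b comp" where
  "loop F [] b = charge 1 b"
| "loop F (x # xs) b = charge 1 () \<Zsemi> (\<lambda>_. F x b \<Zsemi> loop F xs)"


section \<open>The algorithm\<close>

text \<open>Vectors indexed by ordered pairs of distinct labels are lists aligned with \<open>pairs\<close>.\<close>

definition pairs :: "'x ensemble \<Rightarrow> (nat \<times> nat) list" where
  "pairs I = [(y, y'). y \<leftarrow> [1..<nlabels I + 1], y' \<leftarrow> [1..<nlabels I + 1], y \<noteq> y']"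

definition entry :: "'x ensemble \<Rightarrow> 'a list \<Rightarrow> nat \<times> nat \<Rightarrow> 'a" where
  "entry I v q = the (map_of (zip (pairs I) v) q)"

definition grid :: "'x ensemble \<Rightarrow> real \<Rightarrow> real list list" where
  "grid I h = List.n_lists (length (pairs I)) (map (\<lambda>k. real k * h) [0..<nat \<lfloor>1 / h\<rfloor> + 1] @ [1])"

text \<open>
  This enumeration lists \<open>t'\<close> before \<open>t\<close> whenever \<open>t'\<close> is componentwise below \<open>t\<close> and distinct
  from it.
\<close>

definition states :: "'x ensemble \<Rightarrow> nat \<Rightarrow> nat list list" where
  "states I T = List.n_lists (length (pairs I)) [0..<T + 1]"

definition weights :: "'x ensemble \<Rightarrow> real \<Rightarrow> real list \<Rightarrow> nat \<Rightarrow> nat list" where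
  "weights I \<Delta> s m = map2 (\<lambda>(y, y') u. nat \<lfloor>- ln (chern I m y y' u) / \<Delta>\<rfloor>) (pairs I) s"

text \<open>Subtraction on \<open>nat\<close> is truncated, so this is the componentwise positive part \<open>(t - w)\<^sub>+\<close>.\<close>

definition residual :: "nat list \<Rightarrow> nat list \<Rightarrow> nat list" where
  "residual t w = map2 (-) t w"

text \<open>
  A table holds for each state \<open>t\<close> the value \<open>DP[t]\<close> and a model attaining the minimum in the
  recurrence.  The value is \<open>\<infinity>\<close> if no design reaches \<open>t\<close>.  A model with \<open>(t - w)\<^sub>+ = t\<close> would refer
  \<open>DP[t]\<close> to itself; it is left out of the minimum, to which it cannot contribute because prices
  are positive.
\<close>

type_synonym table = "nat list \<Rightarrow> ereal \<times> nat"

definition dp_step :: "'x ensemble \<Rightarrow> (nat \<Rightarrow> nat list) \<Rightarrow> nat list \<Rightarrow> table \<Rightarrow> table comp" where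
  "dp_step I w t D =
     (let n = length t + 1;
          val = (\<lambda>m. ereal (price I m) + fst (D (residual t (w m))));
          ms = [m \<leftarrow> [1..<nmodels I + 1]. residual t (w m) \<noteq> t]
      in if \<forall>i\<in>set t. i = 0 then charge n (D(t := (0, 0)))
         else charge (nmodels I * n) () \<Zsemi> (\<lambda>_.
           if ms = [] then charge n (D(t := (\<infinity>, 0)))
           else argmin n val ms \<Zsemi> (\<lambda>m. charge n (D(t := (val m, m))))))"

definition admissible ::
  "'x ensemble \<Rightarrow> (nat \<Rightarrow> real) \<Rightarrow> real \<Rightarrow> real list \<Rightarrow> nat list \<Rightarrow> bool" where
  "admissible I \<alpha> \<Delta> s t \<longleftrightarrow>
     (\<forall>y\<in>labels I. (\<Sum>y'\<in>labels I - {y}.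
        (prior I y' / prior I y) powr entry I s (y, y') * exp (- \<Delta> * real (entry I t (y, y')))) \<le> \<alpha> y)"

text \<open>
  Every model stored in the table at a state \<open>t \<noteq> 0\<close> of finite value makes the residual strictly
  smaller, so the loop ends exactly at \<open>t = 0\<close>.
\<close>

function backtrack ::
  "(nat \<Rightarrow> nat list) \<Rightarrow> table \<Rightarrow> nat list \<Rightarrow> (nat \<Rightarrow> nat) \<Rightarrow> (nat \<Rightarrow> nat) comp" where
  "backtrack w D t r =
     (let m = snd (D t); t' = residual t (w m)
      in if sum_list t' < sum_list t
         then charge (length t + 1) () \<Zsemi> (\<lambda>_. backtrack w D t' (r(m := r m + 1)))
         else charge (length t + 1) r)"
  by pat_completeness auto
termination
  by (relation "measure (\<lambda>(w, D, t, r). sum_list t)") auto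

declare backtrack.simps [simp del]

definition solve_at ::
  "'x ensemble \<Rightarrow> (nat \<Rightarrow> real) \<Rightarrow> real \<Rightarrow> nat \<Rightarrow> real list \<Rightarrow> (nat \<Rightarrow> nat) option comp" where
  "solve_at I \<alpha> \<Delta> T s =
     (let n = length (pairs I) + 1;
          w = weights I \<Delta> s;
          ts = states I T
      in charge (\<Sum>m\<in>models I. n * (card (alphabet I m) + 1)) () \<Zsemi> (\<lambda>_.
         loop (dp_step I w) ts (\<lambda>_. (\<infinity>, 0)) \<Zsemi> (\<lambda>D.
         charge (n * length ts) [t \<leftarrow> ts. admissible I \<alpha> \<Delta> s t \<and> fst (D t) < \<infinity>] \<Zsemi> (\<lambda>cs.
         if cs = [] then charge 1 None
         else argmin n (\<lambda>t. fst (D t)) cs \<Zsemi> (\<lambda>t.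
              backtrack w D t (\<lambda>_. 0) \<Zsemi> (\<lambda>r. charge (nmodels I) (Some r)))))))"

text \<open>
  The instance constants, including \<open>\<rho>\<close>, \<open>\<vartheta>\<close> and \<open>B\<close>, are inputs of the algorithm; the quantities
  depending on the tolerances and on \<open>\<epsilon>\<close> are computed from them in the first step.  The result
  \<open>None\<close> stands for a run that finds no design.
\<close>

definition algorithm ::
  "'x ensemble \<Rightarrow> (nat \<Rightarrow> real) \<Rightarrow> real \<Rightarrow> (nat \<Rightarrow> nat) option comp" where
  "algorithm I \<alpha> \<epsilon> =
     (let h = step_h I \<alpha> \<epsilon>; \<Delta> = step_Delta I \<alpha> \<epsilon>; T = T_max I \<alpha> \<epsilon>
      in charge (nlabels I + nmodels I) () \<Zsemi> (\<lambda>_.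
         loop (\<lambda>s rs. charge (length s) () \<Zsemi> (\<lambda>_. solve_at I \<alpha> \<Delta> T s \<Zsemi> (\<lambda>res.
                charge 1 (case res of None \<Rightarrow> rs | Some r \<Rightarrow> r # rs))))
           (grid I h) [] \<Zsemi> (\<lambda>rs.
         if rs = [] then charge 1 None
         else argmin (nmodels I) (cost I) rs \<Zsemi> (\<lambda>r. charge 1 (Some r)))))"


section \<open>Families of ensembles with uniformly bounded data\<close>

text \<open>
  Polynomial growth in the number of models only makes sense over a family of ensembles in which
  that number varies.  The remaining instance data are kept in fixed bounds.
\<close>

definition data_bounded :: "real \<Rightarrow> real \<Rightarrow> real \<Rightarrow> real \<Rightarrow> nat \<Rightarrow> 'x ensemble \<Rightarrow> bool" where
  "data_bounded b \<kappa> \<gamma> \<tau> a I \<longleftrightarrow>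
     llr_bound I \<le> b \<and> \<kappa> \<le> kappa_min I \<and> price_max I \<le> \<gamma> * price_min I \<and>
     prior_max I \<le> \<tau> * prior_min I \<and> (\<forall>m\<in>models I. card (alphabet I m) \<le> a)"

end

theory Submission
  imports Defs "HOL-Analysis.Convex"
begin

text \<open>
  The dynamic program returns, for every grid point, a cheapest design whose rounded-down weights
  certify feasibility, so the output is feasible and at most as expensive as any design that passes
  the rounded test at some grid point.

  Rounding the exponent \<open>s\<close> to the grid and the weights to multiples of \<open>\<Delta>\<close> loses a factor of at most
  \<open>(1 + \<epsilon>)\<^sup>2 \<le> 4\<close> for designs with at most \<open>N_max\<close> samples.  It is paid for by \<open>k_max\<close> further samples
  of every model, which gain a factor \<open>\<vartheta>^k_max \<le> 1/4\<close> if \<open>s \<in> [\<delta>, 1 - \<delta>]\<close>.  By the choice of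
  \<open>\<delta>\<close>, the Chernoff sum of a distinguishing model decreases on \<open>[0, \<delta>]\<close> at a rate of at least
  \<open>\<kappa>_min/2\<close>, so a minimiser lies in this interval once the pair receives enough distinguishing
  samples to outweigh the prior ratio.  For the uniform design the prior plays no role, and the
  algorithm always finds a design.  Pairs with few distinguishing samples give finitely many
  objectives, and there the rounding loss tends to 0 with \<open>\<alpha>_min\<close>.  Finally, the \<open>k_max\<close> extra samples
  cost a fixed amount, whereas the optimum is unbounded as \<open>\<alpha>_min\<close> tends to 0.
\<close>

section \<open>Computations\<close>

text \<open>The obstacle is the location of the minimising exponent. The gain from extra samples is
  uniform only on [\<open>delta\<close>, 1 - \<open>delta\<close>], but for an uneven prior and few
  distinguishing samples the minimum of c^s times the Chernoff product can lie near 0 or 1, or at an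
  end, where extra samples gain little or nothing. No bound in terms of \<open>vartheta\<close>
  covers such a pair, so the threshold on \<alpha> comes from a finiteness argument and has no
  closed form. The finiteness holds for each pair separately: the total number of samples is
  unbounded, and only the samples that distinguish the pair can be assumed few.

  The other constraint is the budget \<open>N_max\<close>, since the step sizes control the rounding
  loss only for designs within it. A design that costs no more than the uniform one has at most
  \<open>n_unif\<close> * \<open>price_sum\<close> / \<open>price_min\<close> samples, and the
  second summand of \<open>N_max\<close> leaves room for the extra samples. A costlier feasible
  design is compared through the uniform one.\<close>

lemma mem_charge [simp]: "(z, n) \<in> charge k x \<longleftrightarrow> z = x \<and> n = k"
  by (auto simp: charge_def)

lemma mem_andthen:
  "(z, n) \<in> (F \<Zsemi> G) \<longleftrightarrow> (\<exists>x a b. (x, a) \<in> F \<and> (z, b) \<in> G x \<and> n = a + b)"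
  by (auto simp: andthen_def)

lemma mem_charge_andthen [simp]:
  "(z, n) \<in> (charge k x \<Zsemi> G) \<longleftrightarrow> (\<exists>b. (z, b) \<in> G x \<and> n = k + b)"
  by (auto simp: mem_andthen)

lemma mem_argmin:
  "(x, n) \<in> argmin k f xs \<longleftrightarrow> n = k * length xs \<and> x \<in> set xs \<and> (\<forall>z\<in>set xs. f x \<le> f z)"
  by (auto simp: argmin_def)

lemma charge_nonempty [simp]: "charge k x \<noteq> {}"
  by (simp add: charge_def)

text \<open>A claim about all outcomes of a run is empty if there are none, so the existence of
  outcomes is tracked separately. Asking it of \<open>G\<close> at every argument, reachable or not,
  keeps these proofs purely structural.\<close>

lemma andthen_nonempty:
  assumes "F \<noteq> {}" and "\<And>x. G x \<noteq> {}"
  shows "(F \<Zsemi> G) \<noteq> {}"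
  using assms by (fastforce simp: andthen_def)

lemma if_nonempty:
  "(b \<Longrightarrow> F \<noteq> {}) \<Longrightarrow> (\<not> b \<Longrightarrow> G \<noteq> {}) \<Longrightarrow> (if b then F else G) \<noteq> {}"
  by simp

lemmas comp_nonempty = andthen_nonempty if_nonempty charge_nonempty

lemma argmin_nonempty:
  assumes "xs \<noteq> []"
  shows "argmin k f xs \<noteq> {}"
proof -
  have "Min (f ` set xs) \<in> f ` set xs" using assms by simp
  then obtain x where "x \<in> set xs" "f x = Min (f ` set xs)" by auto
  then have "(x, k * length xs) \<in> argmin k f xs" by (auto simp: mem_argmin)
  then show ?thesis by blast
qed

lemma loop_nonempty:
  assumes "\<And>x b. F x b \<noteq> {}"
  shows "loop F xs b \<noteq> {}"
proof (induction xs arbitrary: b)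
  case Nil
  then show ?case by simp
next
  case (Cons x xs)
  show ?case unfolding loop.simps by (intro comp_nonempty assms Cons.IH)
qed

lemma loop_steps_le:
  assumes "\<And>x b z n. x \<in> set xs \<Longrightarrow> (z, n) \<in> F x b \<Longrightarrow> n \<le> c"
    and "(z, n) \<in> loop F xs b"
  shows "n \<le> length xs * (c + 1) + 1"
  using assms
proof (induction xs arbitrary: b n)
  case Nil
  then show ?case by simp
next
  case (Cons x xs)
  from Cons.prems(2) obtain b' n1 n2 where
    "(b', n1) \<in> F x b" "(z, n2) \<in> loop F xs b'" "n = Suc (n1 + n2)"
    by (auto simp: mem_andthen)
  moreover from this have "n1 \<le> c" "n2 \<le> length xs * (c + 1) + 1"
    using Cons.prems(1) Cons.IH[of n2 b'] by auto
  ultimately show ?case by simp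
qed


section \<open>Pairs and enumerations\<close>

lemma set_pairs [simp]: "set (pairs I) = pair_set I"
  by (auto simp: pairs_def pair_set_def)

text \<open>Makes \<open>entry\<close> agree with access by position: of a repeated pair,
  \<open>map_of\<close> would only see the first occurrence.\<close>

lemma distinct_pairs: "distinct (pairs I)"
proof -
  have filt: "concat (map (\<lambda>y'. if y \<noteq> y' then [(y, y')] else []) zs)
      = map (Pair y) (filter (\<lambda>y'. y \<noteq> y') zs)" for y and zs :: "nat list"
    by (induction zs) auto
  have eq: "pairs I = concat (map (\<lambda>y. map (Pair y) (filter (\<lambda>y'. y \<noteq> y') [1..<nlabels I + 1]))
      [1..<nlabels I + 1])"
    unfolding pairs_def filt ..
  have aux: "distinct (concat (map (\<lambda>y. map (Pair y) (filter (\<lambda>y'. y \<noteq> y') zs)) xs))"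
    if "distinct xs" "distinct zs" for xs zs :: "nat list"
    using that by (induction xs) (auto simp: distinct_map inj_on_def)
  show ?thesis unfolding eq by (rule aux) auto
qed

lemma length_pairs: "length (pairs I) = nlabels I * (nlabels I - 1)"
proof -
  have "length (pairs I) = card (pair_set I)"
    using distinct_card[OF distinct_pairs, of I] by simp
  also have "pair_set I = (SIGMA y:labels I. labels I - {y})"
    by (auto simp: pair_set_def)
  also have "card \<dots> = nlabels I * (nlabels I - 1)"
    by (subst card_SigmaI) auto
  finally show ?thesis .
qed

lemma entry_map_pairs: "p \<in> pair_set I \<Longrightarrow> entry I (map f (pairs I)) p = f p"
  by (simp add: entry_def map_of_zip_map)

lemma entry_nth:
  assumes "i < length (pairs I)" "length v = length (pairs I)"
  shows "entry I v (pairs I ! i) = v ! i"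
  unfolding entry_def using assms
  by (subst map_of_zip_nth) (auto simp: distinct_pairs)

lemma length_weights [simp]:
  "length s = length (pairs I) \<Longrightarrow> length (weights I \<Delta> s m) = length (pairs I)"
  by (simp add: weights_def)

lemma weights_nth:
  assumes "i < length (pairs I)" "length s = length (pairs I)"
  shows "weights I \<Delta> s m ! i =
    nat \<lfloor>- ln (chern I m (fst (pairs I ! i)) (snd (pairs I ! i)) (s ! i)) / \<Delta>\<rfloor>"
  using assms by (simp add: weights_def split_beta)

lemma mem_states: "t \<in> set (states I T) \<longleftrightarrow> length t = length (pairs I) \<and> (\<forall>i\<in>set t. i \<le> T)"
  by (auto simp: states_def set_n_lists)

lemma length_residual [simp]: "length (residual t w) = min (length t) (length w)"
  by (simp add: residual_def)

lemma residual_nth [simp]: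
  "i < length t \<Longrightarrow> i < length w \<Longrightarrow> residual t w ! i = t ! i - w ! i"
  by (simp add: residual_def)

lemma residual_le:
  assumes "length w = length t"
  shows "list_all2 (\<le>) (residual t w) t"
  using assms by (auto simp: list_all2_conv_all_nth)

text \<open>The sum of a state is the measure of all recursions over states: it drops strictly
  whenever a residual differs from its state.\<close>

lemma sum_list_mono2:
  fixes t :: "nat list"
  assumes "list_all2 (\<le>) t' t"
  shows "sum_list t' \<le> sum_list t" "t' \<noteq> t \<Longrightarrow> sum_list t' < sum_list t"
proof -
  show "sum_list t' \<le> sum_list t"
    using assms by (induction rule: list_all2_induct) auto
  show "sum_list t' < sum_list t" if "t' \<noteq> t"
    using assms that
  proof (induction rule: list_all2_induct)
    case (Cons x xs y ys)
    then show ?case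
      by (cases "xs = ys") (auto intro: add_le_less_mono)
  qed simp
qed

lemma residual_mem_states:
  assumes "t \<in> set (states I T)" "length w = length t"
  shows "residual t w \<in> set (states I T)"
proof -
  have "residual t w ! i \<le> T" if "i < length t" for i
    using assms that by (auto simp: mem_states intro: le_trans[OF diff_le_self])
  then have "i \<le> T" if "i \<in> set (residual t w)" for i
    using assms that by (auto simp: in_set_conv_nth[of _ "residual t w"])
  then show ?thesis
    using assms by (simp add: mem_states)
qed

text \<open>\<open>List.n_lists\<close> varies the head fastest. Within a block the tails agree and
  the heads increase; across blocks the tails already violate the componentwise order.\<close>

lemma sorted_wrt_n_lists:
  "sorted_wrt (\<lambda>a b. \<not> list_all2 (\<le>) b a) (List.n_lists n [0..<T :: nat])"
proof (induction n)
  case (Suc n)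
  have block: "sorted_wrt (\<lambda>a b. \<not> list_all2 (\<le>) b a) (map (\<lambda>y. y # ys) [0..<T])" for ys
    unfolding sorted_wrt_map by (rule sorted_wrt_mono_rel[OF _ sorted_wrt_upt]) auto
  have "sorted_wrt (\<lambda>a b. \<not> list_all2 (\<le>) b a)
      (concat (map (\<lambda>ys. map (\<lambda>y. y # ys) [0..<T]) zs))"
    if "sorted_wrt (\<lambda>a b. \<not> list_all2 (\<le>) b a) zs" for zs
    using that
  proof (induction zs)
    case (Cons z zs)
    then show ?case by (auto simp: sorted_wrt_append block)
  qed simp
  from this[OF Suc.IH] show ?case by simp
qed simp

lemma sorted_wrt_states: "sorted_wrt (\<lambda>a b. \<not> list_all2 (\<le>) b a) (states I T)"
  unfolding states_def by (rule sorted_wrt_n_lists)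


section \<open>Correctness of the dynamic program\<close>

definition reaches :: "'x ensemble \<Rightarrow> (nat \<Rightarrow> nat list) \<Rightarrow> (nat \<Rightarrow> nat) \<Rightarrow> nat list \<Rightarrow> bool" where
  "reaches I w r t \<longleftrightarrow> (\<forall>i<length t. t ! i \<le> (\<Sum>m\<in>models I. r m * (w m ! i)))"

text \<open>The recurrence as a property of a finished table, independent of the order in which its
  cells were filled. The inequality keeps values below the cost of every design; the alternative
  after it is what lets \<open>backtrack\<close> realise a finite value.\<close>

definition bellman :: "'x ensemble \<Rightarrow> (nat \<Rightarrow> nat list) \<Rightarrow> table \<Rightarrow> nat list \<Rightarrow> bool" where
  "bellman I w D t \<longleftrightarrow>
     (if \<forall>i\<in>set t. i = 0 then D t = (0, 0)
      else (\<forall>m\<in>models I. residual t (w m) \<noteq> t \<longrightarrow>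
              fst (D t) \<le> ereal (price I m) + fst (D (residual t (w m)))) \<and>
           (fst (D t) = \<infinity> \<or> snd (D t) \<in> models I \<and> residual t (w (snd (D t))) \<noteq> t \<and>
              fst (D t) = ereal (price I (snd (D t))) + fst (D (residual t (w (snd (D t)))))))"

lemma dp_step_bellman:
  assumes "(D', n) \<in> dp_step I w t D"
  shows "bellman I w D' t" "\<And>t'. t' \<noteq> t \<Longrightarrow> D' t' = D t'"
    "n \<le> (2 * nmodels I + 1) * (length t + 1)"
proof -
  define val where "val = (\<lambda>m. ereal (price I m) + fst (D (residual t (w m))))"
  define ms where "ms = [m \<leftarrow> [1..<nmodels I + 1]. residual t (w m) \<noteq> t]"
  have len: "length ms \<le> nmodels I"
    using length_filter_le[of "\<lambda>m. residual t (w m) \<noteq> t" "[1..<nmodels I + 1]"]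
    unfolding ms_def length_upt by simp
  have set_ms: "m \<in> set ms \<longleftrightarrow> m \<in> models I \<and> residual t (w m) \<noteq> t" for m
    by (auto simp: ms_def)
  consider (zero) "\<forall>i\<in>set t. i = 0" "D' = D(t := (0, 0))" "n = length t + 1"
    | (none) "\<not> (\<forall>i\<in>set t. i = 0)" "ms = []" "D' = D(t := (\<infinity>, 0))"
        "n = nmodels I * (length t + 1) + (length t + 1)"
    | (min) m where "\<not> (\<forall>i\<in>set t. i = 0)" "m \<in> set ms" "\<forall>m'\<in>set ms. val m \<le> val m'"
        "D' = D(t := (val m, m))"
        "n = nmodels I * (length t + 1) + ((length t + 1) * length ms + (length t + 1))"
    using assms unfolding dp_step_def Let_def val_def[symmetric] ms_def[symmetric]
    by (auto simp: mem_andthen mem_argmin simp del: split_paired_Ex split: if_splits)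
  note cases = this
  show "D' t' = D t'" if "t' \<noteq> t" for t'
    using cases that by cases auto
  show "bellman I w D' t"
    using cases
  proof cases
    case zero
    then show ?thesis by (auto simp: bellman_def)
  next
    case none
    then have "\<not> (m \<in> models I \<and> residual t (w m) \<noteq> t)" for m
      using set_ms[of m] by simp
    then show ?thesis using none by (auto simp: bellman_def)
  next
    case (min m)
    \<comment> \<open>Models in \<open>ms\<close> have a residual other than \<open>t\<close>, so
      the update at \<open>t\<close> does not affect the values from which the minimum was
      taken.\<close>
    then show ?thesis using set_ms by (auto simp: bellman_def val_def)
  qed
  define l where "l = length t + 1"
  have "(2 * nmodels I + 1) * l = nmodels I * l + (l * nmodels I + l)"
    by (simp add: algebra_simps)
  moreover have "l * length ms \<le> l * nmodels I"
    using len by (rule mult_le_mono2)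
  moreover have "n = l \<or> n = nmodels I * l + l \<or> n = nmodels I * l + (l * length ms + l)"
    using cases unfolding l_def by cases blast+
  ultimately show "n \<le> (2 * nmodels I + 1) * (length t + 1)"
    unfolding l_def[symmetric] by linarith
qed

lemma dp_step_nonempty: "dp_step I w t D \<noteq> {}"
  unfolding dp_step_def Let_def
  by (intro comp_nonempty argmin_nonempty)

lemma bellman_cong:
  assumes "D' t = D t" "\<And>m. D' (residual t (w m)) = D (residual t (w m))"
  shows "bellman I w D' t \<longleftrightarrow> bellman I w D t"
  unfolding bellman_def assms ..

text \<open>Filling the cell \<open>t\<close> cannot spoil an equation established earlier: such an
  equation reads only cells componentwise below an earlier state, and by the order of enumeration
  \<open>t\<close> is below none of these. The list \<open>pre\<close> holds the states already
  done.\<close>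

lemma loop_dp_step_bellman:
  assumes "(D', n) \<in> loop (dp_step I w) post D"
    and "sorted_wrt (\<lambda>a b. \<not> list_all2 (\<le>) b a) (pre @ post)"
    and "\<And>t m. t \<in> set (pre @ post) \<Longrightarrow> length (w m) = length t"
    and "\<And>t. t \<in> set pre \<Longrightarrow> bellman I w D t"
  shows "\<forall>t\<in>set (pre @ post). bellman I w D' t"
  using assms
proof (induction post arbitrary: pre D n)
  case Nil
  then show ?case by simp
next
  case (Cons t post)
  from Cons.prems(1) obtain D1 n1 n2 where
    D1: "(D1, n1) \<in> dp_step I w t D" and D': "(D', n2) \<in> loop (dp_step I w) post D1"
    by (auto simp: mem_andthen)
  have old: "bellman I w D1 t'" if t': "t' \<in> set pre" for t'
  proof -
    have "\<not> list_all2 (\<le>) t t'"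
      using Cons.prems(2) t' by (auto simp: sorted_wrt_append)
    moreover have "list_all2 (\<le>) t' t'" by (simp add: list_all2_refl)
    moreover have "list_all2 (\<le>) (residual t' (w m)) t'" for m
      using Cons.prems(3)[of t' m] t' by (intro residual_le) auto
    ultimately have "t' \<noteq> t" "residual t' (w m) \<noteq> t" for m
      by metis+
    then show ?thesis
      using bellman_cong[of D1 t' D w I] Cons.prems(4)[OF t'] dp_step_bellman(2)[OF D1] by simp
  qed
  have "\<forall>t'\<in>set ((pre @ [t]) @ post). bellman I w D' t'"
  proof (rule Cons.IH[OF D'])
    show "bellman I w D1 t'" if "t' \<in> set (pre @ [t])" for t'
      using that old dp_step_bellman(1)[OF D1] by auto
  qed (use Cons.prems in auto)
  then show ?case by simp
qed

lemma cost_nonneg: "(\<And>m. m \<in> models I \<Longrightarrow> 0 < price I m) \<Longrightarrow> 0 \<le> cost I r"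
  unfolding cost_def by (intro sum_nonneg) (auto simp: less_imp_le)

lemma cost_upd:
  assumes "m \<in> models I"
  shows "cost I (r(m := r m + 1)) = price I m + cost I r"
proof -
  have "cost I (r(m := r m + 1)) = (\<Sum>j\<in>models I. price I j * real (r j) + (if j = m then price I m else 0))"
    unfolding cost_def by (intro sum.cong) (auto simp: algebra_simps)
  then show ?thesis using assms by (simp add: sum.distrib cost_def)
qed

lemma sum_mult_upd:
  fixes r v :: "nat \<Rightarrow> nat"
  assumes "m \<in> models I"
  shows "(\<Sum>j\<in>models I. (r(m := r m + 1)) j * v j) = v m + (\<Sum>j\<in>models I. r j * v j)"
proof -
  have "(\<Sum>j\<in>models I. (r(m := r m + 1)) j * v j)
      = (\<Sum>j\<in>models I. r j * v j + (if j = m then v m else 0))"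
    by (intro sum.cong) auto
  then show ?thesis using assms by (simp add: sum.distrib)
qed

text \<open>A design that reaches a nonzero state uses some model of positive weight at a positive
  entry. Dropping one sample of that model leaves a design that reaches the residual, which has a
  smaller sum.\<close>

lemma bellman_le_cost:
  assumes price: "\<And>m. m \<in> models I \<Longrightarrow> 0 < price I m"
    and len: "\<And>m. length (w m) = length (pairs I)"
    and D: "\<forall>t\<in>set (states I T). bellman I w D t"
    and "t \<in> set (states I T)" "reaches I w r t"
  shows "fst (D t) \<le> ereal (cost I r)"
  using assms(4,5)
proof (induction "sum_list t" arbitrary: t r rule: less_induct)
  case less
  have bt: "bellman I w D t" using D less.prems by blast
  have lt: "length t = length (pairs I)" using less.prems(1) by (simp add: mem_states)
  show ?case
  proof (cases "\<forall>i\<in>set t. i = 0")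
    case True
    then show ?thesis using bt cost_nonneg[OF price] by (simp add: bellman_def)
  next
    case False
    then obtain i where i: "i < length t" "t ! i > 0" by (auto simp: in_set_conv_nth)
    then have "0 < (\<Sum>m\<in>models I. r m * (w m ! i))"
      using less.prems(2) unfolding reaches_def by (meson less_le_trans)
    then have "(\<Sum>m\<in>models I. r m * (w m ! i)) \<noteq> 0" by linarith
    then obtain m where m: "m \<in> models I" "r m * (w m ! i) \<noteq> 0"
      by (meson sum.not_neutral_contains_not_neutral)
    then have rm: "r m > 0" "w m ! i > 0" by auto
    have "residual t (w m) ! i \<noteq> t ! i" using i rm lt len by simp
    then have ne: "residual t (w m) \<noteq> t" by metis
    define r' where "r' = r(m := r m - 1)"
    have r: "r = r'(m := r' m + 1)" using rm by (auto simp: r'_def)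
    have mem: "residual t (w m) \<in> set (states I T)"
      using residual_mem_states less.prems(1) lt len by metis
    have "reaches I w r' (residual t (w m))"
      unfolding reaches_def
    proof (intro allI impI)
      fix j assume j: "j < length (residual t (w m))"
      then have j': "j < length t" "j < length (w m)" by auto
      have "t ! j \<le> (\<Sum>k\<in>models I. r k * (w k ! j))"
        using less.prems(2) j' by (simp add: reaches_def)
      also have "\<dots> = w m ! j + (\<Sum>k\<in>models I. r' k * (w k ! j))"
        using sum_mult_upd[OF m(1), of r' "\<lambda>k. w k ! j"] r by metis
      finally show "residual t (w m) ! j \<le> (\<Sum>k\<in>models I. r' k * (w k ! j))"
        using j' by simp
    qed
    moreover have "sum_list (residual t (w m)) < sum_list t"
      using sum_list_mono2(2)[OF residual_le ne] lt len by simp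
    ultimately have IH: "fst (D (residual t (w m))) \<le> ereal (cost I r')"
      using less.hyps mem by blast
    have "fst (D t) \<le> ereal (price I m) + fst (D (residual t (w m)))"
      using bt False m(1) ne by (auto simp: bellman_def)
    also have "\<dots> \<le> ereal (price I m) + ereal (cost I r')"
      using IH by (rule add_left_mono)
    also have "\<dots> = ereal (cost I r)"
      using cost_upd[OF m(1), of r'] r by simp
    finally show ?thesis .
  qed
qed

lemma backtrack_nonempty: "backtrack w D t r \<noteq> {}"
proof (induction w D t r rule: backtrack.induct)
  case (1 w D t r)
  let ?m = "snd (D t)"
  have "backtrack w D (residual t (w ?m)) (r(?m := r ?m + 1)) \<noteq> {}"
    if "sum_list (residual t (w ?m)) < sum_list t"
    by (rule 1) (use that in auto)
  then show ?case
    unfolding backtrack.simps[of w D t] Let_def by (intro comp_nonempty)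
qed

text \<open>Each recursive call lowers the sum of the state by at least one.\<close>

lemma backtrack_steps_le:
  assumes "(r', n) \<in> backtrack w D t r" "\<And>m. length (w m) = length t"
  shows "n \<le> (sum_list t + 1) * (length t + 1)"
  using assms
proof (induction "sum_list t" arbitrary: t r n rule: less_induct)
  case less
  let ?t = "residual t (w (snd (D t)))"
  show ?case
  proof (cases "sum_list ?t < sum_list t")
    case True
    then obtain b where b: "(r', b) \<in> backtrack w D ?t (r(snd (D t) := r (snd (D t)) + 1))"
      "n = length t + 1 + b"
      using less.prems(1) by (subst (asm) backtrack.simps) (auto simp: Let_def)
    have "b \<le> (sum_list ?t + 1) * (length ?t + 1)"
      by (rule less.hyps[OF True b(1)]) (use less.prems(2) in simp)
    also have "length ?t = length t" using less.prems(2) by simp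
    also have "(sum_list ?t + 1) * (length t + 1) \<le> sum_list t * (length t + 1)"
      using True by (intro mult_right_mono) auto
    finally show ?thesis using b(2) by simp
  next
    case False
    then show ?thesis using less.prems(1) by (subst (asm) backtrack.simps) (auto simp: Let_def)
  qed
qed

text \<open>The accumulator \<open>r\<close> occurs in both claims so that the induction goes
  through: the table value is what remains to be paid, and \<open>t\<close> is what remains to be
  reached.\<close>

lemma backtrack_correct:
  assumes len: "\<And>m. length (w m) = length (pairs I)"
    and D: "\<forall>t\<in>set (states I T). bellman I w D t"
    and "t \<in> set (states I T)" "fst (D t) < \<infinity>" "(r', n) \<in> backtrack w D t r"
  shows "ereal (cost I r') = ereal (cost I r) + fst (D t) \<and>
    (\<forall>i<length (pairs I). t ! i + (\<Sum>m\<in>models I. r m * (w m ! i)) \<le> (\<Sum>m\<in>models I. r' m * (w m ! i)))"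
  using assms(3-5)
proof (induction "sum_list t" arbitrary: t r n rule: less_induct)
  case less
  have bt: "bellman I w D t" using D less.prems by blast
  have lt: "length t = length (pairs I)" using less.prems(1) by (simp add: mem_states)
  define m where "m = snd (D t)"
  have bk: "(r', n) \<in> (if sum_list (residual t (w m)) < sum_list t
         then charge (length t + 1) () \<Zsemi> (\<lambda>_. backtrack w D (residual t (w m)) (r(m := r m + 1)))
         else charge (length t + 1) r)"
    using less.prems(3) by (subst (asm) backtrack.simps) (simp only: Let_def m_def)
  show ?case
  proof (cases "\<forall>i\<in>set t. i = 0")
    case True
    \<comment> \<open>The model stored at the zero state is the dummy 0, whose weights are
      arbitrary. The recursion stops there because no residual has a sum below 0.\<close>
    then have "sum_list t = 0" by simp
    then have "r' = r" using bk by (simp del: sum_list_eq_0_iff)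
    moreover have "t ! i = 0" if "i < length (pairs I)" for i
      using True lt that by simp
    ultimately show ?thesis using True bt by (simp add: bellman_def)
  next
    case False
    then have m: "m \<in> models I" "residual t (w m) \<noteq> t"
      "fst (D t) = ereal (price I m) + fst (D (residual t (w m)))"
      using bt less.prems(2) unfolding bellman_def if_not_P[OF False] m_def by auto
    have mem: "residual t (w m) \<in> set (states I T)"
      using residual_mem_states less.prems(1) lt len by metis
    have dec: "sum_list (residual t (w m)) < sum_list t"
      using sum_list_mono2(2)[OF residual_le m(2)] lt len by simp
    then obtain b where b: "(r', b) \<in> backtrack w D (residual t (w m)) (r(m := r m + 1))"
      using bk by auto
    have fin: "fst (D (residual t (w m))) < \<infinity>" using m(3) less.prems(2) by auto
    note IH = less.hyps[OF dec mem fin b]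
    have "ereal (cost I r') = ereal (cost I (r(m := r m + 1))) + fst (D (residual t (w m)))"
      using IH by blast
    also have "\<dots> = (ereal (price I m) + ereal (cost I r)) + fst (D (residual t (w m)))"
      unfolding cost_upd[OF m(1)] by simp
    also have "\<dots> = ereal (cost I r) + fst (D t)"
      unfolding m(3) by (simp only: ac_simps)
    finally have "ereal (cost I r') = ereal (cost I r) + fst (D t)" .
    moreover have "t ! i + (\<Sum>m\<in>models I. r m * (w m ! i)) \<le> (\<Sum>m\<in>models I. r' m * (w m ! i))"
      if i: "i < length (pairs I)" for i
    proof -
      have "residual t (w m) ! i + (w m ! i + (\<Sum>k\<in>models I. r k * (w k ! i)))
          \<le> (\<Sum>k\<in>models I. r' k * (w k ! i))"
        using conjunct2[OF IH, rule_format, OF i] sum_mult_upd[OF m(1), of r "\<lambda>k. w k ! i"]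
        by simp
      then show ?thesis using i lt len by simp
    qed
    ultimately show ?thesis by blast
  qed
qed


section \<open>Correctness and running time of the algorithm\<close>

text \<open>Soundness and optimality at one grid point. For the latter, a state reached by some
  design has a finite table value and therefore survives the filter for candidates.\<close>

lemma solve_at_correct:
  assumes price: "\<And>m. m \<in> models I \<Longrightarrow> 0 < price I m"
    and s: "length s = length (pairs I)"
    and run: "(res, n) \<in> solve_at I \<alpha> \<Delta> T s"
  shows "res = Some r \<Longrightarrow>
      \<exists>t\<in>set (states I T). admissible I \<alpha> \<Delta> s t \<and> reaches I (weights I \<Delta> s) r t"
    and "t \<in> set (states I T) \<Longrightarrow> admissible I \<alpha> \<Delta> s t \<Longrightarrow> reaches I (weights I \<Delta> s) r' t \<Longrightarrow>
      \<exists>r. res = Some r \<and> cost I r \<le> cost I r'"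
proof -
  let ?w = "weights I \<Delta> s"
  have len: "length (?w m) = length (pairs I)" for m using s by simp
  obtain D nD n' where D: "(D, nD) \<in> loop (dp_step I ?w) (states I T) (\<lambda>_. (\<infinity>, 0))"
    and rest: "(res, n') \<in> (let cs = [t \<leftarrow> states I T. admissible I \<alpha> \<Delta> s t \<and> fst (D t) < \<infinity>] in
         if cs = [] then charge 1 None
         else argmin (length (pairs I) + 1) (\<lambda>t. fst (D t)) cs \<Zsemi> (\<lambda>t.
              backtrack ?w D t (\<lambda>_. 0) \<Zsemi> (\<lambda>r. charge (nmodels I) (Some r))))"
    using run unfolding solve_at_def Let_def mem_charge_andthen mem_andthen[of _ _ "loop _ _ _"]
    by blast
  have bell: "\<forall>t\<in>set (states I T). bellman I ?w D t"
    using loop_dp_step_bellman[of D nD I ?w "states I T" "\<lambda>_. (\<infinity>, 0)" "[]"] D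
    by (simp add: sorted_wrt_states len mem_states)
  define cs where "cs = [t \<leftarrow> states I T. admissible I \<alpha> \<Delta> s t \<and> fst (D t) < \<infinity>]"
  have some: "\<exists>t\<in>set cs. reaches I ?w r t \<and> (\<forall>t'\<in>set cs. ereal (cost I r) \<le> fst (D t'))"
    if res: "res = Some r" for r
  proof -
    obtain t b where t: "t \<in> set cs" "\<forall>t'\<in>set cs. fst (D t) \<le> fst (D t')"
      and b: "(r, b) \<in> backtrack ?w D t (\<lambda>_. 0)"
      using rest unfolding cs_def[symmetric] Let_def
      by (cases "cs = []") (use res in \<open>auto simp: mem_andthen mem_argmin\<close>)
    have "t \<in> set (states I T)" "fst (D t) < \<infinity>" using t(1) by (auto simp: cs_def)
    from backtrack_correct[OF len bell this b]
    have r: "ereal (cost I r) = fst (D t)"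
      and le: "\<forall>i<length (pairs I). t ! i \<le> (\<Sum>m\<in>models I. r m * (?w m ! i))"
      by (auto simp: cost_def zero_ereal_def[symmetric])
    have "reaches I ?w r t"
      using le t(1) by (simp add: reaches_def cs_def mem_states)
    then show ?thesis using t r by auto
  qed
  show "\<exists>t\<in>set (states I T). admissible I \<alpha> \<Delta> s t \<and> reaches I ?w r t" if "res = Some r"
    using some[OF that] by (auto simp: cs_def)
  show "\<exists>r. res = Some r \<and> cost I r \<le> cost I r'"
    if t: "t \<in> set (states I T)" "admissible I \<alpha> \<Delta> s t" "reaches I ?w r' t"
  proof -
    have le: "fst (D t) \<le> ereal (cost I r')"
      by (rule bellman_le_cost[OF price len bell t(1,3)])
    then have "fst (D t) < \<infinity>" by (rule le_less_trans) simp
    then have tcs: "t \<in> set cs" using t by (simp add: cs_def)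
    then have "cs \<noteq> []" by auto
    then obtain r where r: "res = Some r"
      using rest unfolding cs_def[symmetric] Let_def by (auto simp: mem_andthen)
    have "ereal (cost I r) \<le> fst (D t)" using some[OF r] tcs by blast
    then have "ereal (cost I r) \<le> ereal (cost I r')" using le by (rule order_trans)
    then show ?thesis using r by simp
  qed
qed

lemma solve_at_nonempty: "solve_at I \<alpha> \<Delta> T s \<noteq> {}"
  unfolding solve_at_def Let_def
  by (intro comp_nonempty loop_nonempty dp_step_nonempty argmin_nonempty backtrack_nonempty)

lemma solve_at_steps_le:
  assumes K: "1 \<le> nmodels I" and s: "length s = length (pairs I)"
    and a: "\<forall>m\<in>models I. card (alphabet I m) \<le> a"
    and run: "(res, n) \<in> solve_at I \<alpha> \<Delta> T s"
  defines "P \<equiv> length (pairs I)"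
  shows "n \<le> 12 * (nmodels I * (P + 1) ^ 2 * (a + 1) * (T + 1) ^ P * (P * T + 1))"
proof -
  let ?w = "weights I \<Delta> s" and ?x = "(T + 1) ^ P" and ?K = "nmodels I" and ?n = "P + 1"
  have len: "length (?w m) = P" for m using s by (simp add: P_def)
  have lts: "length (states I T) = ?x" by (simp add: states_def length_n_lists P_def)
  obtain D nD n' where D: "(D, nD) \<in> loop (dp_step I ?w) (states I T) (\<lambda>_. (\<infinity>, 0))"
    and rest: "(res, n') \<in> (let cs = [t \<leftarrow> states I T. admissible I \<alpha> \<Delta> s t \<and> fst (D t) < \<infinity>] in
         if cs = [] then charge 1 None
         else argmin ?n (\<lambda>t. fst (D t)) cs \<Zsemi> (\<lambda>t.
              backtrack ?w D t (\<lambda>_. 0) \<Zsemi> (\<lambda>r. charge ?K (Some r))))"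
    and n: "n = (\<Sum>m\<in>models I. ?n * (card (alphabet I m) + 1)) + (nD + (?n * ?x + n'))"
    using run unfolding solve_at_def Let_def mem_charge_andthen mem_andthen[of _ _ "loop _ _ _"]
      P_def[symmetric] lts by blast
  have n1: "(\<Sum>m\<in>models I. ?n * (card (alphabet I m) + 1)) \<le> ?K * (?n * (a + 1))"
    using sum_bounded_above[of "models I" "\<lambda>m. ?n * (card (alphabet I m) + 1)" "?n * (a + 1)"] a
    by (simp del: mult_Suc mult_Suc_right)
  have nD: "nD \<le> ?x * ((2 * ?K + 1) * ?n + 1) + 1"
    unfolding lts[symmetric]
  proof (rule loop_steps_le[OF _ D])
    show "k \<le> (2 * ?K + 1) * ?n" if "t \<in> set (states I T)" "(z, k) \<in> dp_step I ?w t b" for t b z k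
      using dp_step_bellman(3)[OF that(2)] that(1) by (simp add: mem_states P_def)
  qed
  define cs where "cs = [t \<leftarrow> states I T. admissible I \<alpha> \<Delta> s t \<and> fst (D t) < \<infinity>]"
  have lcs: "length cs \<le> ?x" unfolding cs_def lts[symmetric] by simp
  have n': "n' \<le> 1 + (?n * ?x + ((P * T + 1) * ?n + ?K))"
  proof (cases "cs = []")
    case True
    then show ?thesis using rest unfolding cs_def[symmetric] Let_def by simp
  next
    case False
    then obtain t b r where t: "t \<in> set cs" and b: "(r, b) \<in> backtrack ?w D t (\<lambda>_. 0)"
      and n': "n' = ?n * length cs + (b + ?K)"
      using rest unfolding cs_def[symmetric] Let_def by (auto simp: mem_andthen mem_argmin)
    have ts: "length t = P" "\<forall>i\<in>set t. i \<le> T" using t by (auto simp: cs_def mem_states P_def)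
    have "sum_list t \<le> length t * T"
      using ts(2) by (induction t) auto
    then have "(sum_list t + 1) * ?n \<le> (P * T + 1) * ?n"
      using ts by (intro mult_right_mono) auto
    moreover have "b \<le> (sum_list t + 1) * ?n"
      using backtrack_steps_le[OF b] len ts by simp
    moreover have "?n * length cs \<le> ?n * ?x" using lcs by (rule mult_le_mono2)
    ultimately show ?thesis using n' by linarith
  qed
  \<comment> \<open>Every kind of cost is a product of some of these five factors, each at least 1,
    and so is bounded by the product of all. Eleven such terms occur in the total.\<close>
  define V where "V = ?K * ?n ^ 2 * (a + 1) * ?x * (P * T + 1)"
  have pos: "1 \<le> ?K" "1 \<le> ?n" "1 \<le> a + 1" "1 \<le> ?x" "1 \<le> P * T + 1" using K by auto
  have prod: "k' * p' * a' * x' * u' \<le> V"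
    if "k' \<le> ?K" "p' \<le> ?n ^ 2" "a' \<le> a + 1" "x' \<le> ?x" "u' \<le> P * T + 1" for k' p' a' x' u'
    unfolding V_def using that by (intro mult_mono) auto
  have sq: "1 \<le> ?n ^ 2" "?n \<le> ?n ^ 2" by (auto simp: power2_eq_square)
  define b1 b2 b3 b4 where "b1 = ?K * (?n * (a + 1))" and "b2 = ?x * (?K * ?n)"
    and "b3 = ?x * ?n" and "b4 = (P * T + 1) * ?n"
  have "b1 \<le> V" using prod[of ?K ?n "a + 1" 1 1] pos sq by (simp add: b1_def algebra_simps)
  moreover have "b2 \<le> V" using prod[of ?K ?n 1 ?x 1] pos sq by (simp add: b2_def ac_simps)
  moreover have "b3 \<le> V" using prod[of 1 ?n 1 ?x 1] pos sq by (simp add: b3_def ac_simps)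
  moreover have "?x \<le> V" using prod[of 1 1 1 ?x 1] pos sq by simp
  moreover have "1 \<le> V" using prod[of 1 1 1 1 1] pos sq by simp
  moreover have "b4 \<le> V" using prod[of 1 ?n 1 1 "P * T + 1"] pos sq by (simp add: b4_def ac_simps)
  moreover have "?K \<le> V" using prod[of ?K 1 1 1 1] pos sq by simp
  moreover have "n \<le> b1 + (2 * b2 + b3 + ?x + 1) + (b3 + (1 + (b3 + (b4 + ?K))))"
  proof -
    have "?x * ((2 * ?K + 1) * ?n + 1) + 1 = 2 * b2 + b3 + ?x + 1"
      unfolding b2_def b3_def by (simp add: algebra_simps)
    then have "nD \<le> 2 * b2 + b3 + ?x + 1" using nD by (simp only:)
    moreover have "n' \<le> 1 + (b3 + (b4 + ?K))"
      using n' unfolding b3_def b4_def mult.commute[of ?n ?x] .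
    moreover have "?n * ?x = b3" unfolding b3_def by (rule mult.commute)
    ultimately show ?thesis
      using n n1 unfolding b1_def[symmetric] by linarith
  qed
  ultimately have "n \<le> 12 * V" by linarith
  then show ?thesis unfolding V_def .
qed

text \<open>The last claim speaks of some outcome of \<open>F s\<close>, namely the one taken in
  this run: a computation may have several outcomes, and only one per grid point is
  recorded.\<close>

lemma loop_collect:
  fixes F :: "'a \<Rightarrow> 'b option comp"
  assumes "(rs, n) \<in> loop (\<lambda>s rs. charge (f s) () \<Zsemi> (\<lambda>_. F s \<Zsemi> (\<lambda>res.
                charge 1 (case res of None \<Rightarrow> rs | Some r \<Rightarrow> r # rs)))) ss rs0"
  shows "length rs \<le> length ss + length rs0"
    and "set rs0 \<subseteq> set rs"
    and "\<forall>r\<in>set rs. r \<in> set rs0 \<or> (\<exists>s\<in>set ss. \<exists>k. (Some r, k) \<in> F s)"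
    and "\<forall>s\<in>set ss. \<exists>res k. (res, k) \<in> F s \<and> (\<forall>r. res = Some r \<longrightarrow> r \<in> set rs)"
  using assms
proof (atomize (full), induction ss arbitrary: rs0 n)
  case Nil
  then show ?case by simp
next
  case (Cons s ss)
  then obtain res k n' where res: "(res, k) \<in> F s"
    and run: "(rs, n') \<in> loop (\<lambda>s rs. charge (f s) () \<Zsemi> (\<lambda>_. F s \<Zsemi> (\<lambda>res.
                charge 1 (case res of None \<Rightarrow> rs | Some r \<Rightarrow> r # rs)))) ss
                (case res of None \<Rightarrow> rs0 | Some r \<Rightarrow> r # rs0)"
    by (auto simp: mem_andthen simp del: split_paired_Ex)
  from Cons.IH[rule_format, OF run] res show ?case
    by (cases res) auto
qed

lemma algorithm_cases:
  assumes "(res, n) \<in> algorithm I \<alpha> \<epsilon>"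
  defines "body \<equiv> \<lambda>s rs. charge (length s) () \<Zsemi> (\<lambda>_.
      solve_at I \<alpha> (step_Delta I \<alpha> \<epsilon>) (T_max I \<alpha> \<epsilon>) s \<Zsemi> (\<lambda>res.
      charge 1 (case res of None \<Rightarrow> rs | Some r \<Rightarrow> r # rs)))"
  obtains (none) n1 where "([], n1) \<in> loop body (grid I (step_h I \<alpha> \<epsilon>)) []" "res = None"
      "n = nlabels I + nmodels I + (n1 + 1)"
  | (some) rs n1 r where "(rs, n1) \<in> loop body (grid I (step_h I \<alpha> \<epsilon>)) []" "res = Some r"
      "r \<in> set rs" "\<forall>r'\<in>set rs. cost I r \<le> cost I r'"
      "n = nlabels I + nmodels I + (n1 + (nmodels I * length rs + 1))"
proof -
  obtain rs n1 n2 where rs: "(rs, n1) \<in> loop body (grid I (step_h I \<alpha> \<epsilon>)) []"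
    and rest: "(res, n2) \<in> (if rs = [] then charge 1 None
         else argmin (nmodels I) (cost I) rs \<Zsemi> (\<lambda>r. charge 1 (Some r)))"
    and n: "n = nlabels I + nmodels I + (n1 + n2)"
    using assms(1) unfolding algorithm_def Let_def mem_charge_andthen mem_andthen[of _ _ "loop _ _ _"]
      body_def[symmetric] by blast
  show thesis
  proof (cases "rs = []")
    case True
    then show thesis using none rs rest n by simp
  next
    case False
    then obtain r where "res = Some r" "r \<in> set rs" "\<forall>r'\<in>set rs. cost I r \<le> cost I r'"
      "n2 = nmodels I * length rs + 1"
      using rest by (auto simp: mem_andthen mem_argmin)
    then show thesis using some rs n by blast
  qed
qed

lemma length_mem_grid: "s \<in> set (grid I h) \<Longrightarrow> length s = length (pairs I)"
  by (simp add: grid_def length_n_lists_elem)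

text \<open>This is all that the analysis of feasibility and cost uses about the algorithm: its
  result is certified by one grid point and one state, and no design certified in this way is
  cheaper.\<close>

lemma algorithm_correct:
  assumes price: "\<And>m. m \<in> models I \<Longrightarrow> 0 < price I m"
    and run: "(res, n) \<in> algorithm I \<alpha> \<epsilon>"
  defines "\<Delta> \<equiv> step_Delta I \<alpha> \<epsilon>" and "T \<equiv> T_max I \<alpha> \<epsilon>" and "h \<equiv> step_h I \<alpha> \<epsilon>"
  shows "res = Some r \<Longrightarrow> \<exists>s\<in>set (grid I h). \<exists>t\<in>set (states I T).
      admissible I \<alpha> \<Delta> s t \<and> reaches I (weights I \<Delta> s) r t"
    and "s \<in> set (grid I h) \<Longrightarrow> t \<in> set (states I T) \<Longrightarrow> admissible I \<alpha> \<Delta> s t \<Longrightarrow>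
      reaches I (weights I \<Delta> s) r' t \<Longrightarrow> \<exists>r. res = Some r \<and> cost I r \<le> cost I r'"
proof -
  show "\<exists>s\<in>set (grid I h). \<exists>t\<in>set (states I T).
      admissible I \<alpha> \<Delta> s t \<and> reaches I (weights I \<Delta> s) r t" if r: "res = Some r"
    using run
  proof (cases rule: algorithm_cases)
    case none
    then show ?thesis using r by simp
  next
    case (some rs n1 r')
    then obtain s k where s: "s \<in> set (grid I h)" "(Some r, k) \<in> solve_at I \<alpha> \<Delta> T s"
      using loop_collect(3)[OF some(1)] r by (auto simp: \<Delta>_def T_def h_def)
    from solve_at_correct(1)[OF price length_mem_grid[OF s(1)] s(2)] s(1) show ?thesis
      by blast
  qed
  show "\<exists>r. res = Some r \<and> cost I r \<le> cost I r'"
    if s: "s \<in> set (grid I h)" and t: "t \<in> set (states I T)" "admissible I \<alpha> \<Delta> s t"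
      "reaches I (weights I \<Delta> s) r' t"
  proof -
    have *: "\<exists>r\<in>set rs. cost I r \<le> cost I r'"
      if rs: "(rs, n1) \<in> loop (\<lambda>s rs. charge (length s) () \<Zsemi> (\<lambda>_. solve_at I \<alpha> \<Delta> T s \<Zsemi> (\<lambda>res.
        charge 1 (case res of None \<Rightarrow> rs | Some r \<Rightarrow> r # rs)))) (grid I h) []" for rs n1
    proof -
      obtain res' k where res': "(res', k) \<in> solve_at I \<alpha> \<Delta> T s"
        "\<forall>r. res' = Some r \<longrightarrow> r \<in> set rs"
        using loop_collect(4)[OF rs] s by blast
      from solve_at_correct(2)[OF price length_mem_grid[OF s] res'(1) t] res'(2)
      show ?thesis by blast
    qed
    show ?thesis
      using run
    proof (cases rule: algorithm_cases)
      case (none n1)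
      then show ?thesis using *[of "[]" n1] by (simp add: \<Delta>_def T_def h_def)
    next
      case (some rs n1 r)
      then obtain r'' where "r'' \<in> set rs" "cost I r'' \<le> cost I r'"
        using *[of rs n1] by (auto simp: \<Delta>_def T_def h_def)
      then show ?thesis using some by fastforce
    qed
  qed
qed

lemma algorithm_nonempty: "algorithm I \<alpha> \<epsilon> \<noteq> {}"
  unfolding algorithm_def Let_def
  by (intro comp_nonempty loop_nonempty solve_at_nonempty argmin_nonempty)

lemma length_grid: "length (grid I h) = (nat \<lfloor>1 / h\<rfloor> + 2) ^ length (pairs I)"
  by (simp add: grid_def length_n_lists)

lemma algorithm_steps_le:
  assumes K: "1 \<le> nmodels I" and a: "\<forall>m\<in>models I. card (alphabet I m) \<le> a"
    and run: "(res, n) \<in> algorithm I \<alpha> \<epsilon>"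
  defines "P \<equiv> length (pairs I)" and "T \<equiv> T_max I \<alpha> \<epsilon>"
    and "G \<equiv> nat \<lfloor>1 / step_h I \<alpha> \<epsilon>\<rfloor> + 2"
  shows "n \<le> (nlabels I + 20) * (P + 1) ^ 2 * (a + 1) *
    (nmodels I * G ^ P * (T + 1) ^ P * (P * T + 1))"
proof -
  define V where "V = nmodels I * (P + 1) ^ 2 * (a + 1) * (T + 1) ^ P * (P * T + 1)"
  have sq: "1 \<le> (P + 1) ^ 2" "P + 1 \<le> (P + 1) ^ 2" by (auto simp: power2_eq_square)
  have "nmodels I * 1 * 1 * 1 * 1 \<le> V"
    unfolding V_def using K sq(1) by (intro mult_le_mono) auto
  then have KV: "nmodels I \<le> V" by simp
  have "1 * (P + 1) * 1 * 1 * 1 \<le> V"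
    unfolding V_def using K sq(2) by (intro mult_le_mono) auto
  then have PV: "P + 1 \<le> V" by simp
  have G1: "1 \<le> G ^ P" by (simp add: G_def)
  have VG: "V \<le> G ^ P * V" using G1 by simp
  \<comment> \<open>The solver takes at most 12 \<open>V\<close> steps, and the remaining
    \<open>P\<close> + 1 are at most \<open>V\<close>.\<close>
  have body: "k \<le> 14 * V" if s: "s \<in> set (grid I (step_h I \<alpha> \<epsilon>))"
    and k: "(z, k) \<in> (charge (length s) () \<Zsemi> (\<lambda>_.
      solve_at I \<alpha> (step_Delta I \<alpha> \<epsilon>) (T_max I \<alpha> \<epsilon>) s \<Zsemi> (\<lambda>res.
      charge 1 (case res of None \<Rightarrow> rs | Some r \<Rightarrow> r # rs))))" for s rs z k
  proof -
    from k obtain res b where b: "(res, b) \<in> solve_at I \<alpha> (step_Delta I \<alpha> \<epsilon>) (T_max I \<alpha> \<epsilon>) s"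
      "k = length s + (b + 1)"
      by (auto simp: mem_andthen)
    have "b \<le> 12 * V"
      using solve_at_steps_le[OF K length_mem_grid[OF s] a b(1)] by (simp add: V_def P_def T_def)
    then show ?thesis using b(2) length_mem_grid[OF s] PV by (simp add: P_def)
  qed
  have loop: "n1 \<le> G ^ P * (14 * V + 1) + 1" "length rs \<le> G ^ P"
    if "(rs, n1) \<in> loop (\<lambda>s rs. charge (length s) () \<Zsemi> (\<lambda>_.
      solve_at I \<alpha> (step_Delta I \<alpha> \<epsilon>) (T_max I \<alpha> \<epsilon>) s \<Zsemi> (\<lambda>res.
      charge 1 (case res of None \<Rightarrow> rs | Some r \<Rightarrow> r # rs)))) (grid I (step_h I \<alpha> \<epsilon>)) []" for rs n1
    using loop_steps_le[OF body that] loop_collect(1)[OF that]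
    by (simp_all add: length_grid G_def P_def)
  have G1V: "G ^ P \<le> G ^ P * V" using PV by simp
  have KG: "nmodels I * G ^ P \<le> G ^ P * V" using KV by (simp add: mult.commute)
  have n: "n \<le> nlabels I + V + (G ^ P * (14 * V + 1) + 1 + (G ^ P * V + 1))"
    using run
  proof (cases rule: algorithm_cases)
    case (none n1)
    then show ?thesis using loop(1)[OF none(1)] KV by linarith
  next
    case (some rs n1 r)
    have "nmodels I * length rs \<le> nmodels I * G ^ P"
      using loop(2)[OF some(1)] by (rule mult_le_mono2)
    then show ?thesis using loop(1)[OF some(1)] some(5) KG KV by linarith
  qed
  have one: "1 \<le> G ^ P * V" using VG PV by linarith
  then have "nlabels I * 1 \<le> nlabels I * (G ^ P * V)" by (rule mult_le_mono2)
  moreover have "G ^ P * (14 * V + 1) = 14 * (G ^ P * V) + G ^ P" by (simp add: algebra_simps)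
  ultimately have "n \<le> nlabels I * (G ^ P * V) + 20 * (G ^ P * V)"
    using n one VG G1V by linarith
  also have "\<dots> = (nlabels I + 20) * (P + 1) ^ 2 * (a + 1) *
    (nmodels I * G ^ P * (T + 1) ^ P * (P * T + 1))"
    unfolding V_def distrib_right[symmetric] by (simp only: mult.assoc mult.commute mult.left_commute)
  finally show ?thesis .
qed


section \<open>Chernoff sums\<close>

text \<open>With a single label there are no pairs, and \<open>kappa_min\<close>,
  \<open>vartheta\<close> and \<open>rho\<close> are extrema over empty sets, about which nothing
  can be said. That case is treated separately at the end.\<close>

locale multi_label_ensemble =
  fixes I :: "'x ensemble"
  assumes valid: "valid_ensemble I" and two_labels: "2 \<le> nlabels I"
begin

section \<open>Elementary facts about the instance\<close>

lemma pair_setD: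
  assumes "(y, y') \<in> pair_set I"
  shows "y \<in> labels I" "y' \<in> labels I" "y \<noteq> y'" "(y', y) \<in> pair_set I"
  using assms by (auto simp: pair_set_def)

lemma finite_pair_set: "finite (pair_set I)"
  by (rule finite_subset[of _ "labels I \<times> labels I"]) (auto simp: pair_set_def)

lemma pair_set_nonempty: "pair_set I \<noteq> {}"
proof -
  have "(1, 2) \<in> pair_set I" using two_labels by (simp add: pair_set_def)
  then show ?thesis by blast
qed

lemma nmodels_ge_1: "1 \<le> nmodels I"
  using valid by (simp add: valid_ensemble_def)

lemma prior_pos: "y \<in> labels I \<Longrightarrow> 0 < prior I y"
  using valid by (simp add: valid_ensemble_def)

lemma price_pos: "m \<in> models I \<Longrightarrow> 0 < price I m"
  using valid by (simp add: valid_ensemble_def)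

lemma finite_alphabet: "m \<in> models I \<Longrightarrow> finite (alphabet I m)"
  using valid by (simp add: valid_ensemble_def)

lemma lik_pos: "m \<in> models I \<Longrightarrow> y \<in> labels I \<Longrightarrow> x \<in> alphabet I m \<Longrightarrow> 0 < lik I m y x"
  using valid by (simp add: valid_ensemble_def)

lemma sum_lik: "m \<in> models I \<Longrightarrow> y \<in> labels I \<Longrightarrow> (\<Sum>x\<in>alphabet I m. lik I m y x) = 1"
  using valid by (simp add: valid_ensemble_def)

lemma ex_distinguishes: "(y, y') \<in> pair_set I \<Longrightarrow> \<exists>m\<in>models I. distinguishes I m y y'"
  using valid by (simp add: valid_ensemble_def pair_set_def)

lemma distinguishes_sym: "distinguishes I m y y' \<longleftrightarrow> distinguishes I m y' y"
  unfolding distinguishes_def by metis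

section \<open>Chernoff sums as moment generating functions\<close>

definition llr :: "nat \<Rightarrow> nat \<Rightarrow> nat \<Rightarrow> 'x \<Rightarrow> real" where
  "llr m y y' x = ln (lik I m y' x / lik I m y x)"

lemma abs_llr_le:
  assumes "m \<in> models I" "(y, y') \<in> pair_set I" "x \<in> alphabet I m"
  shows "\<bar>llr m y y' x\<bar> \<le> llr_bound I"
  using valid assms unfolding valid_ensemble_def llr_def pair_set_def by blast

lemma llr_bound_pos: "0 < llr_bound I"
proof -
  obtain y y' where p: "(y, y') \<in> pair_set I" using pair_set_nonempty by auto
  obtain m where m: "m \<in> models I" "distinguishes I m y y'" using ex_distinguishes[OF p] by blast
  obtain x where x: "x \<in> alphabet I m" "lik I m y x \<noteq> lik I m y' x"
    using m(2) by (auto simp: distinguishes_def)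
  have pos: "0 < lik I m y x" "0 < lik I m y' x"
    using lik_pos[OF m(1) _ x(1)] pair_setD[OF p] by blast+
  have "lik I m y' x / lik I m y x \<noteq> 1" "0 < lik I m y' x / lik I m y x"
    using pos x(2) by auto
  then have "llr m y y' x \<noteq> 0" unfolding llr_def by simp
  then show ?thesis using abs_llr_le[OF m(1) p x(1)] by linarith
qed

text \<open>The Chernoff sum is the moment generating function of the log-likelihood ratio under
  label \<open>y\<close>. Its convexity, its log-Lipschitz constant B and its slope at 0, minus the
  divergence, are read off from this form.\<close>

lemma chern_eq_exp:
  assumes "m \<in> models I" "(y, y') \<in> pair_set I"
  shows "chern I m y y' s = (\<Sum>x\<in>alphabet I m. lik I m y x * exp (s * llr m y y' x))"
  unfolding chern_def
proof (intro sum.cong refl)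
  fix x assume x: "x \<in> alphabet I m"
  have pos: "0 < lik I m y x" "0 < lik I m y' x"
    using lik_pos[OF assms(1) _ x] pair_setD[OF assms(2)] by blast+
  have "lik I m y x powr (1 - s) * lik I m y' x powr s
      = exp (ln (lik I m y x) + s * (ln (lik I m y' x) - ln (lik I m y x)))"
    using pos by (simp add: powr_def exp_add[symmetric] algebra_simps)
  also have "\<dots> = lik I m y x * exp (s * llr m y y' x)"
    using pos by (simp add: exp_add llr_def ln_div)
  finally show "lik I m y x powr (1 - s) * lik I m y' x powr s = lik I m y x * exp (s * llr m y y' x)" .
qed

lemma chern_lipschitz:
  assumes "m \<in> models I" "(y, y') \<in> pair_set I"
  shows "chern I m y y' s' \<le> exp (llr_bound I * \<bar>s' - s\<bar>) * chern I m y y' s"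
  unfolding chern_eq_exp[OF assms] sum_distrib_left
proof (intro sum_mono)
  fix x assume x: "x \<in> alphabet I m"
  have "(s' - s) * llr m y y' x \<le> \<bar>s' - s\<bar> * \<bar>llr m y y' x\<bar>"
    by (metis abs_ge_self abs_mult)
  also have "\<dots> \<le> \<bar>s' - s\<bar> * llr_bound I"
    using abs_llr_le[OF assms x] by (intro mult_left_mono) auto
  finally have "s' * llr m y y' x \<le> llr_bound I * \<bar>s' - s\<bar> + s * llr m y y' x"
    by (simp add: algebra_simps)
  then have "exp (s' * llr m y y' x) \<le> exp (llr_bound I * \<bar>s' - s\<bar>) * exp (s * llr m y y' x)"
    by (simp flip: exp_add)
  then have "lik I m y x * exp (s' * llr m y y' x)
      \<le> lik I m y x * (exp (llr_bound I * \<bar>s' - s\<bar>) * exp (s * llr m y y' x))"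
    using lik_pos[OF assms(1) _ x] pair_setD[OF assms(2)] by (intro mult_left_mono) (auto intro: less_imp_le)
  then show "lik I m y x * exp (s' * llr m y y' x)
      \<le> exp (llr_bound I * \<bar>s' - s\<bar>) * (lik I m y x * exp (s * llr m y y' x))"
    by (simp add: ac_simps)
qed

lemma chern_0: "m \<in> models I \<Longrightarrow> (y, y') \<in> pair_set I \<Longrightarrow> chern I m y y' 0 = 1"
  using sum_lik[of m y] pair_setD(1)[of y y'] by (simp add: chern_eq_exp)

text \<open>Claims near the exponent 1 are obtained from claims near 0 for the swapped pair.\<close>

lemma chern_swap: "chern I m y y' s = chern I m y' y (1 - s)"
  by (simp add: chern_def mult.commute)

lemma chern_1: "m \<in> models I \<Longrightarrow> (y, y') \<in> pair_set I \<Longrightarrow> chern I m y y' 1 = 1"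
  using chern_0[of m y' y] chern_swap[of m y y' 1] pair_setD(4) by simp

text \<open>The log-Lipschitz bound, applied between \<open>s\<close> and 0, where the sum is
  1.\<close>

lemma chern_ge:
  assumes "m \<in> models I" "(y, y') \<in> pair_set I" "s \<in> {0..1}"
  shows "exp (- llr_bound I) \<le> chern I m y y' s"
proof -
  have "1 \<le> exp (llr_bound I * \<bar>0 - s\<bar>) * chern I m y y' s"
    using chern_lipschitz[OF assms(1,2), of 0 s] chern_0[OF assms(1,2)] by simp
  then have "exp (- (llr_bound I * s)) \<le> chern I m y y' s"
    using assms(3) by (simp add: exp_minus field_simps)
  moreover have "llr_bound I * s \<le> llr_bound I"
    using llr_bound_pos assms(3) by (simp add: mult_left_le)
  ultimately show ?thesis by (meson exp_le_cancel_iff neg_le_iff_le order_trans)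
qed

lemma chern_pos: "m \<in> models I \<Longrightarrow> (y, y') \<in> pair_set I \<Longrightarrow> s \<in> {0..1} \<Longrightarrow> 0 < chern I m y y' s"
  using chern_ge exp_gt_zero less_le_trans by blast

lemma chern_convex:
  assumes "m \<in> models I" "(y, y') \<in> pair_set I" "0 \<le> t" "t \<le> 1"
  shows "chern I m y y' ((1 - t) * u + t * v) \<le> (1 - t) * chern I m y y' u + t * chern I m y y' v"
proof -
  have "lik I m y x * exp (((1 - t) * u + t * v) * llr m y y' x)
      \<le> (1 - t) * (lik I m y x * exp (u * llr m y y' x)) + t * (lik I m y x * exp (v * llr m y y' x))"
    if x: "x \<in> alphabet I m" for x
  proof -
    have "exp ((1 - t) * (u * llr m y y' x) + t * (v * llr m y y' x))
        \<le> (1 - t) * exp (u * llr m y y' x) + t * exp (v * llr m y y' x)"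
      using convex_onD[OF exp_convex assms(3,4), of "u * llr m y y' x" "v * llr m y y' x"] by simp
    then have "lik I m y x * exp ((1 - t) * (u * llr m y y' x) + t * (v * llr m y y' x))
        \<le> lik I m y x * ((1 - t) * exp (u * llr m y y' x) + t * exp (v * llr m y y' x))"
      using lik_pos[OF assms(1) _ x] pair_setD[OF assms(2)] by (intro mult_left_mono) (auto intro: less_imp_le)
    then show ?thesis by (simp add: algebra_simps)
  qed
  then show ?thesis
    unfolding chern_eq_exp[OF assms(1,2)] sum_distrib_left sum.distrib[symmetric] by (rule sum_mono)
qed

lemma chern_le_1:
  assumes "m \<in> models I" "(y, y') \<in> pair_set I" "s \<in> {0..1}"
  shows "chern I m y y' s \<le> 1"
  using chern_convex[OF assms(1,2), of s 0 1] assms by (simp add: chern_0 chern_1)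

lemma chern_not_distinguishes:
  assumes "m \<in> models I" "(y, y') \<in> pair_set I" "\<not> distinguishes I m y y'"
  shows "chern I m y y' s = 1"
proof -
  have "llr m y y' x = 0" if "x \<in> alphabet I m" for x
    using assms(3) that by (auto simp: distinguishes_def llr_def)
  then show ?thesis
    using sum_lik[OF assms(1)] pair_setD(1)[OF assms(2)] by (simp add: chern_eq_exp[OF assms(1,2)])
qed

lemma continuous_on_chern:
  assumes "m \<in> models I" "(y, y') \<in> pair_set I"
  shows "continuous_on S (chern I m y y')"
proof -
  have "continuous_on S (\<lambda>s. \<Sum>x\<in>alphabet I m. lik I m y x * exp (s * llr m y y' x))"
    by (intro continuous_intros)
  then show ?thesis using chern_eq_exp[OF assms] by (simp cong: continuous_on_cong)
qed

section \<open>Divergences and the constant \<open>kappa_min\<close>\<close>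

lemma kl_eq_llr:
  assumes "m \<in> models I" "(y, y') \<in> pair_set I"
  shows "kl I m y y' = - (\<Sum>x\<in>alphabet I m. lik I m y x * llr m y y' x)"
  unfolding kl_def sum_negf[symmetric]
proof (intro sum.cong refl)
  fix x assume x: "x \<in> alphabet I m"
  have "0 < lik I m y x" "0 < lik I m y' x"
    using lik_pos[OF assms(1) _ x] pair_setD[OF assms(2)] by blast+
  then show "lik I m y x * ln (lik I m y x / lik I m y' x) = - (lik I m y x * llr m y y' x)"
    by (simp add: llr_def ln_div algebra_simps)
qed

lemma kl_le:
  assumes "m \<in> models I" "(y, y') \<in> pair_set I"
  shows "kl I m y y' \<le> llr_bound I"
proof -
  have "kl I m y y' = (\<Sum>x\<in>alphabet I m. lik I m y x * (- llr m y y' x))"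
    by (simp add: kl_eq_llr[OF assms] sum_negf)
  also have "\<dots> \<le> (\<Sum>x\<in>alphabet I m. lik I m y x * llr_bound I)"
  proof (intro sum_mono mult_left_mono)
    fix x assume x: "x \<in> alphabet I m"
    show "- llr m y y' x \<le> llr_bound I" using abs_llr_le[OF assms x] by linarith
    show "0 \<le> lik I m y x" using lik_pos[OF assms(1) _ x] pair_setD[OF assms(2)] by (auto intro: less_imp_le)
  qed
  also have "\<dots> = llr_bound I"
    using sum_lik[OF assms(1)] pair_setD[OF assms(2)] by (simp flip: sum_distrib_right)
  finally show ?thesis .
qed

text \<open>Gibbs' inequality, from ln u \<le> u - 1 with equality only at u = 1; a letter at which
  the likelihoods differ makes the sum strict.\<close>

lemma kl_pos:
  assumes "m \<in> models I" "(y, y') \<in> pair_set I" "distinguishes I m y y'"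
  shows "0 < kl I m y y'"
proof -
  let ?p = "lik I m y" and ?q = "lik I m y'"
  have pos: "0 < ?p x" "0 < ?q x" if "x \<in> alphabet I m" for x
    using lik_pos[OF assms(1) _ that] pair_setD[OF assms(2)] by blast+
  have le: "?p x * llr m y y' x \<le> ?q x - ?p x"
    and less: "?p x \<noteq> ?q x \<Longrightarrow> ?p x * llr m y y' x < ?q x - ?p x" if x: "x \<in> alphabet I m" for x
  proof -
    have q: "?q x - ?p x = ?p x * (?q x / ?p x - 1)" using pos[OF x] by (simp add: field_simps)
    have l: "llr m y y' x \<le> ?q x / ?p x - 1"
      unfolding llr_def using pos[OF x] by (intro ln_le_minus_one) simp
    then show "?p x * llr m y y' x \<le> ?q x - ?p x"
      unfolding q using pos[OF x] by (intro mult_left_mono) auto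
    show "?p x * llr m y y' x < ?q x - ?p x" if "?p x \<noteq> ?q x"
    proof -
      have "llr m y y' x \<noteq> ?q x / ?p x - 1"
        using ln_eq_minus_one[of "?q x / ?p x"] pos[OF x] that by (auto simp: llr_def)
      then show ?thesis unfolding q using l pos[OF x] by (intro mult_strict_left_mono) auto
    qed
  qed
  obtain x where "x \<in> alphabet I m" "?p x \<noteq> ?q x"
    using assms(3) by (auto simp: distinguishes_def)
  then have "(\<Sum>x\<in>alphabet I m. ?p x * llr m y y' x) < (\<Sum>x\<in>alphabet I m. ?q x - ?p x)"
    using le less finite_alphabet[OF assms(1)] by (intro sum_strict_mono_ex1) auto
  also have "\<dots> = 0"
    using sum_lik[OF assms(1)] pair_setD[OF assms(2)] by (simp add: sum_subtractf)
  finally show ?thesis using kl_eq_llr[OF assms(1,2)] by simp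
qed

definition kl_values :: "real set" where
  "kl_values = {min (kl I m y y') (kl I m y' y) | m y y'.
     m \<in> models I \<and> (y, y') \<in> pair_set I \<and> distinguishes I m y y'}"

lemma kl_values: "finite kl_values" "kl_values \<noteq> {}" "kappa_min I = Min kl_values"
proof -
  have "kl_values \<subseteq> (\<lambda>(m, y, y'). min (kl I m y y') (kl I m y' y)) ` (models I \<times> pair_set I)"
    by (force simp: kl_values_def)
  then show "finite kl_values"
    by (rule finite_subset) (simp add: finite_pair_set)
  show "kl_values \<noteq> {}"
    using pair_set_nonempty ex_distinguishes by (fastforce simp: kl_values_def)
  show "kappa_min I = Min kl_values" by (simp add: kappa_min_def kl_values_def)
qed

lemma kappa_min_pos: "0 < kappa_min I"
proof -
  have "\<forall>k\<in>kl_values. 0 < k"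
    using kl_pos pair_setD(4) distinguishes_sym by (fastforce simp: kl_values_def)
  then show ?thesis using kl_values by simp
qed

lemma kappa_min_le_kl:
  assumes "m \<in> models I" "(y, y') \<in> pair_set I" "distinguishes I m y y'"
  shows "kappa_min I \<le> kl I m y y'"
proof -
  have "min (kl I m y y') (kl I m y' y) \<in> kl_values" using assms by (auto simp: kl_values_def)
  then have "kappa_min I \<le> min (kl I m y y') (kl I m y' y)"
    unfolding kl_values(3) using kl_values(1) by (intro Min_le)
  then show ?thesis by simp
qed

text \<open>Together with \<open>delta\<close> * B^2 \<le> \<open>kappa_min\<close> / 4 this gives
  \<open>delta\<close> * B \<le> 1/4, which keeps exponents in the range of the quadratic bound for
  exp.\<close>

lemma kappa_min_le_llr_bound: "kappa_min I \<le> llr_bound I"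
proof -
  obtain y y' where p: "(y, y') \<in> pair_set I" using pair_set_nonempty by auto
  obtain m where m: "m \<in> models I" "distinguishes I m y y'" using ex_distinguishes[OF p] by blast
  show ?thesis using kappa_min_le_kl[OF m(1) p m(2)] kl_le[OF m(1) p] by linarith
qed

section \<open>The interval [\<open>delta\<close>, 1 - \<open>delta\<close>] and the constant
  \<open>vartheta\<close>\<close>

lemma delta_bounds:
  "0 < delta I" "delta I \<le> 1 / 4" "delta I * (llr_bound I)\<^sup>2 \<le> kappa_min I / 4"
  "delta I * llr_bound I \<le> 1 / 4"
proof -
  let ?B = "llr_bound I"
  show "0 < delta I" using kappa_min_pos llr_bound_pos by (simp add: delta_def)
  show "delta I \<le> 1 / 4" by (simp add: delta_def)
  have "delta I \<le> kappa_min I / (4 * ?B\<^sup>2)" by (simp add: delta_def)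
  then show *: "delta I * ?B\<^sup>2 \<le> kappa_min I / 4"
    using llr_bound_pos by (simp add: field_simps)
  have "(delta I * ?B) * ?B \<le> (1 / 4) * ?B"
    using * kappa_min_le_llr_bound by (simp add: power2_eq_square)
  then show "delta I * ?B \<le> 1 / 4"
    using llr_bound_pos by (simp only: mult_le_cancel_right_pos)
qed

text \<open>
  The tangent of \<open>exp\<close> at \<open>\<delta> z\<close> bounds the difference quotient by the mean of \<open>z exp(\<delta> z)\<close>, and
  \<open>\<delta> B\<^sup>2 \<le> \<kappa>/4\<close> keeps this mean within \<open>\<kappa>/2\<close> of the mean of \<open>z\<close>, which is at most \<open>-\<kappa>\<close>.
\<close>

lemma chern_delta_le:
  assumes "m \<in> models I" "(y, y') \<in> pair_set I" "distinguishes I m y y'" "s \<le> delta I"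
  shows "chern I m y y' (delta I) \<le> chern I m y y' s - (delta I - s) * (kappa_min I / 2)"
proof -
  let ?d = "delta I" and ?B = "llr_bound I" and ?k = "kappa_min I"
  let ?p = "lik I m y" and ?z = "llr m y y'"
  have term_le: "exp (?d * ?z x) \<le> exp (s * ?z x) + (?d - s) * (?z x + ?k / 2)"
    if x: "x \<in> alphabet I m" for x
  proof -
    define z where "z = ?z x"
    have zB: "\<bar>z\<bar> \<le> ?B" using abs_llr_le[OF assms(1,2) x] by (simp add: z_def)
    have dz: "\<bar>?d * z\<bar> \<le> 1 / 4"
    proof -
      have "\<bar>?d * z\<bar> = ?d * \<bar>z\<bar>" using delta_bounds(1) by (simp add: abs_mult)
      also have "\<dots> \<le> ?d * ?B" using zB delta_bounds(1) by (intro mult_left_mono) auto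
      finally show ?thesis using delta_bounds(4) by linarith
    qed
    have z2: "?d * z\<^sup>2 \<le> ?k / 4"
    proof -
      have "z\<^sup>2 \<le> ?B\<^sup>2" using zB by (rule abs_le_square_iff[THEN iffD1, OF order_trans]) simp
      then have "?d * z\<^sup>2 \<le> ?d * ?B\<^sup>2" using delta_bounds(1) by (intro mult_left_mono) auto
      then show ?thesis using delta_bounds(3) by linarith
    qed
    \<comment> \<open>Compares z exp(\<delta> z) with z. For z \<ge> 0 the quadratic bound of exp
      applies, and \<delta> z \<le> 1/4 absorbs its square into a second linear term; for z < 0,
      multiplying by z reverses exp u \<ge> 1 + u.\<close>
    have quad: "z * (exp (?d * z) - 1) \<le> 2 * (?d * z\<^sup>2)"
    proof (cases "0 \<le> z")
      case True
      have "exp (?d * z) \<le> 1 + ?d * z + (?d * z)\<^sup>2"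
        using True dz delta_bounds(1) by (intro exp_bound) auto
      also have "(?d * z)\<^sup>2 \<le> ?d * z"
        using True dz delta_bounds(1) by (simp add: power2_eq_square mult_left_le)
      finally have "exp (?d * z) - 1 \<le> 2 * (?d * z)" by linarith
      then have "z * (exp (?d * z) - 1) \<le> z * (2 * (?d * z))" using True by (rule mult_left_mono)
      then show ?thesis by (simp add: power2_eq_square algebra_simps)
    next
      case False
      have "?d * z \<le> exp (?d * z) - 1" using exp_ge_add_one_self[of "?d * z"] by linarith
      then have "z * (exp (?d * z) - 1) \<le> z * (?d * z)" using False by (intro mult_left_mono_neg) auto
      then have "z * (exp (?d * z) - 1) \<le> ?d * z\<^sup>2" by (simp add: power2_eq_square algebra_simps)
      moreover have "0 \<le> ?d * z\<^sup>2" using delta_bounds(1) by simp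
      ultimately show ?thesis by linarith
    qed
    have "1 + (s - ?d) * z \<le> exp ((s - ?d) * z)" by (rule exp_ge_add_one_self)
    then have "exp (?d * z) * (1 + (s - ?d) * z) \<le> exp (?d * z) * exp ((s - ?d) * z)"
      by (intro mult_left_mono) auto
    also have "\<dots> = exp (s * z)" by (simp flip: exp_add add: algebra_simps)
    finally have "exp (?d * z) \<le> exp (s * z) + (?d - s) * (z + z * (exp (?d * z) - 1))"
      by (simp add: algebra_simps)
    also have "\<dots> \<le> exp (s * z) + (?d - s) * (z + ?k / 2)"
      using quad z2 assms(4) by (intro add_left_mono mult_left_mono) auto
    finally show ?thesis by (simp add: z_def)
  qed
  have "chern I m y y' ?d \<le> (\<Sum>x\<in>alphabet I m. ?p x * (exp (s * ?z x) + (?d - s) * (?z x + ?k / 2)))"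
    unfolding chern_eq_exp[OF assms(1,2)]
    using term_le lik_pos[OF assms(1)] pair_setD[OF assms(2)]
    by (intro sum_mono mult_left_mono) (auto intro: less_imp_le)
  also have "\<dots> = chern I m y y' s + (?d - s) * (\<Sum>x\<in>alphabet I m. ?p x * ?z x)
      + (?d - s) * (?k / 2) * (\<Sum>x\<in>alphabet I m. ?p x)"
    unfolding chern_eq_exp[OF assms(1,2)] sum_distrib_left sum.distrib[symmetric]
    by (intro sum.cong refl) (simp add: algebra_simps)
  also have "\<dots> = chern I m y y' s - (?d - s) * (kl I m y y' - ?k / 2)"
    using sum_lik[OF assms(1)] pair_setD[OF assms(2)] kl_eq_llr[OF assms(1,2)] by (simp add: algebra_simps)
  also have "\<dots> \<le> chern I m y y' s - (?d - s) * (?k / 2)"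
    using kappa_min_le_kl[OF assms(1-3)] assms(4) by (intro diff_left_mono mult_left_mono) auto
  finally show ?thesis .
qed

text \<open>What a decrease at rate \<open>kappa_min\<close> / 2 accumulates over the length
  \<open>delta\<close>.\<close>

definition gap :: real where
  "gap = delta I * kappa_min I / 2"

lemma gap_pos: "0 < gap"
  using delta_bounds kappa_min_pos by (simp add: gap_def)

text \<open>At \<open>delta\<close> this is the decrease from the value 1 at 0, at 1 -
  \<open>delta\<close> its reflection; convexity carries the bound to the interior.\<close>

lemma chern_le_gap:
  assumes "m \<in> models I" "(y, y') \<in> pair_set I" "distinguishes I m y y'" "s \<in> {delta I..1 - delta I}"
  shows "chern I m y y' s \<le> 1 - gap"
proof -
  let ?d = "delta I"
  have left: "chern I m v v' ?d \<le> 1 - gap"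
    if "(v, v') \<in> pair_set I" "distinguishes I m v v'" for v v'
    using chern_delta_le[OF assms(1) that, of 0] chern_0[OF assms(1) that(1)] delta_bounds(1)
    by (simp add: gap_def)
  have right: "chern I m y y' (1 - ?d) \<le> 1 - gap"
    using left[of y' y] chern_swap[of m y y' "1 - ?d"] assms distinguishes_sym pair_setD(4) by simp
  define t where "t = (s - ?d) / (1 - 2 * ?d)"
  have d: "0 < 1 - 2 * ?d" using delta_bounds by linarith
  then have "t * (1 - 2 * ?d) = s - ?d" by (simp add: t_def)
  moreover have "(1 - t) * ?d + t * (1 - ?d) = ?d + t * (1 - 2 * ?d)" by (simp add: algebra_simps)
  ultimately have t: "0 \<le> t" "t \<le> 1" "(1 - t) * ?d + t * (1 - ?d) = s"
    using assms(4) d by (auto simp: t_def)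
  have "chern I m y y' s \<le> (1 - t) * chern I m y y' ?d + t * chern I m y y' (1 - ?d)"
    using chern_convex[OF assms(1,2) t(1,2), of ?d "1 - ?d"] t(3) by simp
  also have "\<dots> \<le> (1 - t) * (1 - gap) + t * (1 - gap)"
    using left[OF assms(2,3)] right t by (intro add_mono mult_left_mono) auto
  finally show ?thesis by (simp add: algebra_simps)
qed

lemma delta_interval_subset: "{delta I..1 - delta I} \<subseteq> {0..1}"
  using delta_bounds by auto

lemma half_in_delta_interval: "1 / 2 \<in> {delta I..1 - delta I}"
  using delta_bounds by auto

lemma prod_chern_le_gap:
  assumes "(y, y') \<in> pair_set I" "s \<in> {delta I..1 - delta I}"
  shows "(\<Prod>m\<in>models I. chern I m y y' s) \<le> 1 - gap"
proof -
  have s: "s \<in> {0..1}" using assms(2) delta_interval_subset by blast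
  obtain m where m: "m \<in> models I" "distinguishes I m y y'" using ex_distinguishes[OF assms(1)] by blast
  have "(\<Prod>m\<in>models I. chern I m y y' s)
      = chern I m y y' s * (\<Prod>m\<in>models I - {m}. chern I m y y' s)"
    using m(1) by (subst prod.remove[of _ m]) auto
  also have "\<dots> \<le> chern I m y y' s * 1"
    using chern_pos[OF _ assms(1) s] chern_le_1[OF _ assms(1) s] m(1)
    by (intro mult_left_mono prod_le_1) (auto intro: less_imp_le)
  finally show ?thesis using chern_le_gap[OF m(1) assms(1) m(2) assms(2)] by simp
qed

lemma prod_chern_pos:
  "(y, y') \<in> pair_set I \<Longrightarrow> s \<in> {0..1} \<Longrightarrow> 0 < (\<Prod>m\<in>models I. chern I m y y' s)"
  by (intro prod_pos) (auto intro!: chern_pos)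

lemma bdd_above_prod_chern:
  assumes "(y, y') \<in> pair_set I"
  shows "bdd_above ((\<lambda>s. \<Prod>m\<in>models I. chern I m y y' s) ` {delta I..1 - delta I})"
  using prod_chern_le_gap[OF assms] by (intro bdd_aboveI2) auto

lemma vartheta_ge:
  assumes "(y, y') \<in> pair_set I" "s \<in> {delta I..1 - delta I}"
  shows "(\<Prod>m\<in>models I. chern I m y y' s) \<le> vartheta I"
proof -
  have "(\<Prod>m\<in>models I. chern I m y y' s)
      \<le> (SUP s\<in>{delta I..1 - delta I}. \<Prod>m\<in>models I. chern I m y y' s)"
    by (rule cSUP_upper[OF assms(2) bdd_above_prod_chern[OF assms(1)]])
  also have "\<dots> \<le> vartheta I"
    unfolding vartheta_def using finite_pair_set assms(1) by (intro Max_ge) force+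
  finally show ?thesis .
qed

lemma vartheta_bounds: "0 < vartheta I" "vartheta I \<le> 1 - gap"
proof -
  obtain y y' where p: "(y, y') \<in> pair_set I" using pair_set_nonempty by auto
  show "0 < vartheta I"
    using vartheta_ge[OF p half_in_delta_interval] prod_chern_pos[OF p, of "1 / 2"] by simp
  have "(SUP s\<in>{delta I..1 - delta I}. \<Prod>m\<in>models I. chern I m v v' s) \<le> 1 - gap"
    if "(v, v') \<in> pair_set I" for v v'
    using prod_chern_le_gap[OF that] half_in_delta_interval by (intro cSUP_least) auto
  then show "vartheta I \<le> 1 - gap"
    unfolding vartheta_def using finite_pair_set pair_set_nonempty by (subst Max_le_iff) auto
qed

end


section \<open>Chernoff objectives and their rounding\<close>

context multi_label_ensemble
begin

text \<open>The prior ratio is a free parameter \<open>c\<close>: reflecting the exponent turns it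
  into 1 / \<open>c\<close>, and \<open>c\<close> = 1 gives the products that define
  \<open>rho\<close>.\<close>

definition obj :: "real \<Rightarrow> (nat \<Rightarrow> nat) \<Rightarrow> nat \<Rightarrow> nat \<Rightarrow> real \<Rightarrow> real" where
  "obj c r y y' s = c powr s * (\<Prod>m\<in>models I. chern I m y y' s ^ r m)"

text \<open>A model that does not distinguish the pair has Chernoff sum 1 at every exponent, so
  these are the samples on which the objective of the pair depends.\<close>

definition hits :: "(nat \<Rightarrow> nat) \<Rightarrow> nat \<Rightarrow> nat \<Rightarrow> nat" where
  "hits r y y' = (\<Sum>m\<in>models I. if distinguishes I m y y' then r m else 0)"

lemma hits_le: "hits r y y' \<le> (\<Sum>m\<in>models I. r m)"
  unfolding hits_def by (intro sum_mono) auto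

lemma hits_swap: "hits r y y' = hits r y' y"
  by (simp add: hits_def distinguishes_sym)

section \<open>The objective at different exponents\<close>

lemma obj_pos:
  "0 < c \<Longrightarrow> (y, y') \<in> pair_set I \<Longrightarrow> s \<in> {0..1} \<Longrightarrow> 0 < obj c r y y' s"
  unfolding obj_def by (intro mult_pos_pos prod_pos ballI zero_less_power chern_pos) auto

lemma obj_swap:
  assumes "0 < c"
  shows "obj c r y y' s = c * obj (1 / c) r y' y (1 - s)"
proof -
  have "c powr s = c * (1 / c) powr (1 - s)"
    using assms by (simp add: powr_divide powr_diff)
  then show ?thesis using chern_swap[of _ y y' s] by (simp add: obj_def)
qed

lemma continuous_on_obj:
  assumes "0 < c" "(y, y') \<in> pair_set I"
  shows "continuous_on S (obj c r y y')"
  unfolding obj_def using assms by (intro continuous_intros continuous_on_chern) auto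

lemma obj_attains_min:
  assumes "0 < c" "(y, y') \<in> pair_set I"
  obtains s where "s \<in> {0..1}" "\<forall>u\<in>{0..1}. obj c r y y' s \<le> obj c r y y' u"
  using continuous_attains_inf[OF compact_Icc _ continuous_on_obj[OF assms], of 0 1 r] by auto

lemma prod_power_hits:
  "(\<Prod>m\<in>models I. (if distinguishes I m y y' then exp x else 1) ^ r m) = exp (real (hits r y y') * x)"
proof -
  have "(\<Prod>m\<in>models I. (if distinguishes I m y y' then exp x else 1) ^ r m)
      = (\<Prod>m\<in>models I. exp (real (if distinguishes I m y y' then r m else 0) * x))"
    by (intro prod.cong) (auto simp: exp_of_nat_mult)
  also have "\<dots> = exp (\<Sum>m\<in>models I. real (if distinguishes I m y y' then r m else 0) * x)"
    by (simp add: exp_sum)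
  also have "(\<Sum>m\<in>models I. real (if distinguishes I m y y' then r m else 0) * x) = real (hits r y y') * x"
    unfolding hits_def of_nat_sum sum_distrib_right ..
  finally show ?thesis .
qed

text \<open>Common core of two comparisons: \<open>x\<close> = B * |s' - s| yields the Lipschitz
  bound, and a negative \<open>x\<close> yields the decrease towards \<open>delta\<close>.\<close>

lemma obj_le_exp_hits:
  assumes c: "0 < c" and p: "(y, y') \<in> pair_set I" and s: "s \<in> {0..1}" "s' \<in> {0..1}"
    and x: "\<And>m. m \<in> models I \<Longrightarrow> distinguishes I m y y' \<Longrightarrow> chern I m y y' s' \<le> exp x * chern I m y y' s"
    and e: "(s' - s) * ln c + real (hits r y y') * x \<le> e"
  shows "obj c r y y' s' \<le> obj c r y y' s * exp e"
proof -
  have "(\<Prod>m\<in>models I. chern I m y y' s' ^ r m)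
      \<le> (\<Prod>m\<in>models I. ((if distinguishes I m y y' then exp x else 1) * chern I m y y' s) ^ r m)"
  proof (intro prod_mono conjI power_mono)
    fix m assume m: "m \<in> models I"
    show "chern I m y y' s' \<le> (if distinguishes I m y y' then exp x else 1) * chern I m y y' s"
      using x m chern_not_distinguishes[OF m p] by auto
    show "0 \<le> chern I m y y' s'" "0 \<le> chern I m y y' s' ^ r m"
      using chern_pos[OF m p s(2)] by auto
  qed
  also have "\<dots> = exp (real (hits r y y') * x) * (\<Prod>m\<in>models I. chern I m y y' s ^ r m)"
    unfolding power_mult_distrib prod.distrib prod_power_hits ..
  finally have prod: "(\<Prod>m\<in>models I. chern I m y y' s' ^ r m)
      \<le> exp (real (hits r y y') * x) * (\<Prod>m\<in>models I. chern I m y y' s ^ r m)" .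
  have "c powr s' = exp ((s' - s) * ln c) * c powr s"
    using c by (simp add: powr_def flip: exp_add) (simp add: algebra_simps)
  then have "obj c r y y' s' \<le> exp ((s' - s) * ln c) * c powr s *
      (exp (real (hits r y y') * x) * (\<Prod>m\<in>models I. chern I m y y' s ^ r m))"
    unfolding obj_def using prod c by (simp add: mult_left_mono)
  also have "\<dots> = obj c r y y' s * exp ((s' - s) * ln c + real (hits r y y') * x)"
    by (simp add: obj_def exp_add ac_simps)
  also have "\<dots> \<le> obj c r y y' s * exp e"
    using obj_pos[OF c p s(1), of r] e by (intro mult_left_mono) (auto intro: less_imp_le)
  finally show ?thesis .
qed

lemma obj_lipschitz:
  assumes "0 < c" "(y, y') \<in> pair_set I" "s \<in> {0..1}" "s' \<in> {0..1}"
  shows "obj c r y y' s' \<le>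
    obj c r y y' s * exp (\<bar>s' - s\<bar> * (\<bar>ln c\<bar> + llr_bound I * real (hits r y y')))"
proof (rule obj_le_exp_hits[OF assms])
  show "chern I m y y' s' \<le> exp (llr_bound I * \<bar>s' - s\<bar>) * chern I m y y' s" if "m \<in> models I" for m
    by (rule chern_lipschitz[OF that assms(2)])
  have "(s' - s) * ln c \<le> \<bar>s' - s\<bar> * \<bar>ln c\<bar>" by (metis abs_ge_self abs_mult)
  then show "(s' - s) * ln c + real (hits r y y') * (llr_bound I * \<bar>s' - s\<bar>)
      \<le> \<bar>s' - s\<bar> * (\<bar>ln c\<bar> + llr_bound I * real (hits r y y'))"
    by (simp add: algebra_simps)
qed

text \<open>In logarithms, moving from \<open>s\<close> to \<open>delta\<close> raises the prior
  factor by at most (\<open>delta\<close> - s) * |ln c|, while every hit lowers the product by at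
  least (\<open>delta\<close> - s) * \<open>kappa_min\<close> / 2. The hypothesis on
  \<open>hits\<close> says that the second effect wins.\<close>

lemma obj_delta_le:
  assumes "0 < c" "(y, y') \<in> pair_set I" "\<bar>ln c\<bar> \<le> kappa_min I / 2 * real (hits r y y')" "s \<in> {0..delta I}"
  shows "obj c r y y' (delta I) \<le> obj c r y y' s"
proof -
  have s: "s \<in> {0..1}" "delta I \<in> {0..1}" using assms(4) delta_bounds by auto
  have "obj c r y y' (delta I) \<le> obj c r y y' s * exp 0"
  proof (rule obj_le_exp_hits[OF assms(1,2) s])
    fix m assume m: "m \<in> models I" "distinguishes I m y y'"
    let ?x = "(delta I - s) * (kappa_min I / 2)"
    have x: "0 \<le> ?x" using assms(4) kappa_min_pos by auto
    have "chern I m y y' (delta I) \<le> chern I m y y' s - ?x"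
      using chern_delta_le[OF m(1) assms(2) m(2)] assms(4) by auto
    \<comment> \<open>The additive decrease becomes a multiplicative one because the sum is at most
      1.\<close>
    also have "\<dots> \<le> chern I m y y' s - ?x * chern I m y y' s"
      using chern_le_1[OF m(1) assms(2) s(1)] x by (intro diff_left_mono mult_left_le) auto
    also have "\<dots> = (1 + (- ?x)) * chern I m y y' s" by (simp add: algebra_simps)
    also have "\<dots> \<le> exp (- ?x) * chern I m y y' s"
      using chern_pos[OF m(1) assms(2) s(1)] exp_ge_add_one_self[of "- ?x"]
      by (intro mult_right_mono) auto
    finally show "chern I m y y' (delta I) \<le> exp (- ?x) * chern I m y y' s" .
  next
    have "(delta I - s) * ln c \<le> (delta I - s) * (kappa_min I / 2 * real (hits r y y'))"
      using assms(3,4) by (intro mult_left_mono) auto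
    moreover have "real (hits r y y') * - ((delta I - s) * (kappa_min I / 2))
        = - ((delta I - s) * (kappa_min I / 2 * real (hits r y y')))"
      by simp
    ultimately show "(delta I - s) * ln c + real (hits r y y') * - ((delta I - s) * (kappa_min I / 2)) \<le> 0"
      by linarith
  qed
  then show ?thesis by simp
qed

text \<open>An exponent outside the interval is moved to the nearer end. On the right this uses the
  swapped pair with 1 / \<open>c\<close>, which has the same |ln c| and the same hits.\<close>

lemma obj_le_on_delta_interval:
  assumes "0 < c" "(y, y') \<in> pair_set I" "\<bar>ln c\<bar> \<le> kappa_min I / 2 * real (hits r y y')" "s \<in> {0..1}"
  obtains s' where "s' \<in> {delta I..1 - delta I}" "obj c r y y' s' \<le> obj c r y y' s"
proof -
  have d: "delta I \<in> {delta I..1 - delta I}" "1 - delta I \<in> {delta I..1 - delta I}"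
    using delta_bounds by auto
  consider "s < delta I" | "s \<in> {delta I..1 - delta I}" | "1 - delta I < s" by fastforce
  then show thesis
  proof cases
    case 1
    then show thesis using that[OF d(1)] obj_delta_le[OF assms(1-3)] assms(4) by auto
  next
    case 2
    then show thesis using that by blast
  next
    case 3
    have "obj (1 / c) r y' y (delta I) \<le> obj (1 / c) r y' y (1 - s)"
      using 3 assms pair_setD(4)[OF assms(2)]
      by (intro obj_delta_le) (auto simp: ln_div hits_swap[of r y' y])
    then have "obj c r y y' (1 - delta I) \<le> obj c r y y' s"
      unfolding obj_swap[OF assms(1), of r y y'] using assms(1) by simp
    then show thesis using that[OF d(2)] by blast
  qed
qed

section \<open>Additional samples and the constant \<open>rho\<close>\<close>

lemma obj_add_const:
  "obj c (\<lambda>m. r m + k) y y' s = obj c r y y' s * (\<Prod>m\<in>models I. chern I m y y' s) ^ k"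
  by (simp add: obj_def power_add prod.distrib prod_power_distrib)

lemma obj_const: "obj c (\<lambda>m. k) y y' s = c powr s * (\<Prod>m\<in>models I. chern I m y y' s) ^ k"
  by (simp add: obj_def prod_power_distrib)

text \<open>Convexity between the value 1 at an end and a value below 1 at 1/2. In contrast to
  \<open>prod_chern_le_gap\<close> this covers exponents arbitrarily close to 0 or 1, but without a
  uniform rate.\<close>

lemma prod_chern_less_1:
  assumes p: "(y, y') \<in> pair_set I" and s: "0 < s" "s < 1"
  shows "(\<Prod>m\<in>models I. chern I m y y' s) < 1"
proof -
  have s01: "s \<in> {0..1}" using s by simp
  obtain m where m: "m \<in> models I" "distinguishes I m y y'" using ex_distinguishes[OF p] by blast
  have half: "chern I m y y' (1 / 2) < 1"
    using chern_le_gap[OF m(1) p m(2) half_in_delta_interval] gap_pos by linarith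
  have "chern I m y y' s < 1"
  proof (cases "s \<le> 1 / 2")
    case True
    have "chern I m y y' s \<le> (1 - 2 * s) * 1 + 2 * s * chern I m y y' (1 / 2)"
      using chern_convex[OF m(1) p, of "2 * s" 0 "1 / 2"] True s by (simp add: chern_0[OF m(1) p])
    also have "\<dots> < (1 - 2 * s) * 1 + 2 * s * 1"
      using half s by (intro add_strict_left_mono mult_strict_left_mono) auto
    finally show ?thesis by simp
  next
    case False
    have eq: "(1 - (2 * s - 1)) * (1 / 2) + (2 * s - 1) * 1 = s" by (simp add: field_simps)
    have "chern I m y y' s \<le> (1 - (2 * s - 1)) * chern I m y y' (1 / 2) + (2 * s - 1) * 1"
      using chern_convex[OF m(1) p, of "2 * s - 1" "1 / 2" 1] False s
      unfolding eq chern_1[OF m(1) p] by linarith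
    also have "\<dots> < (1 - (2 * s - 1)) * 1 + (2 * s - 1) * 1"
      using half s by (intro add_strict_right_mono mult_strict_left_mono) auto
    finally show ?thesis by simp
  qed
  moreover have "(\<Prod>m\<in>models I. chern I m y y' s)
      = chern I m y y' s * (\<Prod>m\<in>models I - {m}. chern I m y y' s)"
    using m(1) by (subst prod.remove[of _ m]) auto
  moreover have "\<dots> \<le> chern I m y y' s * 1"
    using chern_pos[OF _ p s01] chern_le_1[OF _ p s01] m(1)
    by (intro mult_left_mono prod_le_1) (auto intro: less_imp_le)
  ultimately show ?thesis by linarith
qed

text \<open>For \<open>c\<close> = 1 the condition on hits reads 0 \<le> \<open>kappa_min\<close> /
  2 * hits, so a minimiser can always be moved into the interval. One exponent thus serves both the
  bound by \<open>rho\<close> and the gain by \<open>vartheta\<close>.\<close>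

lemma rho_witness:
  assumes p: "(y, y') \<in> pair_set I"
  obtains s where "s \<in> {delta I..1 - delta I}" "(\<Prod>m\<in>models I. chern I m y y' s) \<le> rho I" "0 < rho I"
proof -
  have o: "obj 1 (\<lambda>_. 1) y y' s = (\<Prod>m\<in>models I. chern I m y y' s)" for s by (simp add: obj_def)
  obtain s where s: "s \<in> {0..1}" "\<forall>u\<in>{0..1}. obj 1 (\<lambda>_. 1) y y' s \<le> obj 1 (\<lambda>_. 1) y y' u"
    using obj_attains_min[OF _ p, of 1] by auto
  then have "(\<Prod>m\<in>models I. chern I m y y' s) \<le> (INF s\<in>{0..1}. \<Prod>m\<in>models I. chern I m y y' s)"
    unfolding o by (intro cINF_greatest) auto
  also have "\<dots> \<le> rho I"
    unfolding rho_def using finite_pair_set p by (intro Max_ge) force+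
  finally have le: "(\<Prod>m\<in>models I. chern I m y y' s) \<le> rho I" .
  obtain s' where s': "s' \<in> {delta I..1 - delta I}" "obj 1 (\<lambda>_. 1) y y' s' \<le> obj 1 (\<lambda>_. 1) y y' s"
    using obj_le_on_delta_interval[of 1 y y' "\<lambda>_. 1" s] p s(1) kappa_min_pos by auto
  then have "(\<Prod>m\<in>models I. chern I m y y' s') \<le> rho I" using le unfolding o by linarith
  moreover have "0 < rho I" using le prod_chern_pos[OF p s(1)] by linarith
  ultimately show thesis using that s'(1) by blast
qed

lemma rho_bounds: "0 < rho I" "rho I \<le> 1 - gap"
proof -
  show "0 < rho I" using rho_witness pair_set_nonempty by (metis surj_pair ex_in_conv)
  have "(INF s\<in>{0..1}. \<Prod>m\<in>models I. chern I m y y' s) \<le> 1 - gap" if p: "(y, y') \<in> pair_set I" for y y'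
  proof -
    have "bdd_below ((\<lambda>s. \<Prod>m\<in>models I. chern I m y y' s) ` {0..1})"
      using prod_chern_pos[OF p] by (intro bdd_belowI2[of _ 0]) (auto intro: less_imp_le)
    then have "(INF s\<in>{0..1}. \<Prod>m\<in>models I. chern I m y y' s) \<le> (\<Prod>m\<in>models I. chern I m y y' (1 / 2))"
      by (rule cINF_lower) simp
    then show ?thesis using prod_chern_le_gap[OF p half_in_delta_interval] by linarith
  qed
  then show "rho I \<le> 1 - gap"
    unfolding rho_def using finite_pair_set pair_set_nonempty by (subst Max_le_iff) auto
qed

section \<open>Rounded weights and the exponent grid\<close>

definition weight :: "real \<Rightarrow> nat \<Rightarrow> nat \<Rightarrow> real \<Rightarrow> nat \<Rightarrow> nat" where
  "weight \<Delta> y y' s m = nat \<lfloor>- ln (chern I m y y' s) / \<Delta>\<rfloor>"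

text \<open>The term of a pair in \<open>admissible\<close> when the state is exactly the weight
  collected by \<open>r\<close>.\<close>

definition rounded :: "real \<Rightarrow> real \<Rightarrow> (nat \<Rightarrow> nat) \<Rightarrow> nat \<Rightarrow> nat \<Rightarrow> real \<Rightarrow> real" where
  "rounded c \<Delta> r y y' s = c powr s * exp (- \<Delta> * real (\<Sum>m\<in>models I. r m * weight \<Delta> y y' s m))"

lemma obj_eq_exp:
  assumes "(y, y') \<in> pair_set I" "s \<in> {0..1}"
  shows "obj c r y y' s = c powr s * exp (\<Sum>m\<in>models I. real (r m) * ln (chern I m y y' s))"
proof -
  have "chern I m y y' s ^ r m = exp (real (r m) * ln (chern I m y y' s))" if "m \<in> models I" for m
    using chern_pos[OF that assms] by (simp add: exp_of_nat_mult)
  then show ?thesis by (simp add: obj_def exp_sum)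
qed

text \<open>A model that does not distinguish the pair has weight exactly 0 and loses nothing by
  rounding. Hence the loss is governed by \<open>hits\<close> and stays bounded however often the
  other models are sampled. The third bound is the origin of \<open>T_max\<close>.\<close>

lemma weight_bounds:
  assumes "m \<in> models I" "(y, y') \<in> pair_set I" "s \<in> {0..1}" "0 < \<Delta>"
  shows "\<Delta> * real (weight \<Delta> y y' s m) \<le> - ln (chern I m y y' s)"
    and "- ln (chern I m y y' s) - (if distinguishes I m y y' then \<Delta> else 0) \<le> \<Delta> * real (weight \<Delta> y y' s m)"
    and "\<Delta> * real (weight \<Delta> y y' s m) \<le> llr_bound I"
proof -
  let ?l = "- ln (chern I m y y' s)"
  have l0: "0 \<le> ?l" using chern_pos[OF assms(1-3)] chern_le_1[OF assms(1-3)] by simp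
  have "real (weight \<Delta> y y' s m) \<le> ?l / \<Delta>"
    unfolding weight_def using l0 assms(4) by (intro of_nat_floor divide_nonneg_pos)
  then show *: "\<Delta> * real (weight \<Delta> y y' s m) \<le> ?l" using assms(4) by (simp add: field_simps)
  have "?l / \<Delta> - 1 \<le> real (weight \<Delta> y y' s m)"
    unfolding weight_def by linarith
  then have "?l - \<Delta> \<le> \<Delta> * real (weight \<Delta> y y' s m)" using assms(4) by (simp add: field_simps)
  moreover have "?l = 0" if "\<not> distinguishes I m y y'"
    using chern_not_distinguishes[OF assms(1,2) that] by simp
  ultimately show "?l - (if distinguishes I m y y' then \<Delta> else 0) \<le> \<Delta> * real (weight \<Delta> y y' s m)"
    using assms(4) by auto
  have "ln (exp (- llr_bound I)) \<le> ln (chern I m y y' s)"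
    using chern_ge[OF assms(1-3)] chern_pos[OF assms(1-3)] by (subst ln_le_cancel_iff) auto
  then show "\<Delta> * real (weight \<Delta> y y' s m) \<le> llr_bound I" using * by simp
qed

lemma obj_le_rounded:
  assumes "(y, y') \<in> pair_set I" "s \<in> {0..1}" "0 < \<Delta>"
  shows "obj c r y y' s \<le> rounded c \<Delta> r y y' s"
proof -
  have "(\<Sum>m\<in>models I. real (r m) * ln (chern I m y y' s))
      \<le> (\<Sum>m\<in>models I. real (r m) * - (\<Delta> * real (weight \<Delta> y y' s m)))"
    using weight_bounds(1)[OF _ assms] by (intro sum_mono mult_left_mono) fastforce+
  also have "\<dots> = - \<Delta> * real (\<Sum>m\<in>models I. r m * weight \<Delta> y y' s m)"
    by (simp add: sum_distrib_left sum_negf ac_simps)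
  finally show ?thesis
    unfolding obj_eq_exp[OF assms(1,2)] rounded_def by (intro mult_left_mono) auto
qed

lemma rounded_le_obj:
  assumes "(y, y') \<in> pair_set I" "s \<in> {0..1}" "0 < \<Delta>"
  shows "rounded c \<Delta> r y y' s \<le> obj c r y y' s * exp (\<Delta> * real (hits r y y'))"
proof -
  have "- \<Delta> * real (\<Sum>m\<in>models I. r m * weight \<Delta> y y' s m)
      = (\<Sum>m\<in>models I. real (r m) * - (\<Delta> * real (weight \<Delta> y y' s m)))"
    by (simp add: sum_distrib_left sum_negf ac_simps)
  also have "\<dots> \<le> (\<Sum>m\<in>models I. real (r m) *
      (ln (chern I m y y' s) + (if distinguishes I m y y' then \<Delta> else 0)))"
    using weight_bounds(2)[OF _ assms] by (intro sum_mono mult_left_mono) fastforce+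
  also have "\<dots> = (\<Sum>m\<in>models I. real (r m) * ln (chern I m y y' s)) + \<Delta> * real (hits r y y')"
    unfolding hits_def of_nat_sum sum_distrib_left sum.distrib[symmetric]
    by (intro sum.cong) (auto simp: algebra_simps)
  finally show ?thesis
    unfolding obj_eq_exp[OF assms(1,2)] rounded_def mult.assoc exp_add[symmetric]
    by (intro mult_left_mono) auto
qed

definition gridpoints :: "real \<Rightarrow> real set" where
  "gridpoints h = set (map (\<lambda>k. real k * h) [0..<nat \<lfloor>1 / h\<rfloor> + 1] @ [1])"

lemma gridpoints_endpoints: "0 \<in> gridpoints h" "1 \<in> gridpoints h"
  by (auto simp: gridpoints_def image_iff intro!: exI[of _ "0::nat"] bexI[of _ "0::nat"])

lemma gridpoints_subset:
  assumes "0 < h"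
  shows "gridpoints h \<subseteq> {0..1}"
proof -
  have "real k * h \<le> 1" if "k < nat \<lfloor>1 / h\<rfloor> + 1" for k
  proof -
    have "real k \<le> real (nat \<lfloor>1 / h\<rfloor>)" using that by simp
    also have "\<dots> \<le> 1 / h" using assms by (intro of_nat_floor) simp
    finally show ?thesis using assms by (simp add: field_simps)
  qed
  then show ?thesis using assms by (auto simp: gridpoints_def simp del: upt_Suc)
qed

lemma gridpoints_dense:
  assumes "0 < h" "s \<in> {0..1}"
  obtains u where "u \<in> gridpoints h" "\<bar>u - s\<bar> \<le> h"
proof -
  define k where "k = nat \<lfloor>s / h\<rfloor>"
  have "\<lfloor>s / h\<rfloor> \<le> \<lfloor>1 / h\<rfloor>" using assms by (intro floor_mono divide_right_mono) auto
  then have "k \<le> nat \<lfloor>1 / h\<rfloor>" unfolding k_def by (rule nat_mono)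
  then have "real k * h \<in> gridpoints h"
    unfolding gridpoints_def set_append set_map set_upt by auto
  moreover have "real k \<le> s / h" "s / h < real k + 1"
    unfolding k_def using assms by (auto intro: of_nat_floor)
  then have "\<bar>real k * h - s\<bar> \<le> h" using assms(1) by (auto simp: field_simps abs_le_iff)
  ultimately show thesis using that by blast
qed

text \<open>Moving the exponent costs at most \<open>h\<close> times the Lipschitz constant of the
  logarithm of the objective; the floors cost at most \<open>\<Delta>\<close> per hit.\<close>

lemma rounded_on_grid:
  assumes "0 < c" "(y, y') \<in> pair_set I" "s \<in> {0..1}" "0 < h" "0 < \<Delta>"
  obtains u where "u \<in> gridpoints h" "rounded c \<Delta> r y y' u \<le> obj c r y y' s *
    exp (h * (\<bar>ln c\<bar> + llr_bound I * real (hits r y y')) + \<Delta> * real (hits r y y'))"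
proof -
  obtain u where u: "u \<in> gridpoints h" "\<bar>u - s\<bar> \<le> h" using gridpoints_dense[OF assms(4,3)] .
  have u01: "u \<in> {0..1}" using u(1) gridpoints_subset[OF assms(4)] by blast
  let ?n = "real (hits r y y')"
  have "rounded c \<Delta> r y y' u \<le> obj c r y y' u * exp (\<Delta> * ?n)"
    by (rule rounded_le_obj[OF assms(2) u01 assms(5)])
  also have "\<dots> \<le> (obj c r y y' s * exp (\<bar>u - s\<bar> * (\<bar>ln c\<bar> + llr_bound I * ?n))) * exp (\<Delta> * ?n)"
    by (intro mult_right_mono obj_lipschitz[OF assms(1-3) u01]) simp
  also have "\<dots> \<le> (obj c r y y' s * exp (h * (\<bar>ln c\<bar> + llr_bound I * ?n))) * exp (\<Delta> * ?n)"
  proof -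
    have "\<bar>u - s\<bar> * (\<bar>ln c\<bar> + llr_bound I * ?n) \<le> h * (\<bar>ln c\<bar> + llr_bound I * ?n)"
      using u(2) llr_bound_pos by (intro mult_right_mono) auto
    then show ?thesis using obj_pos[OF assms(1-3), of r] by (intro mult_right_mono mult_left_mono) auto
  qed
  finally show thesis using that u(1) by (simp add: exp_add mult.assoc)
qed

end


section \<open>Priors, prices and the constant \<open>k_max\<close>\<close>

context multi_label_ensemble
begin

lemma prior_min_pos: "0 < prior_min I"
  unfolding prior_min_def using two_labels prior_pos by (subst Min_gr_iff) auto

lemma prior_bounds: "y \<in> labels I \<Longrightarrow> prior_min I \<le> prior I y" "y \<in> labels I \<Longrightarrow> prior I y \<le> prior_max I"
  unfolding prior_min_def prior_max_def by (auto intro!: Min_le Max_ge)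

lemma prior_min_le_max: "prior_min I \<le> prior_max I"
  using prior_bounds[of 1] two_labels by simp

lemma ln_prior_ratio_nonneg: "0 \<le> ln (prior_max I / prior_min I)"
  using prior_min_pos prior_min_le_max by simp

lemma ratio_pos: "(y, y') \<in> pair_set I \<Longrightarrow> 0 < prior I y' / prior I y"
  using prior_pos pair_setD by simp

lemma abs_ln_ratio_le:
  assumes "(y, y') \<in> pair_set I"
  shows "\<bar>ln (prior I y' / prior I y)\<bar> \<le> ln (prior_max I / prior_min I)"
proof -
  have y: "y \<in> labels I" "y' \<in> labels I" using pair_setD[OF assms] by blast+
  have "ln (prior_min I) \<le> ln (prior I v)" "ln (prior I v) \<le> ln (prior_max I)" if "v \<in> labels I" for v
    using prior_bounds[OF that] prior_pos[OF that] prior_min_pos by auto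
  note b = this[OF y(1)] this[OF y(2)]
  have "ln (prior I y' / prior I y) = ln (prior I y') - ln (prior I y)"
    "ln (prior_max I / prior_min I) = ln (prior_max I) - ln (prior_min I)"
    using prior_pos[OF y(1)] prior_pos[OF y(2)] prior_min_pos prior_min_le_max by (simp_all add: ln_div)
  then show ?thesis using b by linarith
qed

lemma powr_ratio_bounds:
  assumes "(y, y') \<in> pair_set I" "s \<in> {0..1}"
  shows "(prior I y' / prior I y) powr s \<le> prior_max I / prior_min I"
    and "prior_min I / prior_max I \<le> (prior I y' / prior I y) powr s"
proof -
  let ?l = "ln (prior I y' / prior I y)" and ?R = "ln (prior_max I / prior_min I)"
  have "\<bar>s * ?l\<bar> \<le> 1 * ?R"
    unfolding abs_mult using assms(2) abs_ln_ratio_le[OF assms(1)] by (intro mult_mono) auto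
  then have "s * ?l \<le> ?R" "- ?R \<le> s * ?l" by auto
  then have "exp (s * ?l) \<le> exp ?R" "exp (- ?R) \<le> exp (s * ?l)" by simp_all
  moreover have "exp ?R = prior_max I / prior_min I" "exp (- ?R) = prior_min I / prior_max I"
    using prior_min_pos prior_min_le_max by (simp_all add: exp_minus)
  moreover have "(prior I y' / prior I y) powr s = exp (s * ?l)"
    using prior_pos[OF pair_setD(1)[OF assms(1)]] prior_pos[OF pair_setD(2)[OF assms(1)]]
    by (simp add: powr_def)
  ultimately show "(prior I y' / prior I y) powr s \<le> prior_max I / prior_min I"
    "prior_min I / prior_max I \<le> (prior I y' / prior I y) powr s" by simp_all
qed

lemma price_min_pos: "0 < price_min I"
  unfolding price_min_def using nmodels_ge_1 price_pos by (subst Min_gr_iff) auto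

lemma price_min_le: "m \<in> models I \<Longrightarrow> price_min I \<le> price I m"
  unfolding price_min_def by (auto intro!: Min_le)

lemma price_sum_ge: "real (nmodels I) * price_min I \<le> price_sum I"
  using sum_bounded_below[of "models I" "price_min I" "price I"] price_min_le
  by (simp add: price_sum_def)

lemma price_sum_pos: "0 < price_sum I"
  unfolding price_sum_def using nmodels_ge_1 price_pos by (intro sum_pos) auto

lemma samples_le_cost: "price_min I * real (\<Sum>m\<in>models I. r m) \<le> cost I r"
  unfolding cost_def of_nat_sum sum_distrib_left
  using price_min_le by (intro sum_mono mult_right_mono) auto

lemma cost_add_const: "cost I (\<lambda>m. r m + k) = cost I r + real k * price_sum I"
  unfolding cost_def price_sum_def sum_distrib_left sum.distrib[symmetric]
  by (intro sum.cong) (auto simp: algebra_simps)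

lemma cost_const: "cost I (\<lambda>_. k) = real k * price_sum I"
  unfolding cost_def price_sum_def sum_distrib_left by (intro sum.cong) auto

lemma surrogate_error_eq:
  "surrogate_error I y r = (\<Sum>y'\<in>labels I - {y}. INF s\<in>{0..1}. obj (prior I y' / prior I y) r y y' s)"
  by (simp add: surrogate_error_def obj_def)

lemma bdd_below_obj:
  "0 < c \<Longrightarrow> (y, y') \<in> pair_set I \<Longrightarrow> bdd_below (obj c r y y' ` {0..1})"
  using obj_pos by (intro bdd_belowI2[of _ 0]) (auto intro: less_imp_le)

lemma surrogate_error_le:
  assumes y: "y \<in> labels I"
    and v: "\<And>y'. (y, y') \<in> pair_set I \<Longrightarrow> \<exists>s\<in>{0..1}. obj (prior I y' / prior I y) r y y' s \<le> v y'"
  shows "surrogate_error I y r \<le> (\<Sum>y'\<in>labels I - {y}. v y')"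
  unfolding surrogate_error_eq
proof (rule sum_mono)
  fix y' assume "y' \<in> labels I - {y}"
  then have p: "(y, y') \<in> pair_set I" using y by (auto simp: pair_set_def)
  obtain s where s: "s \<in> {0..1}" "obj (prior I y' / prior I y) r y y' s \<le> v y'" using v[OF p] by blast
  have "(INF s\<in>{0..1}. obj (prior I y' / prior I y) r y y' s) \<le> obj (prior I y' / prior I y) r y y' s"
    by (rule cINF_lower[OF bdd_below_obj[OF ratio_pos[OF p] p] s(1)])
  then show "(INF s\<in>{0..1}. obj (prior I y' / prior I y) r y y' s) \<le> v y'" using s(2) by linarith
qed

lemma k_max_ge_1: "1 \<le> k_max I"
proof -
  have "0 < - ln (vartheta I)" using vartheta_bounds gap_pos by simp
  then have "0 < 2 * ln 2 / (- ln (vartheta I))" by (intro divide_pos_pos) auto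
  then show ?thesis unfolding k_max_def by linarith
qed

text \<open>Common form of the two ceilings: \<open>X\<close> is 4 for \<open>k_max\<close>, as 2 ln
  2 = ln 4, and \<open>n_arg\<close> for \<open>n_unif\<close>.\<close>

lemma power_nat_ceiling_le:
  fixes q X :: real
  assumes "0 < q" "q < 1" "0 < X" "ln X / (- ln q) \<le> of_int n" "0 \<le> n"
  shows "q ^ nat n \<le> 1 / X"
proof -
  have "0 < - ln q" using assms by simp
  then have "ln X \<le> real (nat n) * (- ln q)" using assms(4,5) unfolding pos_divide_le_eq[OF \<open>0 < - ln q\<close>] by simp
  then have "real (nat n) * ln q \<le> - ln X" by simp
  then have "exp (real (nat n) * ln q) \<le> exp (- ln X)" by (simp only: exp_le_cancel_iff)
  moreover have "exp (real (nat n) * ln q) = q ^ nat n"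
    using assms(1) by (simp only: exp_of_nat_mult exp_ln)
  moreover have "exp (- ln X) = 1 / X" using assms(3) by (simp add: exp_minus divide_inverse)
  ultimately show ?thesis by simp
qed

lemma vartheta_power: "vartheta I ^ nat (k_max I) \<le> 1 / 4"
proof (rule power_nat_ceiling_le)
  have "ln (4::real) = 2 * ln 2" using ln_realpow[of "2::real" 2] by simp
  then show "ln 4 / (- ln (vartheta I)) \<le> of_int (k_max I)"
    unfolding k_max_def by (simp only: le_of_int_ceiling)
qed (use vartheta_bounds gap_pos k_max_ge_1 in auto)

lemma prod_chern_power_k_max:
  assumes "(y, y') \<in> pair_set I" "s \<in> {delta I..1 - delta I}"
  shows "(\<Prod>m\<in>models I. chern I m y y' s) ^ nat (k_max I) \<le> 1 / 4"
proof -
  have "s \<in> {0..1}" using assms(2) delta_interval_subset by blast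
  then have "(\<Prod>m\<in>models I. chern I m y y' s) ^ nat (k_max I) \<le> vartheta I ^ nat (k_max I)"
    using vartheta_ge[OF assms] prod_chern_pos[OF assms(1)] by (intro power_mono) (auto intro: less_imp_le)
  then show ?thesis using vartheta_power by linarith
qed

end


section \<open>Feasibility and cost of the returned design\<close>

locale algorithm_run = multi_label_ensemble I for I :: "'x ensemble" +
  fixes \<alpha> :: "nat \<Rightarrow> real" and \<epsilon> :: real
  assumes tol: "valid_tolerance I \<alpha>" and eps: "0 < \<epsilon>" "\<epsilon> \<le> 1"
begin

abbreviation "N \<equiv> N_max I \<alpha>"
abbreviation "h \<equiv> step_h I \<alpha> \<epsilon>"
abbreviation "\<Delta> \<equiv> step_Delta I \<alpha> \<epsilon>"
abbreviation "T \<equiv> T_max I \<alpha> \<epsilon>"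
abbreviation "ratio y y' \<equiv> prior I y' / prior I y"

section \<open>Constants that depend on the tolerances\<close>

lemma tol_min_bounds: "0 < tol_min I \<alpha>" "tol_min I \<alpha> < 1" "y \<in> labels I \<Longrightarrow> tol_min I \<alpha> \<le> \<alpha> y"
proof -
  have "tol_min I \<alpha> \<in> \<alpha> ` labels I" unfolding tol_min_def using two_labels by (intro Min_in) auto
  then show "0 < tol_min I \<alpha>" "tol_min I \<alpha> < 1" using tol by (auto simp: valid_tolerance_def)
  show "tol_min I \<alpha> \<le> \<alpha> y" if "y \<in> labels I" using that by (simp add: tol_min_def)
qed

text \<open>The argument of the logarithm in \<open>n_unif\<close>. Its inverse times the largest
  prior ratio is the share of \<open>tol_min\<close> that each competing label receives.\<close>

definition n_arg :: real where
  "n_arg = (real (nlabels I) - 1) * prior_max I / (prior_min I * tol_min I \<alpha>)"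

lemma n_arg_ge: "1 / tol_min I \<alpha> \<le> n_arg"
proof -
  have "1 * prior_min I \<le> (real (nlabels I) - 1) * prior_max I"
    using two_labels prior_min_le_max prior_min_pos by (intro mult_mono) auto
  then have "1 \<le> (real (nlabels I) - 1) * prior_max I / prior_min I"
    using prior_min_pos by simp
  then have "1 / tol_min I \<alpha> \<le> ((real (nlabels I) - 1) * prior_max I / prior_min I) / tol_min I \<alpha>"
    using tol_min_bounds(1) by (intro divide_right_mono) auto
  then show ?thesis by (simp add: n_arg_def)
qed

lemma ln_rho_pos: "0 < - ln (rho I)"
  using rho_bounds gap_pos by simp

text \<open>Shows that \<open>n_unif\<close>, and with it \<open>N_max\<close>, grows without bound
  as the tolerances shrink, which later drives both step sizes to 0.\<close>

lemma n_unif_ge: "ln (1 / tol_min I \<alpha>) / (- ln (rho I)) \<le> of_int (n_unif I \<alpha>)"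
proof -
  have "ln (1 / tol_min I \<alpha>) \<le> ln n_arg"
    using n_arg_ge tol_min_bounds by (subst ln_le_cancel_iff) (auto intro: less_le_trans[OF _ n_arg_ge])
  then have "ln (1 / tol_min I \<alpha>) / (- ln (rho I)) \<le> ln n_arg / (- ln (rho I))"
    using ln_rho_pos by (intro divide_right_mono) auto
  then show ?thesis unfolding n_unif_def n_arg_def by linarith
qed

lemma ln_inverse_tol_min_pos: "0 < ln (1 / tol_min I \<alpha>)"
  using tol_min_bounds by simp

lemma n_unif_ge_1: "1 \<le> n_unif I \<alpha>"
proof -
  have "0 < ln (1 / tol_min I \<alpha>) / (- ln (rho I))"
    using ln_inverse_tol_min_pos ln_rho_pos by (intro divide_pos_pos)
  then show ?thesis using n_unif_ge by linarith
qed

lemma rho_power: "rho I ^ nat (n_unif I \<alpha>) \<le> 1 / n_arg"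
proof (rule power_nat_ceiling_le)
  show "ln n_arg / (- ln (rho I)) \<le> of_int (n_unif I \<alpha>)"
    unfolding n_unif_def n_arg_def by linarith
  show "0 < n_arg" using n_arg_ge tol_min_bounds(1) by (meson less_le_trans zero_less_divide_1_iff)
qed (use rho_bounds gap_pos n_unif_ge_1 in auto)

lemma N_max_ge: "of_int (n_unif I \<alpha> + k_max I) * real (nmodels I) \<le> N" "of_int (n_unif I \<alpha>) \<le> N" "0 < N"
proof -
  have "real (nmodels I) \<le> price_sum I / price_min I"
    using price_sum_ge price_min_pos by (simp add: pos_le_divide_eq)
  then have "of_int (n_unif I \<alpha>) * real (nmodels I) \<le> of_int (n_unif I \<alpha>) * (price_sum I / price_min I)"
    using n_unif_ge_1 by (intro mult_left_mono) auto
  then show *: "of_int (n_unif I \<alpha> + k_max I) * real (nmodels I) \<le> N"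
    by (simp add: N_max_def algebra_simps)
  have "of_int (n_unif I \<alpha>) * 1 \<le> of_int (n_unif I \<alpha> + k_max I) * real (nmodels I)"
    using n_unif_ge_1 k_max_ge_1 nmodels_ge_1 by (intro mult_mono) auto
  then show "of_int (n_unif I \<alpha>) \<le> N" using * by simp
  then show "0 < N" using n_unif_ge_1 by linarith
qed

lemma Lambda_ge: "llr_bound I * N \<le> Lambda I \<alpha>" "0 < Lambda I \<alpha>"
proof -
  show "llr_bound I * N \<le> Lambda I \<alpha>" using ln_prior_ratio_nonneg by (simp add: Lambda_def)
  then show "0 < Lambda I \<alpha>" using mult_pos_pos[OF llr_bound_pos N_max_ge(3)] by linarith
qed

lemma steps_pos: "0 < h" "0 < \<Delta>"
  using Lambda_ge N_max_ge eps by (auto simp: step_h_def step_Delta_def)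

text \<open>\<open>h\<close> times \<open>Lambda\<close> and \<open>\<Delta>\<close> times
  \<open>N\<close> both equal ln(1 + \<epsilon>) \<le> ln 2, so within the budget each rounding
  costs at most a factor 2.\<close>

lemma rounded_le_4_obj:
  assumes p: "(y, y') \<in> pair_set I" and s: "s \<in> {0..1}" and r: "real (\<Sum>m\<in>models I. r m) \<le> N"
  obtains u where "u \<in> gridpoints h" "rounded (ratio y y') \<Delta> r y y' u \<le> 4 * obj (ratio y y') r y y' s"
proof -
  let ?c = "ratio y y'" and ?n = "real (hits r y y')"
  obtain u where u: "u \<in> gridpoints h" "rounded ?c \<Delta> r y y' u \<le> obj ?c r y y' s *
      exp (h * (\<bar>ln ?c\<bar> + llr_bound I * ?n) + \<Delta> * ?n)"
    using rounded_on_grid[OF ratio_pos[OF p] p s steps_pos] .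
  have n: "?n \<le> N" using hits_le[of r y y'] r by linarith
  have "llr_bound I * ?n \<le> llr_bound I * N" using n llr_bound_pos by simp
  then have "h * (\<bar>ln ?c\<bar> + llr_bound I * ?n) \<le> h * Lambda I \<alpha>"
    using abs_ln_ratio_le[OF p] steps_pos unfolding Lambda_def by (intro mult_left_mono) auto
  also have "\<dots> = ln (1 + \<epsilon>)" using Lambda_ge by (simp add: step_h_def)
  finally have "h * (\<bar>ln ?c\<bar> + llr_bound I * ?n) \<le> ln 2"
    using eps by (smt (verit) ln_le_cancel_iff)
  moreover have "\<Delta> * ?n \<le> \<Delta> * N" using n steps_pos by simp
  then have "\<Delta> * ?n \<le> ln (1 + \<epsilon>)" using N_max_ge by (simp add: step_Delta_def)
  then have "\<Delta> * ?n \<le> ln 2" using eps by (smt (verit) ln_le_cancel_iff)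
  ultimately have "exp (h * (\<bar>ln ?c\<bar> + llr_bound I * ?n) + \<Delta> * ?n) \<le> exp (ln 2 + ln 2)"
    by (subst exp_le_cancel_iff) linarith
  also have "\<dots> = (4::real)" unfolding exp_add by simp
  finally have "obj ?c r y y' s * exp (h * (\<bar>ln ?c\<bar> + llr_bound I * ?n) + \<Delta> * ?n) \<le> obj ?c r y y' s * 4"
    using obj_pos[OF ratio_pos[OF p] p s, of r] by (intro mult_left_mono) auto
  then show thesis using that u by (simp add: mult.commute)
qed

text \<open>The bounds \<open>v\<close> are left open because they are chosen in two ways: equal
  shares of the smallest tolerance for the uniform design, and the infima of a given feasible design
  for near-optimality.\<close>

lemma candidate_cost:
  assumes run: "(res, n) \<in> algorithm I \<alpha> \<epsilon>"
    and r: "real (\<Sum>m\<in>models I. r m) \<le> N"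
    and v: "\<And>y y'. (y, y') \<in> pair_set I \<Longrightarrow> \<exists>u\<in>gridpoints h. rounded (ratio y y') \<Delta> r y y' u \<le> v y y'"
    and \<alpha>: "\<And>y. y \<in> labels I \<Longrightarrow> (\<Sum>y'\<in>labels I - {y}. v y y') \<le> \<alpha> y"
  shows "\<exists>r'. res = Some r' \<and> cost I r' \<le> cost I r"
proof -
  have "\<forall>p\<in>pair_set I. \<exists>u. u \<in> gridpoints h \<and> rounded (ratio (fst p) (snd p)) \<Delta> r (fst p) (snd p) u \<le> v (fst p) (snd p)"
    using v by fastforce
  then obtain \<sigma> where \<sigma>: "\<And>p. p \<in> pair_set I \<Longrightarrow> \<sigma> p \<in> gridpoints h"
    "\<And>p. p \<in> pair_set I \<Longrightarrow> rounded (ratio (fst p) (snd p)) \<Delta> r (fst p) (snd p) (\<sigma> p) \<le> v (fst p) (snd p)"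
    using bchoice by metis
  \<comment> \<open>The largest state that \<open>r\<close> reaches, hence the one with the smallest
    terms in \<open>admissible\<close>.\<close>
  define \<tau> where "\<tau> p = (\<Sum>m\<in>models I. r m * weight \<Delta> (fst p) (snd p) (\<sigma> p) m)" for p
  define s where "s = map \<sigma> (pairs I)"
  define t where "t = map \<tau> (pairs I)"
  have len: "length s = length (pairs I)" by (simp add: s_def)
  have "set s \<subseteq> gridpoints h" using \<sigma>(1) by (auto simp: s_def)
  then have sg: "s \<in> set (grid I h)" by (simp add: grid_def set_n_lists len gridpoints_def)
  \<comment> \<open>The table is large enough: each of the at most \<open>N\<close> samples adds at
    most B / \<open>\<Delta>\<close>.\<close>
  have "\<tau> p \<le> T" if p: "p \<in> pair_set I" for p
  proof -
    obtain y y' where yy: "p = (y, y')" by fastforce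
    have u: "\<sigma> p \<in> {0..1}" using \<sigma>(1)[OF p] gridpoints_subset[OF steps_pos(1)] by blast
    have "\<Delta> * real (\<tau> p) = (\<Sum>m\<in>models I. real (r m) * (\<Delta> * real (weight \<Delta> y y' (\<sigma> p) m)))"
      by (simp add: \<tau>_def yy sum_distrib_left ac_simps)
    also have "\<dots> \<le> (\<Sum>m\<in>models I. real (r m) * llr_bound I)"
      using weight_bounds(3)[OF _ p[unfolded yy] u[unfolded yy] steps_pos(2)] yy
      by (intro sum_mono mult_left_mono) auto
    also have "\<dots> = real (\<Sum>m\<in>models I. r m) * llr_bound I" by (simp add: sum_distrib_right)
    also have "\<dots> \<le> N * llr_bound I" using r llr_bound_pos by (intro mult_right_mono) auto
    finally have "real (\<tau> p) \<le> llr_bound I * N / \<Delta>" using steps_pos(2) by (simp add: field_simps)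
    then show ?thesis unfolding T_max_def by linarith
  qed
  then have ts: "t \<in> set (states I T)" by (auto simp: mem_states t_def)
  have adm: "admissible I \<alpha> \<Delta> s t"
    unfolding admissible_def
  proof (intro ballI)
    fix y assume y: "y \<in> labels I"
    have "(\<Sum>y'\<in>labels I - {y}. ratio y y' powr entry I s (y, y') * exp (- \<Delta> * real (entry I t (y, y'))))
        \<le> (\<Sum>y'\<in>labels I - {y}. v y y')"
    proof (rule sum_mono)
      fix y' assume "y' \<in> labels I - {y}"
      then have p: "(y, y') \<in> pair_set I" using y by (auto simp: pair_set_def)
      show "ratio y y' powr entry I s (y, y') * exp (- \<Delta> * real (entry I t (y, y'))) \<le> v y y'"
        using \<sigma>(2)[OF p] by (simp add: s_def t_def entry_map_pairs[OF p] rounded_def \<tau>_def)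
    qed
    then show "(\<Sum>y'\<in>labels I - {y}. ratio y y' powr entry I s (y, y') * exp (- \<Delta> * real (entry I t (y, y'))))
        \<le> \<alpha> y" using \<alpha>[OF y] by linarith
  qed
  have "reaches I (weights I \<Delta> s) r t"
    unfolding reaches_def
  proof (intro allI impI)
    fix i assume i: "i < length t"
    then have "i < length (pairs I)" by (simp add: t_def)
    then show "t ! i \<le> (\<Sum>m\<in>models I. r m * (weights I \<Delta> s m ! i))"
      using weights_nth[OF _ len] by (simp add: t_def \<tau>_def weight_def s_def)
  qed
  then show ?thesis
    using algorithm_correct(2)[OF price_pos run sg ts adm] by blast
qed

text \<open>Every approximation errs on the safe side: a single exponent bounds the infimum from
  above, rounding weights down raises the objective, and the tested state is at most the weight
  actually collected.\<close>

lemma algorithm_feasible: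
  assumes run: "(Some r, n) \<in> algorithm I \<alpha> \<epsilon>" and y: "y \<in> labels I"
  shows "surrogate_error I y r \<le> \<alpha> y"
proof -
  obtain s t where s: "s \<in> set (grid I h)" and t: "t \<in> set (states I T)"
    and adm: "admissible I \<alpha> \<Delta> s t" and reach: "reaches I (weights I \<Delta> s) r t"
    using algorithm_correct(1)[OF price_pos run] by blast
  have ls: "length s = length (pairs I)" by (rule length_mem_grid[OF s])
  have lt: "length t = length (pairs I)" using t by (simp add: mem_states)
  have "surrogate_error I y r \<le>
    (\<Sum>y'\<in>labels I - {y}. ratio y y' powr entry I s (y, y') * exp (- \<Delta> * real (entry I t (y, y'))))"
  proof (rule surrogate_error_le[OF y])
    fix y' assume p: "(y, y') \<in> pair_set I"
    then obtain i where i: "i < length (pairs I)" "pairs I ! i = (y, y')"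
      by (metis in_set_conv_nth set_pairs)
    have es: "entry I s (y, y') = s ! i" and et: "entry I t (y, y') = t ! i"
      using entry_nth[OF i(1) ls] entry_nth[OF i(1) lt] i(2) by simp_all
    have "set s \<subseteq> gridpoints h" using s by (simp add: grid_def set_n_lists gridpoints_def)
    then have "s ! i \<in> gridpoints h" using i(1) ls by auto
    then have u: "s ! i \<in> {0..1}" using gridpoints_subset[OF steps_pos(1)] by blast
    have "obj (ratio y y') r y y' (s ! i) \<le> rounded (ratio y y') \<Delta> r y y' (s ! i)"
      by (rule obj_le_rounded[OF p u steps_pos(2)])
    also have "\<dots> \<le> ratio y y' powr (s ! i) * exp (- \<Delta> * real (t ! i))"
    proof -
      have "weights I \<Delta> s m ! i = weight \<Delta> y y' (s ! i) m" for m
        using weights_nth[OF i(1) ls] i(2) by (simp add: weight_def)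
      moreover have "t ! i \<le> (\<Sum>m\<in>models I. r m * (weights I \<Delta> s m ! i))"
        using reach i(1) lt by (simp add: reaches_def)
      ultimately have "t ! i \<le> (\<Sum>m\<in>models I. r m * weight \<Delta> y y' (s ! i) m)" by simp
      then have "\<Delta> * real (t ! i) \<le> \<Delta> * real (\<Sum>m\<in>models I. r m * weight \<Delta> y y' (s ! i) m)"
        using steps_pos(2) by (intro mult_left_mono) linarith+
      then show ?thesis unfolding rounded_def by (intro mult_left_mono) auto
    qed
    finally show "\<exists>u\<in>{0..1}. obj (ratio y y') r y y' u
        \<le> ratio y y' powr entry I s (y, y') * exp (- \<Delta> * real (entry I t (y, y')))"
      using u es et by auto
  qed
  also have "\<dots> \<le> \<alpha> y" using adm y by (simp add: admissible_def)
  finally show ?thesis .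
qed

text \<open>The exponent lies in the \<open>delta\<close> interval, so that \<open>k_max\<close>
  further samples of every model still gain the factor 4 at the same exponent.\<close>

lemma uniform_obj_le:
  assumes p: "(y, y') \<in> pair_set I"
  obtains s where "s \<in> {delta I..1 - delta I}"
    "obj (ratio y y') (\<lambda>_. nat (n_unif I \<alpha>)) y y' s \<le> tol_min I \<alpha> / (real (nlabels I) - 1)"
proof -
  obtain s where s: "s \<in> {delta I..1 - delta I}" "(\<Prod>m\<in>models I. chern I m y y' s) \<le> rho I"
    using rho_witness[OF p] by blast
  have s01: "s \<in> {0..1}" using s(1) delta_interval_subset by blast
  have "(\<Prod>m\<in>models I. chern I m y y' s) ^ nat (n_unif I \<alpha>) \<le> rho I ^ nat (n_unif I \<alpha>)"
    using s(2) prod_chern_pos[OF p s01] by (intro power_mono) auto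
  also have "\<dots> \<le> 1 / n_arg" by (rule rho_power)
  finally have "obj (ratio y y') (\<lambda>_. nat (n_unif I \<alpha>)) y y' s \<le> (prior_max I / prior_min I) * (1 / n_arg)"
    unfolding obj_const using powr_ratio_bounds(1)[OF p s01] prior_min_pos prior_min_le_max
      prod_chern_pos[OF p s01] by (intro mult_mono) auto
  also have "\<dots> = tol_min I \<alpha> / (real (nlabels I) - 1)"
    using prior_min_pos prior_min_le_max tol_min_bounds(1) two_labels by (simp add: n_arg_def)
  finally show thesis using that s(1) by blast
qed

lemma sum_tol_min_le:
  assumes "y \<in> labels I"
  shows "(\<Sum>y'\<in>labels I - {y}. tol_min I \<alpha> / (real (nlabels I) - 1)) \<le> \<alpha> y"
  using assms two_labels tol_min_bounds(3)[OF assms] by (simp add: of_nat_diff)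

lemma uniform_feasible: "surrogate_feasible I \<alpha> (\<lambda>_. nat (n_unif I \<alpha>))"
  unfolding surrogate_feasible_def
proof
  fix y assume y: "y \<in> labels I"
  have "surrogate_error I y (\<lambda>_. nat (n_unif I \<alpha>))
      \<le> (\<Sum>y'\<in>labels I - {y}. tol_min I \<alpha> / (real (nlabels I) - 1))"
    by (rule surrogate_error_le[OF y]) (use uniform_obj_le delta_interval_subset in blast)
  then show "surrogate_error I y (\<lambda>_. nat (n_unif I \<alpha>)) \<le> \<alpha> y" using sum_tol_min_le[OF y] by linarith
qed

text \<open>The candidate takes \<open>n_unif\<close> + \<open>k_max\<close> samples of every model.
  The gain of 4 cancels the rounding loss, and this works for every valid tolerance.\<close>

lemma algorithm_finds_design:
  assumes run: "(res, n) \<in> algorithm I \<alpha> \<epsilon>"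
  shows "\<exists>r. res = Some r"
proof -
  let ?n = "nat (n_unif I \<alpha>)" and ?k = "nat (k_max I)"
  have "real (\<Sum>m\<in>models I. ?n + ?k) = of_int (n_unif I \<alpha> + k_max I) * real (nmodels I)"
    using n_unif_ge_1 k_max_ge_1 by (simp add: algebra_simps)
  then have total: "real (\<Sum>m\<in>models I. ?n + ?k) \<le> N" using N_max_ge(1) by linarith
  have "\<exists>u\<in>gridpoints h. rounded (ratio y y') \<Delta> (\<lambda>_. ?n + ?k) y y' u \<le> tol_min I \<alpha> / (real (nlabels I) - 1)"
    if p: "(y, y') \<in> pair_set I" for y y'
  proof -
    obtain s where s: "s \<in> {delta I..1 - delta I}"
      "obj (ratio y y') (\<lambda>_. ?n) y y' s \<le> tol_min I \<alpha> / (real (nlabels I) - 1)"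
      using uniform_obj_le[OF p] .
    have s01: "s \<in> {0..1}" using s(1) delta_interval_subset by blast
    obtain u where u: "u \<in> gridpoints h"
      "rounded (ratio y y') \<Delta> (\<lambda>_. ?n + ?k) y y' u \<le> 4 * obj (ratio y y') (\<lambda>_. ?n + ?k) y y' s"
      using rounded_le_4_obj[OF p s01 total] .
    have "obj (ratio y y') (\<lambda>_. ?n + ?k) y y' s \<le> obj (ratio y y') (\<lambda>_. ?n) y y' s * (1 / 4)"
      unfolding obj_add_const using prod_chern_power_k_max[OF p s(1)] obj_pos[OF ratio_pos[OF p] p s01]
      by (intro mult_left_mono) (auto intro: less_imp_le)
    then show ?thesis using u s(2) by (intro bexI[OF _ u(1)]) linarith
  qed
  from candidate_cost[OF run total this sum_tol_min_le] show ?thesis by blast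
qed

end


section \<open>Pairs with few distinguishing samples, and growth of the optimum\<close>

context multi_label_ensemble
begin

text \<open>
  At an interior minimiser the additional samples yield a factor below 1, which absorbs a small
  enough rounding loss; a minimiser in \<open>{0, 1}\<close> is itself a grid point, where all weights vanish.
\<close>

lemma rounded_le_obj_small_steps:
  assumes c: "0 < c" and p: "(y, y') \<in> pair_set I" and k: "1 \<le> k"
  shows "\<exists>\<nu>>0. \<forall>h \<Delta>. 0 < h \<and> h \<le> \<nu> \<and> 0 < \<Delta> \<and> \<Delta> \<le> \<nu> \<longrightarrow>
    (\<exists>u\<in>gridpoints h. \<forall>s\<in>{0..1}. rounded c \<Delta> (\<lambda>m. r m + k) y y' u \<le> obj c r y y' s)"
proof -
  obtain s where s: "s \<in> {0..1}" "\<forall>u\<in>{0..1}. obj c r y y' s \<le> obj c r y y' u"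
    using obj_attains_min[OF c p] .
  consider (boundary) "s = 0 \<or> s = 1" | (interior) "0 < s" "s < 1" using s(1) by fastforce
  then show ?thesis
  proof cases
    case boundary
    have one: "chern I m y y' s = 1" if "m \<in> models I" for m
      using boundary chern_0[OF that p] chern_1[OF that p] by auto
    then have "rounded c \<Delta> (\<lambda>m. r m + k) y y' s = obj c r y y' s" for \<Delta>
      by (simp add: rounded_def obj_def weight_def)
    moreover have "s \<in> gridpoints h" for h using boundary gridpoints_endpoints by auto
    ultimately have "\<exists>u\<in>gridpoints h. \<forall>s\<in>{0..1}. rounded c \<Delta> (\<lambda>m. r m + k) y y' u \<le> obj c r y y' s"
      for h \<Delta>
      using s(2) by metis
    then show ?thesis by (intro exI[of _ 1]) simp
  next
    case interior
    let ?r = "\<lambda>m. r m + k"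
    let ?n = "real (hits ?r y y')"
    define q where "q = (\<Prod>m\<in>models I. chern I m y y' s) ^ k"
    have q: "0 < q" "q < 1"
      unfolding q_def using prod_chern_pos[OF p s(1)] prod_chern_less_1[OF p interior] k
      by (auto intro: power_less_one_iff[THEN iffD2] simp: power_Suc_less_one)
    \<comment> \<open>The logarithm of the rounding loss is at most \<open>\<nu>\<close> *
      \<open>M\<close>, and \<open>\<nu>\<close> is chosen so that this equals -ln q, the gain of
      the \<open>k\<close> extra samples. The summand 1 keeps \<open>M\<close> positive.\<close>
    define M where "M = \<bar>ln c\<bar> + llr_bound I * ?n + ?n + 1"
    have M: "0 < M" unfolding M_def using llr_bound_pos by (simp add: add_nonneg_pos)
    define \<nu> where "\<nu> = - ln q / M"
    have \<nu>: "0 < \<nu>" unfolding \<nu>_def using q M by (intro divide_pos_pos) auto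
    have "\<exists>u\<in>gridpoints h. \<forall>v\<in>{0..1}. rounded c \<Delta> ?r y y' u \<le> obj c r y y' v"
      if h: "0 < h" "h \<le> \<nu>" and \<Delta>: "0 < \<Delta>" "\<Delta> \<le> \<nu>" for h \<Delta>
    proof -
      obtain u where u: "u \<in> gridpoints h" "rounded c \<Delta> ?r y y' u \<le> obj c ?r y y' s *
          exp (h * (\<bar>ln c\<bar> + llr_bound I * ?n) + \<Delta> * ?n)"
        using rounded_on_grid[OF c p s(1) h(1) \<Delta>(1)] .
      have "h * (\<bar>ln c\<bar> + llr_bound I * ?n) + \<Delta> * ?n \<le> \<nu> * (\<bar>ln c\<bar> + llr_bound I * ?n) + \<nu> * ?n"
        using h \<Delta> llr_bound_pos by (intro add_mono mult_right_mono) auto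
      also have "\<dots> \<le> \<nu> * M" unfolding M_def using \<nu> by (simp add: algebra_simps)
      also have "\<dots> = - ln q" using M by (simp add: \<nu>_def)
      finally have "exp (h * (\<bar>ln c\<bar> + llr_bound I * ?n) + \<Delta> * ?n) \<le> exp (- ln q)" by simp
      also have "\<dots> = 1 / q" using q by (simp add: exp_minus divide_inverse)
      finally have "obj c ?r y y' s * exp (h * (\<bar>ln c\<bar> + llr_bound I * ?n) + \<Delta> * ?n)
          \<le> obj c ?r y y' s * (1 / q)"
        using obj_pos[OF c p s(1)] by (intro mult_left_mono) (auto intro: less_imp_le)
      also have "\<dots> = obj c r y y' s"
        unfolding obj_add_const q_def[symmetric] using q by simp
      finally have "rounded c \<Delta> ?r y y' u \<le> obj c r y y' s" using u(2) by linarith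
      then show ?thesis using u(1) s(2) by force
    qed
    then show ?thesis using \<nu> by blast
  qed
qed

lemma obj_restrict:
  assumes "(y, y') \<in> pair_set I"
  shows "obj c (\<lambda>m. if m \<in> models I \<and> distinguishes I m y y' then r m else 0) y y' s = obj c r y y' s"
proof -
  have "chern I m y y' s ^ (if m \<in> models I \<and> distinguishes I m y y' then r m else 0)
      = chern I m y y' s ^ r m" if "m \<in> models I" for m
    using that chern_not_distinguishes[OF that assms] by auto
  then show ?thesis unfolding obj_def by (intro arg_cong2[of _ _ _ _ "(*)"] prod.cong) auto
qed

lemma rounded_restrict:
  assumes "(y, y') \<in> pair_set I"
  shows "rounded c \<Delta> (\<lambda>m. (if m \<in> models I \<and> distinguishes I m y y' then r m else 0) + k) y y' s
    = rounded c \<Delta> (\<lambda>m. r m + k) y y' s"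
proof -
  have "((if m \<in> models I \<and> distinguishes I m y y' then r m else 0) + k) * weight \<Delta> y y' s m
      = (r m + k) * weight \<Delta> y y' s m" if "m \<in> models I" for m
    using that chern_not_distinguishes[OF that assms] by (auto simp: weight_def)
  then have "(\<Sum>m\<in>models I. ((if m \<in> models I \<and> distinguishes I m y y' then r m else 0) + k) * weight \<Delta> y y' s m)
      = (\<Sum>m\<in>models I. (r m + k) * weight \<Delta> y y' s m)"
    by (intro sum.cong) auto
  then show ?thesis unfolding rounded_def by simp
qed

text \<open>
  The objective of a pair only involves the samples of the models that distinguish it, so a bound
  on their number leaves finitely many objectives.
\<close>

lemma rounded_le_obj_few_hits:
  assumes k: "1 \<le> k"
  obtains \<nu> where "0 < \<nu>"
    "\<And>y y' r h \<Delta>. (y, y') \<in> pair_set I \<Longrightarrow> hits r y y' \<le> R \<Longrightarrow>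
      0 < h \<Longrightarrow> h \<le> \<nu> \<Longrightarrow> 0 < \<Delta> \<Longrightarrow> \<Delta> \<le> \<nu> \<Longrightarrow>
      \<exists>u\<in>gridpoints h. \<forall>s\<in>{0..1}. rounded (prior I y' / prior I y) \<Delta> (\<lambda>m. r m + k) y y' u
        \<le> obj (prior I y' / prior I y) r y y' s"
proof -
  define good where "good \<nu> x \<longleftrightarrow> (case x of ((y, y'), r) \<Rightarrow>
      \<forall>h \<Delta>. 0 < h \<and> h \<le> \<nu> \<and> 0 < \<Delta> \<and> \<Delta> \<le> \<nu> \<longrightarrow>
    (\<exists>u\<in>gridpoints h. \<forall>s\<in>{0..1}. rounded (prior I y' / prior I y) \<Delta> (\<lambda>m. r m + k) y y' u
        \<le> obj (prior I y' / prior I y) r y y' s))" for \<nu> :: real and x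
  define F where "F = {r :: nat \<Rightarrow> nat. \<forall>m. (m \<in> models I \<longrightarrow> r m \<in> {..R}) \<and> (m \<notin> models I \<longrightarrow> r m = 0)}"
  have "finite F" unfolding F_def by (rule finite_set_of_finite_funs) auto
  then have fin: "finite (pair_set I \<times> F)" using finite_pair_set by simp
  \<comment> \<open>Each of finitely many objectives has its own threshold; the filter at 0 from the
    right merges them into one.\<close>
  have "\<forall>x\<in>pair_set I \<times> F. eventually (\<lambda>\<nu>. good \<nu> x) (at_right 0)"
  proof
    fix x assume "x \<in> pair_set I \<times> F"
    then obtain y y' r where x: "x = ((y, y'), r)" and p: "(y, y') \<in> pair_set I" by auto
    obtain \<nu>0 where \<nu>0: "0 < \<nu>0" "good \<nu>0 x"
      using rounded_le_obj_small_steps[OF ratio_pos[OF p] p k, of r] by (auto simp: good_def x)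
    have "good \<nu> x" if "\<nu> < \<nu>0" for \<nu>
      using \<nu>0(2) that unfolding good_def x by fastforce
    then show "eventually (\<lambda>\<nu>. good \<nu> x) (at_right 0)"
      unfolding eventually_at_right_field using \<nu>0(1) by blast
  qed
  from eventually_ball_finite[OF fin this]
  obtain \<nu>1 where \<nu>1: "0 < \<nu>1" "\<And>\<nu>. 0 < \<nu> \<Longrightarrow> \<nu> < \<nu>1 \<Longrightarrow> \<forall>x\<in>pair_set I \<times> F. good \<nu> x"
    unfolding eventually_at_right_field by blast
  have all: "\<forall>x\<in>pair_set I \<times> F. good (\<nu>1 / 2) x" using \<nu>1 by simp
  show thesis
  proof (rule that[of "\<nu>1 / 2"])
    show "0 < \<nu>1 / 2" using \<nu>1(1) by simp
    fix y y' r h \<Delta>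
    assume p: "(y, y') \<in> pair_set I" and R: "hits r y y' \<le> R"
      and st: "0 < h" "h \<le> \<nu>1 / 2" "0 < \<Delta>" "\<Delta> \<le> \<nu>1 / 2"
    define r0 where "r0 = (\<lambda>m. if m \<in> models I \<and> distinguishes I m y y' then r m else 0)"
    have "r m \<le> R" if "m \<in> models I" "distinguishes I m y y'" for m
    proof -
      have "(if distinguishes I m y y' then r m else 0) \<le> hits r y y'"
        unfolding hits_def using that(1) by (intro member_le_sum) auto
      then show ?thesis using that(2) R by simp
    qed
    then have "r0 \<in> F" by (auto simp: F_def r0_def)
    then have "good (\<nu>1 / 2) ((y, y'), r0)" using all p by blast
    then have "\<exists>u\<in>gridpoints h. \<forall>s\<in>{0..1}. rounded (prior I y' / prior I y) \<Delta> (\<lambda>m. r0 m + k) y y' u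
        \<le> obj (prior I y' / prior I y) r0 y y' s"
      using st unfolding good_def by blast
    then show "\<exists>u\<in>gridpoints h. \<forall>s\<in>{0..1}. rounded (prior I y' / prior I y) \<Delta> (\<lambda>m. r m + k) y y' u
        \<le> obj (prior I y' / prior I y) r y y' s"
      unfolding r0_def obj_restrict[OF p] rounded_restrict[OF p] .
  qed
qed

text \<open>Each sample multiplies an objective by at least exp(-B), so an error below a small
  tolerance takes many samples. This makes the optimum exceed any fixed extra cost.\<close>

lemma feasible_samples_ge:
  assumes "valid_tolerance I \<alpha>" "surrogate_feasible I \<alpha> r"
  shows "ln (1 / tol_min I \<alpha>) - ln (prior_max I / prior_min I) \<le> llr_bound I * real (\<Sum>m\<in>models I. r m)"
proof -
  let ?S = "real (\<Sum>m\<in>models I. r m)" and ?B = "llr_bound I"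
  have "tol_min I \<alpha> \<in> \<alpha> ` labels I" unfolding tol_min_def using two_labels by (intro Min_in) auto
  then obtain y where y: "y \<in> labels I" "tol_min I \<alpha> = \<alpha> y" by auto
  have a: "0 < \<alpha> y" using assms(1) y by (simp add: valid_tolerance_def)
  obtain y' where y': "y' \<in> labels I" "y' \<noteq> y"
  proof (cases "y = 1")
    case True
    then show thesis using that[of 2] two_labels by simp
  next
    case False
    then show thesis using that[of 1] two_labels by simp
  qed
  have pp: "(y, v) \<in> pair_set I" if "v \<in> labels I - {y}" for v using that y by (auto simp: pair_set_def)
  have p: "(y, y') \<in> pair_set I" using y y' by (auto simp: pair_set_def)
  have lower: "prior_min I / prior_max I * exp (- ?B * ?S) \<le> obj (prior I y' / prior I y) r y y' s"
    if s: "s \<in> {0..1}" for s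
  proof -
    have "exp (- ?B * ?S) = (\<Prod>m\<in>models I. exp (- ?B) ^ r m)"
      by (simp add: exp_sum[symmetric] sum_distrib_left sum_negf exp_of_nat_mult[symmetric] mult.commute)
    also have "\<dots> \<le> (\<Prod>m\<in>models I. chern I m y y' s ^ r m)"
      using chern_ge[OF _ p s] by (intro prod_mono conjI power_mono) auto
    finally show ?thesis
      unfolding obj_def using powr_ratio_bounds(2)[OF p s] by (intro mult_mono) auto
  qed
  have nonneg: "0 \<le> (INF s\<in>{0..1}. obj (prior I v / prior I y) r y v s)" if "v \<in> labels I - {y}" for v
    using obj_pos[OF ratio_pos[OF pp[OF that]] pp[OF that]] by (intro cINF_greatest) (auto intro: less_imp_le)
  have "prior_min I / prior_max I * exp (- ?B * ?S)
      \<le> (INF s\<in>{0..1}. obj (prior I y' / prior I y) r y y' s)"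
    using lower by (intro cINF_greatest) auto
  also have "\<dots> \<le> surrogate_error I y r"
    unfolding surrogate_error_eq using y' nonneg by (intro member_le_sum) auto
  also have "\<dots> \<le> tol_min I \<alpha>" using assms(2) y by (simp add: surrogate_feasible_def)
  finally have le: "prior_min I / prior_max I * exp (- ?B * ?S) \<le> tol_min I \<alpha>" .
  have pos: "0 < prior_min I / prior_max I" using prior_min_pos prior_min_le_max by simp
  have "ln (prior_min I / prior_max I * exp (- ?B * ?S)) \<le> ln (tol_min I \<alpha>)"
    using le mult_pos_pos[OF pos exp_gt_zero] a y by (subst ln_le_cancel_iff) auto
  moreover have "ln (prior_min I / prior_max I * exp (- ?B * ?S)) = ln (prior_min I / prior_max I) - ?B * ?S"
    using pos by (subst ln_mult_pos) auto
  moreover have "ln (prior_max I / prior_min I) = - ln (prior_min I / prior_max I)"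
    using prior_min_pos prior_min_le_max by (simp add: ln_div)
  moreover have "ln (1 / tol_min I \<alpha>) = - ln (tol_min I \<alpha>)" using a y by (simp add: ln_div)
  ultimately show ?thesis by linarith
qed

end

section \<open>Near-optimality\<close>

context algorithm_run
begin

lemma steps_le:
  assumes "1 / \<nu> \<le> N" "1 / (llr_bound I * \<nu>) \<le> N" "0 < \<nu>"
  shows "h \<le> \<nu>" "\<Delta> \<le> \<nu>"
proof -
  have l: "ln (1 + \<epsilon>) \<le> 1" using ln_add_one_self_le_self[of \<epsilon>] eps by linarith
  have "1 \<le> N * \<nu>" using assms(1,3) by (simp add: pos_divide_le_eq)
  then show "\<Delta> \<le> \<nu>" using l N_max_ge(3) by (simp add: step_Delta_def pos_divide_le_eq mult.commute)
  have "1 \<le> N * (llr_bound I * \<nu>)" using assms(2,3) llr_bound_pos by (simp add: pos_divide_le_eq)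
  also have "\<dots> \<le> \<nu> * Lambda I \<alpha>" using Lambda_ge(1) assms(3) by (simp add: ac_simps)
  finally show "h \<le> \<nu>" using l Lambda_ge(2) by (simp add: step_h_def pos_divide_le_eq)
qed

text \<open>The additive form of the guarantee. The assumption on \<open>\<nu>\<close> is the
  conclusion of \<open>rounded_le_obj_few_hits\<close>, and \<open>R\<close> is large enough that
  more than \<open>R\<close> hits outweigh every prior ratio.\<close>

lemma cost_le_add_k_max:
  assumes run: "(res, n) \<in> algorithm I \<alpha> \<epsilon>"
    and \<nu>: "\<And>y y' r h \<Delta>. (y, y') \<in> pair_set I \<Longrightarrow> hits r y y' \<le> R \<Longrightarrow>
      0 < h \<Longrightarrow> h \<le> \<nu> \<Longrightarrow> 0 < \<Delta> \<Longrightarrow> \<Delta> \<le> \<nu> \<Longrightarrow>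
      \<exists>u\<in>gridpoints h. \<forall>s\<in>{0..1}. rounded (prior I y' / prior I y) \<Delta> (\<lambda>m. r m + nat (k_max I)) y y' u
        \<le> obj (prior I y' / prior I y) r y y' s"
    and R: "ln (prior_max I / prior_min I) \<le> kappa_min I / 2 * real R"
    and small: "h \<le> \<nu>" "\<Delta> \<le> \<nu>"
    and feas: "surrogate_feasible I \<alpha> r"
  shows "\<exists>r'. res = Some r' \<and> cost I r' \<le> cost I r + real (nat (k_max I)) * price_sum I"
proof -
  let ?k = "nat (k_max I)"
  have main: "\<exists>r'. res = Some r' \<and> cost I r' \<le> cost I r + real ?k * price_sum I"
    if feas: "surrogate_feasible I \<alpha> r" and cost: "cost I r \<le> real (nat (n_unif I \<alpha>)) * price_sum I" for r
  proof -
    let ?r = "\<lambda>m. r m + ?k"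
    \<comment> \<open>The origin of the ratio \<open>price_sum\<close> / \<open>price_min\<close> in
      \<open>N_max\<close>: it turns the cost of the uniform design into a bound on the number of
      samples.\<close>
    have "real (\<Sum>m\<in>models I. r m) \<le> cost I r / price_min I"
      using samples_le_cost[of r] price_min_pos by (simp add: pos_le_divide_eq mult.commute)
    also have "\<dots> \<le> of_int (n_unif I \<alpha>) * price_sum I / price_min I"
      using cost n_unif_ge_1 price_min_pos by (intro divide_right_mono) auto
    finally have total: "real (\<Sum>m\<in>models I. ?r m) \<le> N"
      using k_max_ge_1 by (simp add: N_max_def sum.distrib mult.commute)
    \<comment> \<open>The enlarged design passes the rounded test with the infima of
      \<open>r\<close> itself as bounds, so the tolerances are met by the feasibility of
      \<open>r\<close>.\<close>
    have grid: "\<exists>u\<in>gridpoints h. rounded (ratio y y') \<Delta> ?r y y' u \<le> (INF s\<in>{0..1}. obj (ratio y y') r y y' s)"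
      if p: "(y, y') \<in> pair_set I" for y y'
    proof -
      have "\<exists>u\<in>gridpoints h. \<forall>s\<in>{0..1}. rounded (ratio y y') \<Delta> ?r y y' u \<le> obj (ratio y y') r y y' s"
      proof (cases "hits r y y' \<le> R")
        case True
        then show ?thesis using \<nu>[OF p _ steps_pos(1) small(1) steps_pos(2) small(2)] by blast
      next
        case False
        obtain s where s: "s \<in> {0..1}" "\<forall>u\<in>{0..1}. obj (ratio y y') r y y' s \<le> obj (ratio y y') r y y' u"
          using obj_attains_min[OF ratio_pos[OF p] p] .
        have "kappa_min I / 2 * real R \<le> kappa_min I / 2 * real (hits r y y')"
          using False kappa_min_pos by (intro mult_left_mono) auto
        then have "\<bar>ln (ratio y y')\<bar> \<le> kappa_min I / 2 * real (hits r y y')"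
          using R abs_ln_ratio_le[OF p] by linarith
        then obtain s' where s': "s' \<in> {delta I..1 - delta I}" "obj (ratio y y') r y y' s' \<le> obj (ratio y y') r y y' s"
          using obj_le_on_delta_interval[OF ratio_pos[OF p] p _ s(1)] by blast
        have s01: "s' \<in> {0..1}" using s'(1) delta_interval_subset by blast
        obtain u where u: "u \<in> gridpoints h" "rounded (ratio y y') \<Delta> ?r y y' u \<le> 4 * obj (ratio y y') ?r y y' s'"
          using rounded_le_4_obj[OF p s01 total] .
        have "obj (ratio y y') ?r y y' s' \<le> obj (ratio y y') r y y' s' * (1 / 4)"
          unfolding obj_add_const using prod_chern_power_k_max[OF p s'(1)] obj_pos[OF ratio_pos[OF p] p s01]
          by (intro mult_left_mono) (auto intro: less_imp_le)
        then have "rounded (ratio y y') \<Delta> ?r y y' u \<le> obj (ratio y y') r y y' s" using u(2) s'(2) by linarith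
        then show ?thesis using u(1) s(2) by force
      qed
      then show ?thesis by (auto intro!: cINF_greatest)
    qed
    have "(\<Sum>y'\<in>labels I - {y}. INF s\<in>{0..1}. obj (ratio y y') r y y' s) \<le> \<alpha> y" if "y \<in> labels I" for y
      using feas that by (simp add: surrogate_feasible_def surrogate_error_eq)
    from candidate_cost[OF run total grid this] show ?thesis unfolding cost_add_const by blast
  qed
  show ?thesis
  proof (cases "cost I r \<le> real (nat (n_unif I \<alpha>)) * price_sum I")
    case True
    then show ?thesis using main feas by blast
  next
    case False
    \<comment> \<open>A costlier design is compared through the uniform one, which is feasible and
      to which \<open>main\<close> applies.\<close>
    then show ?thesis using main[OF uniform_feasible] by (force simp: cost_const)
  qed
qed

end

lemma (in multi_label_ensemble) near_optimal:
  assumes eps: "0 < \<epsilon>" "\<epsilon> \<le> 1"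
  shows "\<exists>a0>0. \<forall>\<alpha>. valid_tolerance I \<alpha> \<and> tol_min I \<alpha> \<le> a0 \<longrightarrow>
           (\<forall>(res, n)\<in>algorithm I \<alpha> \<epsilon>. \<exists>r. res = Some r \<and>
              cost I r \<le> (1 + \<epsilon>) * surrogate_opt I \<alpha>)"
proof -
  let ?k = "nat (k_max I)" and ?B = "llr_bound I" and ?R = "ln (prior_max I / prior_min I)"
  define R where "R = nat \<lceil>?R / (kappa_min I / 2)\<rceil>"
  have "?R / (kappa_min I / 2) \<le> real R" unfolding R_def by linarith
  then have R: "?R \<le> kappa_min I / 2 * real R"
    using kappa_min_pos by (simp add: pos_divide_le_eq mult.commute)
  have "1 \<le> ?k" using k_max_ge_1 by simp
  from rounded_le_obj_few_hits[OF this, of R]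
  obtain \<nu> where \<nu>: "0 < \<nu>" "\<And>y y' r h \<Delta>. (y, y') \<in> pair_set I \<Longrightarrow> hits r y y' \<le> R \<Longrightarrow>
      0 < h \<Longrightarrow> h \<le> \<nu> \<Longrightarrow> 0 < \<Delta> \<Longrightarrow> \<Delta> \<le> \<nu> \<Longrightarrow>
      \<exists>u\<in>gridpoints h. \<forall>s\<in>{0..1}. rounded (prior I y' / prior I y) \<Delta> (\<lambda>m. r m + ?k) y y' u
        \<le> obj (prior I y' / prior I y) r y y' s" by blast
  \<comment> \<open>Lower bounds to be imposed on ln(1 / \<open>tol_min\<close>). The first two make
    \<open>N_max\<close> large enough that both step sizes are at most \<open>\<nu>\<close>; the
    third makes \<epsilon> times the cost of any feasible design exceed or equal the cost of the
    extra samples. The threshold \<open>a0\<close> is exp(-\<open>Z\<close>).\<close>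
  define z1 z2 z3 where "z1 = 1 / \<nu> * (- ln (rho I))" and "z2 = 1 / (?B * \<nu>) * (- ln (rho I))"
    and "z3 = ?R + ?B * (real ?k * price_sum I / (\<epsilon> * price_min I))"
  define Z where "Z = max z1 (max z2 z3)"
  have "\<exists>r'. res = Some r' \<and> cost I r' \<le> (1 + \<epsilon>) * surrogate_opt I \<alpha>"
    if small_tol: "valid_tolerance I \<alpha>" "tol_min I \<alpha> \<le> exp (- Z)" and run: "(res, n) \<in> algorithm I \<alpha> \<epsilon>" for \<alpha> res n
  proof -
    interpret algorithm_run I \<alpha> \<epsilon> by unfold_locales (use small_tol eps in auto)
    have "ln (tol_min I \<alpha>) \<le> ln (exp (- Z))"
      using small_tol(2) tol_min_bounds(1) by (subst ln_le_cancel_iff) auto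
    then have Z: "Z \<le> ln (1 / tol_min I \<alpha>)" using tol_min_bounds(1) by (simp add: ln_div)
    have N: "z / (- ln (rho I)) \<le> N" if "z \<le> Z" for z
    proof -
      have "z / (- ln (rho I)) \<le> ln (1 / tol_min I \<alpha>) / (- ln (rho I))"
        using that Z ln_rho_pos by (intro divide_right_mono) auto
      then show ?thesis using n_unif_ge N_max_ge(2) by linarith
    qed
    have "1 / \<nu> \<le> N" "1 / (?B * \<nu>) \<le> N"
      using N[of z1] N[of z2] ln_rho_pos by (auto simp: Z_def z1_def z2_def)
    note small = steps_le[OF this \<nu>(1)]
    obtain r' where r': "res = Some r'" using algorithm_finds_design[OF run] by blast
    have bound: "cost I r' / (1 + \<epsilon>) \<le> cost I r" if feas: "surrogate_feasible I \<alpha> r" for r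
    proof -
      have "?B * (real ?k * price_sum I / (\<epsilon> * price_min I)) \<le> ?B * real (\<Sum>m\<in>models I. r m)"
        using feasible_samples_ge[OF tol feas] Z by (simp add: Z_def z3_def)
      then have "real ?k * price_sum I / (\<epsilon> * price_min I) \<le> real (\<Sum>m\<in>models I. r m)"
        using llr_bound_pos by (simp only: mult_le_cancel_left_pos)
      then have "real ?k * price_sum I \<le> \<epsilon> * (price_min I * real (\<Sum>m\<in>models I. r m))"
        using eps price_min_pos by (simp add: pos_divide_le_eq ac_simps)
      also have "\<dots> \<le> \<epsilon> * cost I r" using samples_le_cost[of r] eps by (intro mult_left_mono) auto
      finally have "real ?k * price_sum I \<le> \<epsilon> * cost I r" .
      moreover have "cost I r' \<le> cost I r + real ?k * price_sum I"
        using cost_le_add_k_max[OF run \<nu>(2) R small feas] r' by auto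
      ultimately have "cost I r' \<le> cost I r * (1 + \<epsilon>)" by (simp add: algebra_simps)
      then show ?thesis using eps by (simp add: pos_divide_le_eq)
    qed
    have "cost I r' / (1 + \<epsilon>) \<le> surrogate_opt I \<alpha>"
      unfolding surrogate_opt_def using bound uniform_feasible by (intro cInf_greatest) auto
    then show ?thesis using r' eps by (simp add: pos_divide_le_eq mult.commute)
  qed
  then show ?thesis by (intro exI[of _ "exp (- Z)"]) auto
qed


section \<open>Polynomial running time\<close>

context algorithm_run
begin

lemma inverse_ln_le: "1 / ln (1 + \<epsilon>) \<le> 2 / \<epsilon>"
proof -
  have "\<epsilon> / 2 \<le> ln (1 + \<epsilon>)"
  proof -
    have "ln (1 / (1 + \<epsilon>)) \<le> 1 / (1 + \<epsilon>) - 1" using eps by (intro ln_le_minus_one) simp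
    then have "\<epsilon> / (1 + \<epsilon>) \<le> ln (1 + \<epsilon>)" using eps by (simp add: ln_div field_simps)
    moreover have "\<epsilon> / 2 \<le> \<epsilon> / (1 + \<epsilon>)" using eps by (intro divide_left_mono) auto
    ultimately show ?thesis by linarith
  qed
  moreover have "0 < \<epsilon> / 2" using eps by simp
  ultimately have "1 / ln (1 + \<epsilon>) \<le> 1 / (\<epsilon> / 2)" by (intro divide_left_mono) auto
  then show ?thesis by simp
qed

text \<open>The exponents arise as follows. Both \<open>n_unif\<close> and the price ratio, through
  the number of models, are of order \<open>S\<close>, so \<open>N_max\<close> is of order S^2. The
  grid size \<open>Lambda\<close> / ln(1 + \<epsilon>) gains one factor from 1 / \<epsilon>, and
  \<open>T_max\<close> is of order \<open>N_max\<close>^2 / ln(1 + \<epsilon>).\<close>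

lemma size_bounds:
  assumes data: "data_bounded b \<kappa> \<gamma> \<tau> a I" and \<kappa>: "0 < \<kappa>"
  defines "S \<equiv> real (nmodels I) + ln (1 / tol_min I \<alpha>) + 1 / \<epsilon>"
    and "\<eta> \<equiv> min (\<kappa> / (4 * b\<^sup>2)) (1 / 4) * \<kappa> / 2"
  defines "c1 \<equiv> ((real (nlabels I) * \<tau> + 1) / \<eta> + 1) * \<gamma> + (2 / \<eta> + 1)"
  shows "real (nat \<lfloor>1 / h\<rfloor> + 2) \<le> (2 * (\<tau> + b * c1) + 2) * S ^ 3"
    and "real (T + 1) \<le> (2 * b * c1\<^sup>2 + 2) * S ^ 5"
    and "real (nmodels I) \<le> S" "1 \<le> S"
proof -
  let ?B = "llr_bound I" and ?l = "ln (1 / tol_min I \<alpha>)"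
  have B: "?B \<le> b" and k: "\<kappa> \<le> kappa_min I" and g: "price_max I \<le> \<gamma> * price_min I"
    and t: "prior_max I \<le> \<tau> * prior_min I"
    using data by (auto simp: data_bounded_def)
  have b: "0 < b" using B llr_bound_pos by linarith
  have \<tau>: "1 \<le> \<tau>"
  proof -
    have "1 * prior_min I \<le> \<tau> * prior_min I" using t prior_min_le_max by linarith
    then show ?thesis using prior_min_pos by (simp only: mult_le_cancel_right_pos)
  qed
  have price_le: "price I m \<le> price_max I" if "m \<in> models I" for m
    unfolding price_max_def using that by (intro Max_ge) auto
  have \<gamma>: "1 \<le> \<gamma>"
  proof -
    have "price_min I \<le> price_max I" using price_min_le[of 1] price_le[of 1] nmodels_ge_1 by simp
    then have "1 * price_min I \<le> \<gamma> * price_min I" using g by linarith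
    then show ?thesis using price_min_pos by (simp only: mult_le_cancel_right_pos)
  qed
  have ieps: "1 \<le> 1 / \<epsilon>" using eps by simp
  show K: "real (nmodels I) \<le> S" using ln_inverse_tol_min_pos ieps unfolding S_def by linarith
  show S1: "1 \<le> S" using ln_inverse_tol_min_pos ieps unfolding S_def by linarith
  have lS: "?l \<le> S" using ieps unfolding S_def by linarith
  have eS: "1 / \<epsilon> \<le> S" using ln_inverse_tol_min_pos unfolding S_def by linarith
  have \<eta>: "0 < \<eta>" unfolding \<eta>_def using \<kappa> b by simp
  \<comment> \<open>The data bounds err in the right direction: a larger \<open>kappa_min\<close>
    and a smaller B only enlarge \<open>delta\<close> and \<open>gap\<close>.\<close>
  have \<eta>_gap: "\<eta> \<le> gap"
  proof -
    have "\<kappa> / (4 * b\<^sup>2) \<le> kappa_min I / (4 * ?B\<^sup>2)"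
      using k \<kappa> B llr_bound_pos by (intro frac_le mult_left_mono power_mono) auto
    then have "min (\<kappa> / (4 * b\<^sup>2)) (1 / 4) \<le> delta I" unfolding delta_def by auto
    then have "min (\<kappa> / (4 * b\<^sup>2)) (1 / 4) * \<kappa> \<le> delta I * kappa_min I"
      using k \<kappa> delta_bounds(1) by (intro mult_mono) auto
    then show ?thesis by (simp add: \<eta>_def gap_def)
  qed
  \<comment> \<open>From -ln q \<ge> 1 - q. It bounds the denominators in \<open>n_unif\<close> and
    \<open>k_max\<close> away from 0 uniformly over the family.\<close>
  have ln_ge: "\<eta> \<le> - ln q" if "0 < q" "q \<le> 1 - gap" for q :: real
    using ln_le_minus_one[of q] that \<eta>_gap by linarith
  have n: "of_int (n_unif I \<alpha>) \<le> ((real (nlabels I) * \<tau> + 1) / \<eta> + 1) * S"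
  proof -
    have n_arg_pos: "0 < n_arg" using n_arg_ge tol_min_bounds(1) by (meson less_le_trans zero_less_divide_1_iff)
    have "n_arg \<le> real (nlabels I) * \<tau> * (1 / tol_min I \<alpha>)"
    proof -
      have "prior_max I / prior_min I \<le> \<tau>" using t prior_min_pos by (simp add: pos_divide_le_eq)
      then have "(real (nlabels I) - 1) * (prior_max I / prior_min I) \<le> real (nlabels I) * \<tau>"
        using two_labels prior_min_pos prior_min_le_max by (intro mult_mono) auto
      then have "(real (nlabels I) - 1) * (prior_max I / prior_min I) * (1 / tol_min I \<alpha>)
          \<le> real (nlabels I) * \<tau> * (1 / tol_min I \<alpha>)"
        using tol_min_bounds(1) by (intro mult_right_mono) auto
      then show ?thesis by (simp add: n_arg_def)
    qed
    then have "ln n_arg \<le> ln (real (nlabels I) * \<tau> * (1 / tol_min I \<alpha>))"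
      using n_arg_pos by (subst ln_le_cancel_iff) auto
    also have "\<dots> = ln (real (nlabels I) * \<tau>) + ?l"
      using two_labels \<tau> tol_min_bounds(1) by (subst ln_mult_pos) auto
    also have "\<dots> \<le> real (nlabels I) * \<tau> + S"
    proof -
      have "0 < real (nlabels I) * \<tau>" using two_labels \<tau> by (intro mult_pos_pos) auto
      then show ?thesis using ln_le_minus_one[of "real (nlabels I) * \<tau>"] lS by linarith
    qed
    also have "\<dots> \<le> (real (nlabels I) * \<tau> + 1) * S"
    proof -
      have "real (nlabels I) * \<tau> * 1 \<le> real (nlabels I) * \<tau> * S"
        using S1 \<tau> by (intro mult_left_mono) auto
      then show ?thesis by (simp add: distrib_right)
    qed
    finally have "ln n_arg \<le> (real (nlabels I) * \<tau> + 1) * S" .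
    then have "ln n_arg / (- ln (rho I)) \<le> (real (nlabels I) * \<tau> + 1) * S / \<eta>"
      using ln_ge[OF rho_bounds] \<eta> \<tau> S1 by (intro frac_le) auto
    moreover have "of_int (n_unif I \<alpha>) \<le> ln n_arg / (- ln (rho I)) + 1"
      unfolding n_unif_def n_arg_def by (rule of_int_ceiling_le_add_one)
    ultimately show ?thesis using S1 by (simp add: distrib_right)
  qed
  have km: "of_int (k_max I) \<le> 2 / \<eta> + 1"
  proof -
    have "2 * ln 2 \<le> (2 :: real)" using ln_le_minus_one[of 2] by simp
    then have "2 * ln 2 / (- ln (vartheta I)) \<le> 2 / \<eta>"
      using ln_ge[OF vartheta_bounds] \<eta> by (intro frac_le) auto
    moreover have "of_int (k_max I) \<le> 2 * ln 2 / (- ln (vartheta I)) + 1"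
      unfolding k_max_def by (rule of_int_ceiling_le_add_one)
    ultimately show ?thesis by linarith
  qed
  have price: "price_sum I / price_min I \<le> \<gamma> * S"
  proof -
    have "price_sum I \<le> real (nmodels I) * (\<gamma> * price_min I)"
      using sum_bounded_above[of "models I" "price I" "\<gamma> * price_min I"] price_le g
      by (fastforce simp: price_sum_def)
    also have "\<dots> \<le> S * (\<gamma> * price_min I)" using K \<gamma> price_min_pos by (intro mult_right_mono) auto
    finally show ?thesis using price_min_pos by (simp add: pos_divide_le_eq ac_simps)
  qed
  have N: "N \<le> c1 * S\<^sup>2"
  proof -
    have nn: "0 \<le> real_of_int (n_unif I \<alpha>)" "0 \<le> real_of_int (k_max I)" using n_unif_ge_1 k_max_ge_1 by auto
    have "of_int (n_unif I \<alpha>) * (price_sum I / price_min I)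
        \<le> (((real (nlabels I) * \<tau> + 1) / \<eta> + 1) * S) * (\<gamma> * S)"
      using n price nn price_sum_pos price_min_pos by (intro mult_mono) auto
    moreover have "of_int (k_max I) * real (nmodels I) \<le> (2 / \<eta> + 1) * S\<^sup>2"
    proof (rule mult_mono[OF km])
      have "S * 1 \<le> S * S" using S1 by (intro mult_left_mono) auto
      then show "real (nmodels I) \<le> S\<^sup>2" using K unfolding power2_eq_square by linarith
      show "0 \<le> 2 / \<eta> + 1" using \<eta> by (simp add: add_nonneg_nonneg)
    qed auto
    ultimately show ?thesis by (simp add: N_max_def c1_def power2_eq_square algebra_simps)
  qed
  have c1: "0 \<le> c1"
  proof -
    have "0 < c1 * S\<^sup>2" using N N_max_ge(3) by linarith
    then show ?thesis using S1 by (simp add: zero_less_mult_iff)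
  qed
  have pow: "1 \<le> S ^ i" for i using S1 by simp
  have BN: "?B * N \<le> b * (c1 * S\<^sup>2)" using B N N_max_ge(3) llr_bound_pos b by (intro mult_mono) auto
  have ie: "1 / ln (1 + \<epsilon>) \<le> 2 * S" using inverse_ln_le eS by simp
  have ie0: "0 \<le> 1 / ln (1 + \<epsilon>)" using eps by simp
  have Lam: "Lambda I \<alpha> \<le> (\<tau> + b * c1) * S\<^sup>2"
  proof -
    have "ln (prior_max I / prior_min I) \<le> prior_max I / prior_min I - 1"
      using prior_min_pos prior_min_le_max by (intro ln_le_minus_one) auto
    also have "\<dots> \<le> \<tau> * 1" using t prior_min_pos by (simp add: pos_divide_le_eq algebra_simps)
    also have "\<dots> \<le> \<tau> * S\<^sup>2" using pow[of 2] \<tau> by (intro mult_left_mono) auto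
    finally show ?thesis using BN by (simp add: Lambda_def distrib_right mult.assoc)
  qed
  have "1 / h = Lambda I \<alpha> * (1 / ln (1 + \<epsilon>))" by (simp add: step_h_def)
  also have "\<dots> \<le> ((\<tau> + b * c1) * S\<^sup>2) * (2 * S)"
    using Lam ie ie0 Lambda_ge(2) by (intro mult_mono) auto
  also have "\<dots> = 2 * (\<tau> + b * c1) * S ^ 3" by (simp add: power2_eq_square power3_eq_cube)
  finally have h: "1 / h \<le> 2 * (\<tau> + b * c1) * S ^ 3" .
  have "real (nat \<lfloor>1 / h\<rfloor>) \<le> 1 / h" using steps_pos(1) by (intro of_nat_floor) simp
  then show "real (nat \<lfloor>1 / h\<rfloor> + 2) \<le> (2 * (\<tau> + b * c1) + 2) * S ^ 3"
    using h pow[of 3] by (simp add: distrib_right)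
  have "?B * N / \<Delta> = (?B * N) * N * (1 / ln (1 + \<epsilon>))" by (simp add: step_Delta_def)
  also have "\<dots> \<le> (b * (c1 * S\<^sup>2)) * (c1 * S\<^sup>2) * (2 * S)"
    using N_max_ge(3) llr_bound_pos b c1 ie0 by (intro mult_mono[OF mult_mono[OF BN N] ie]) auto
  also have "\<dots> = 2 * b * c1\<^sup>2 * S ^ 5" by (simp add: power2_eq_square eval_nat_numeral)
  finally have T: "?B * N / \<Delta> \<le> 2 * b * c1\<^sup>2 * S ^ 5" .
  have "0 \<le> ?B * N / \<Delta>" using llr_bound_pos N_max_ge(3) steps_pos(2) by simp
  then have "real T \<le> ?B * N / \<Delta> + 1" unfolding T_max_def by linarith
  then show "real (T + 1) \<le> (2 * b * c1\<^sup>2 + 2) * S ^ 5"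
    using T pow[of 5] by (simp add: distrib_right)
qed

end

lemma valid_ensembleD:
  assumes "valid_ensemble I"
  shows "1 \<le> nmodels I" "\<And>m. m \<in> models I \<Longrightarrow> 0 < price I m"
  using assms by (auto simp: valid_ensemble_def)

lemma polynomial_steps:
  fixes L :: nat
  assumes L: "1 \<le> L"
  shows "\<exists>d::nat. \<forall>b \<kappa> \<gamma> \<tau> a. 0 < \<kappa> \<longrightarrow> (\<exists>C::real. \<forall>(I :: 'x ensemble) \<alpha> \<epsilon>.
        valid_ensemble I \<and> nlabels I = L \<and> data_bounded b \<kappa> \<gamma> \<tau> a I \<and>
        valid_tolerance I \<alpha> \<and> 0 < \<epsilon> \<and> \<epsilon> \<le> 1 \<longrightarrow>
        (\<forall>(res, n)\<in>algorithm I \<alpha> \<epsilon>.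
           real n \<le> C * (real (nmodels I) + ln (1 / tol_min I \<alpha>) + 1 / \<epsilon>) ^ d))"
proof -
  define P where "P = L * (L - 1)"
  \<comment> \<open>One factor \<open>S\<close> for the number of models, 3 \<open>P\<close> for the
    grid, 5 \<open>P\<close> for the states and 5 for the length of backtracking.\<close>
  define d where "d = 8 * P + 6"
  have "\<exists>C::real. \<forall>(I :: 'x ensemble) \<alpha> \<epsilon>.
        valid_ensemble I \<and> nlabels I = L \<and> data_bounded b \<kappa> \<gamma> \<tau> a I \<and>
        valid_tolerance I \<alpha> \<and> 0 < \<epsilon> \<and> \<epsilon> \<le> 1 \<longrightarrow>
        (\<forall>(res, n)\<in>algorithm I \<alpha> \<epsilon>.
           real n \<le> C * (real (nmodels I) + ln (1 / tol_min I \<alpha>) + 1 / \<epsilon>) ^ d)"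
    if \<kappa>: "0 < \<kappa>" for b \<kappa> \<gamma> \<tau> :: real and a :: nat
  proof -
    define \<eta> where "\<eta> = min (\<kappa> / (4 * b\<^sup>2)) (1 / 4) * \<kappa> / 2"
    define c1 where "c1 = ((real L * \<tau> + 1) / \<eta> + 1) * \<gamma> + (2 / \<eta> + 1)"
    define cG where "cG = 2 * (\<tau> + b * c1) + 2"
    define cT where "cT = 2 * b * c1\<^sup>2 + 2"
    define A where "A = real ((L + 20) * (P + 1) ^ 2 * (a + 1))"
    \<comment> \<open>With one label \<open>P\<close> is 0, and the step count is at most
      \<open>A\<close> times the number of models; the constants from \<open>size_bounds\<close>
      belong to the case of several labels.\<close>
    define C where "C = A * (if L = 1 then 1 else cG ^ P * cT ^ P * (real (P + 1) * cT))"
    have A0: "0 \<le> A" by (simp add: A_def)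
    have "real n \<le> C * (real (nmodels I) + ln (1 / tol_min I \<alpha>) + 1 / \<epsilon>) ^ d"
      if I: "valid_ensemble I" "nlabels I = L" "data_bounded b \<kappa> \<gamma> \<tau> a I"
        and tol: "valid_tolerance I \<alpha>" and eps: "0 < \<epsilon>" "\<epsilon> \<le> 1"
        and run: "(res, n) \<in> algorithm I \<alpha> \<epsilon>" for I :: "'x ensemble" and \<alpha> \<epsilon> res n
    proof -
      define S where "S = real (nmodels I) + ln (1 / tol_min I \<alpha>) + 1 / \<epsilon>"
      define G where "G = nat \<lfloor>1 / step_h I \<alpha> \<epsilon>\<rfloor> + 2"
      define T where "T = T_max I \<alpha> \<epsilon>"
      have lenP: "length (pairs I) = P" using I(2) by (simp add: length_pairs P_def)
      have "\<forall>m\<in>models I. card (alphabet I m) \<le> a" using I(3) unfolding data_bounded_def by blast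
      then have "n \<le> (L + 20) * (P + 1) ^ 2 * (a + 1) * (nmodels I * G ^ P * (T + 1) ^ P * (P * T + 1))"
        using algorithm_steps_le[OF valid_ensembleD(1)[OF I(1)] _ run]
        by (simp only: I(2) lenP G_def T_def)
      then have "real n \<le> real ((L + 20) * (P + 1) ^ 2 * (a + 1) *
          (nmodels I * G ^ P * (T + 1) ^ P * (P * T + 1)))"
        by (simp only: of_nat_le_iff)
      then have n: "real n \<le> A * (real (nmodels I) * real G ^ P * real (T + 1) ^ P * real (P * T + 1))"
        unfolding A_def by (simp only: of_nat_mult of_nat_power)
      show ?thesis
      proof (cases "L = 1")
        case True
        then have P0: "P = 0" by (simp add: P_def)
        have "tol_min I \<alpha> = \<alpha> 1" using I(2) True by (simp add: tol_min_def)
        then have "0 < tol_min I \<alpha>" "tol_min I \<alpha> < 1" using tol I(2) True by (auto simp: valid_tolerance_def)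
        then have l: "0 \<le> ln (1 / tol_min I \<alpha>)" by simp
        have "1 \<le> 1 / \<epsilon>" using eps by simp
        then have S: "real (nmodels I) \<le> S" "1 \<le> S" using l unfolding S_def by linarith+
        have "real (nmodels I) \<le> S ^ d" using S self_le_power[of S d] by (simp add: d_def)
        then have "A * real (nmodels I) \<le> A * S ^ d" using A0 by (rule mult_left_mono)
        then show ?thesis using n P0 True by (simp add: C_def S_def)
      next
        case False
        then have "2 \<le> nlabels I" using I(2) L by simp
        then interpret algorithm_run I \<alpha> \<epsilon>
          by unfold_locales (use I tol eps in auto)
        note sb = size_bounds[OF I(3) \<kappa>, folded S_def, unfolded I(2), folded \<eta>_def, folded c1_def, folded cG_def cT_def]
        have G: "real G \<le> cG * S ^ 3" using sb(1) by (simp add: G_def)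
        have T: "real (T + 1) \<le> cT * S ^ 5" using sb(2) by (simp add: T_def)
        have S1: "1 \<le> S" by (rule sb(4))
        have PT: "real (P * T + 1) \<le> real (P + 1) * (cT * S ^ 5)"
        proof -
          have "P * T + 1 \<le> (P + 1) * (T + 1)" by simp
          then have "real (P * T + 1) \<le> real (P + 1) * real (T + 1)"
            by (simp only: of_nat_le_iff of_nat_mult[symmetric])
          also have "\<dots> \<le> real (P + 1) * (cT * S ^ 5)" using T by (intro mult_left_mono) auto
          finally show ?thesis .
        qed
        have "real (nmodels I) * real G ^ P * real (T + 1) ^ P * real (P * T + 1)
            \<le> S * (cG * S ^ 3) ^ P * (cT * S ^ 5) ^ P * (real (P + 1) * (cT * S ^ 5))"
        proof -
          have "0 \<le> cG * S ^ 3" "0 \<le> cT * S ^ 5" using G T by linarith+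
          moreover have "real G ^ P \<le> (cG * S ^ 3) ^ P" "real (T + 1) ^ P \<le> (cT * S ^ 5) ^ P"
            using G T by (simp_all add: power_mono del: of_nat_add of_nat_Suc)
          ultimately show ?thesis
            using S1 by (intro mult_mono[OF mult_mono[OF mult_mono[OF sb(3)]]] PT) auto
        qed
        also have "\<dots> = (cG ^ P * cT ^ P * (real (P + 1) * cT)) * S ^ d"
          unfolding d_def power_mult_distrib power_mult[symmetric]
          by (simp add: power_add[symmetric] ac_simps flip: power_Suc)
        finally have "A * (real (nmodels I) * real G ^ P * real (T + 1) ^ P * real (P * T + 1))
            \<le> A * ((cG ^ P * cT ^ P * (real (P + 1) * cT)) * S ^ d)"
          using A0 by (rule mult_left_mono)
        then show ?thesis using n False by (simp add: C_def S_def mult.assoc)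
      qed
    qed
    then show ?thesis by (intro exI[of _ C]) blast
  qed
  then show ?thesis by blast
qed

section \<open>The case of a single label\<close>

lemma surrogate_error_single_label:
  assumes "nlabels I = 1" "y \<in> labels I"
  shows "surrogate_error I y r = 0"
proof -
  have "labels I - {y} = {}" using assms by auto
  then show ?thesis unfolding surrogate_error_def by (simp only: sum.empty)
qed

text \<open>The grid and the set of states each consist of the empty list alone, whatever values the
  constants take, and the empty state is reached by the zero design.\<close>

lemma algorithm_single_label:
  assumes I: "valid_ensemble I" "nlabels I = 1" and tol: "valid_tolerance I \<alpha>"
    and run: "(res, n) \<in> algorithm I \<alpha> \<epsilon>"
  shows "\<exists>r. res = Some r \<and> cost I r \<le> 0"
proof -
  have P: "pairs I = []" using length_pairs[of I] I(2) by simp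
  have "[] \<in> set (grid I (step_h I \<alpha> \<epsilon>))" by (simp add: grid_def P)
  moreover have "[] \<in> set (states I (T_max I \<alpha> \<epsilon>))" by (simp add: mem_states P)
  moreover have "admissible I \<alpha> (step_Delta I \<alpha> \<epsilon>) [] []"
    using tol I(2) by (auto simp: admissible_def valid_tolerance_def intro: less_imp_le)
  moreover have "reaches I (weights I (step_Delta I \<alpha> \<epsilon>) []) (\<lambda>_. 0) []" by (simp add: reaches_def)
  ultimately have "\<exists>r. res = Some r \<and> cost I r \<le> cost I (\<lambda>_. 0)"
    using algorithm_correct(2)[OF valid_ensembleD(2)[OF I(1)] run] by blast
  then show ?thesis by (simp add: cost_def)
qed

text \<open>Nonemptiness keeps the claims about all runs from being vacuous. In the running time the
  degree depends on \<open>L\<close> alone, while \<open>C\<close> may depend on the data bounds but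
  not on the number of models.\<close>

theorem theorem4p10:
  fixes L :: nat
  assumes "1 \<le> L"
  shows
    "(\<forall>(I :: 'x ensemble) \<epsilon>. valid_ensemble I \<and> nlabels I = L \<and> 0 < \<epsilon> \<and> \<epsilon> \<le> 1 \<longrightarrow>
        (\<forall>\<alpha>. valid_tolerance I \<alpha> \<longrightarrow>
           algorithm I \<alpha> \<epsilon> \<noteq> {} \<and>
           (\<forall>(res, n)\<in>algorithm I \<alpha> \<epsilon>. \<exists>r. res = Some r \<and>
              (\<forall>y\<in>labels I. surrogate_error I y r \<le> \<alpha> y))) \<and>
        (\<exists>a0>0. \<forall>\<alpha>. valid_tolerance I \<alpha> \<and> tol_min I \<alpha> \<le> a0 \<longrightarrow>
           (\<forall>(res, n)\<in>algorithm I \<alpha> \<epsilon>. \<exists>r. res = Some r \<and>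
              cost I r \<le> (1 + \<epsilon>) * surrogate_opt I \<alpha>))) \<and>
     (\<exists>d::nat. \<forall>b \<kappa> \<gamma> \<tau> a. 0 < \<kappa> \<longrightarrow> (\<exists>C::real. \<forall>(I :: 'x ensemble) \<alpha> \<epsilon>.
        valid_ensemble I \<and> nlabels I = L \<and> data_bounded b \<kappa> \<gamma> \<tau> a I \<and>
        valid_tolerance I \<alpha> \<and> 0 < \<epsilon> \<and> \<epsilon> \<le> 1 \<longrightarrow>
        (\<forall>(res, n)\<in>algorithm I \<alpha> \<epsilon>.
           real n \<le> C * (real (nmodels I) + ln (1 / tol_min I \<alpha>) + 1 / \<epsilon>) ^ d)))"
proof (intro conjI allI impI)
  fix I :: "'x ensemble" and \<epsilon> :: real and \<alpha> :: "nat \<Rightarrow> real"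
  assume I: "valid_ensemble I \<and> nlabels I = L \<and> 0 < \<epsilon> \<and> \<epsilon> \<le> 1"
  show "algorithm I \<alpha> \<epsilon> \<noteq> {}" by (rule algorithm_nonempty)
  assume tol: "valid_tolerance I \<alpha>"
  have "\<exists>r. res = Some r \<and> (\<forall>y\<in>labels I. surrogate_error I y r \<le> \<alpha> y)"
    if run: "(res, n) \<in> algorithm I \<alpha> \<epsilon>" for res n
  proof (cases "L = 1")
    case True
    obtain r where r: "res = Some r" using algorithm_single_label[OF _ _ tol run] I True by blast
    have "surrogate_error I y r \<le> \<alpha> y" if "y \<in> labels I" for y
      using surrogate_error_single_label[OF _ that] that tol I True
      by (simp add: valid_tolerance_def less_imp_le)
    then show ?thesis using r by blast
  next
    case False
    then interpret algorithm_run I \<alpha> \<epsilon> by unfold_locales (use I tol assms in auto)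
    show ?thesis using algorithm_finds_design[OF run] algorithm_feasible run by blast
  qed
  then show "\<forall>(res, n)\<in>algorithm I \<alpha> \<epsilon>. \<exists>r. res = Some r \<and>
      (\<forall>y\<in>labels I. surrogate_error I y r \<le> \<alpha> y)" by blast
next
  fix I :: "'x ensemble" and \<epsilon> :: real
  assume I: "valid_ensemble I \<and> nlabels I = L \<and> 0 < \<epsilon> \<and> \<epsilon> \<le> 1"
  show "\<exists>a0>0. \<forall>\<alpha>. valid_tolerance I \<alpha> \<and> tol_min I \<alpha> \<le> a0 \<longrightarrow>
      (\<forall>(res, n)\<in>algorithm I \<alpha> \<epsilon>. \<exists>r. res = Some r \<and> cost I r \<le> (1 + \<epsilon>) * surrogate_opt I \<alpha>)"
  proof (cases "L = 1")
    case True
    have "\<exists>r. res = Some r \<and> cost I r \<le> (1 + \<epsilon>) * surrogate_opt I \<alpha>"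
      if tol: "valid_tolerance I \<alpha>" and run: "(res, n) \<in> algorithm I \<alpha> \<epsilon>" for \<alpha> res n
    proof -
      have "surrogate_feasible I \<alpha> (\<lambda>_. 0)"
        unfolding surrogate_feasible_def using tol surrogate_error_single_label[of I] I True
        by (simp add: valid_tolerance_def less_imp_le)
      then have "0 \<le> surrogate_opt I \<alpha>"
        unfolding surrogate_opt_def using cost_nonneg[OF valid_ensembleD(2)] I
        by (intro cInf_greatest) auto
      then have "0 \<le> (1 + \<epsilon>) * surrogate_opt I \<alpha>" using I by simp
      then show ?thesis using algorithm_single_label[OF _ _ tol run] I True by fastforce
    qed
    \<comment> \<open>For every tolerance the returned cost is at most 0 and the optimum is
      nonnegative, so 1 serves as \<open>a0\<close>.\<close>
    then show ?thesis by (intro exI[of _ 1]) auto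
  next
    case False
    then interpret multi_label_ensemble I by unfold_locales (use I assms in auto)
    show ?thesis using near_optimal I by blast
  qed
next
  show "\<exists>d::nat. \<forall>b \<kappa> \<gamma> \<tau> a. 0 < \<kappa> \<longrightarrow> (\<exists>C::real. \<forall>(I :: 'x ensemble) \<alpha> \<epsilon>.
        valid_ensemble I \<and> nlabels I = L \<and> data_bounded b \<kappa> \<gamma> \<tau> a I \<and>
        valid_tolerance I \<alpha> \<and> 0 < \<epsilon> \<and> \<epsilon> \<le> 1 \<longrightarrow>
        (\<forall>(res, n)\<in>algorithm I \<alpha> \<epsilon>.
           real n \<le> C * (real (nmodels I) + ln (1 / tol_min I \<alpha>) + 1 / \<epsilon>) ^ d))"
    by (rule polynomial_steps[OF assms])
qed

end
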